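(* Let $G=F(A)$ be the free group on a set $A$, equipped with the standard conjugation-invariant word norm, with stable length function $\tau$. Let $\Theta\subseteq G$ be a set of cyclically reduced representatives, one for each equivalence class, of the pure elements of $G$ under the relation $g\sim g'$ iff $g'$ is conjugate to $g$ or $g^{-1}$. Let $\eta\colon F_{\mathbb{R}}(G)\to\hat{\mathcal{C}}(G)$ be the homomorphism $$\eta\big(\overline{g_1}(r_1)\cdots\overline{g_k}(r_k)\big)=\big[\,t\mapsto g_1^{\lfloor r_1t\rfloor}\cdots g_k^{\lfloor r_kt\rfloor}\,\big].$$ The restriction of $\eta$ to $F_{\mathbb{R}}(\Theta)$ is an injective homomorphism $$\xi_\Theta\colon F_{\mathbb{R}}(\Theta;\tau)\to\hat{\mathcal{C}}(G)$$ with dense image. It is Lipschitz with constant $1$ and $\|\xi_\Theta(\alpha)\|=\|\alpha\|$ for all generators $\alpha=\overline{\theta}(r)\in F_{\mathbb{R}}(\Theta)$ ($\theta\in\Theta$, $r\in\mathbb{R}$). Upon completion, $$\hat{\xi}_\Theta\colon\widehat{F_{\mathbb{R}}(\Theta;\tau)}\to\hat{\mathcal{C}}(G)$$ is a metric quotient homomorphism.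
   Context: Standard word norm on $F(A)$: $\|g\|$ is the least $n\ge0$ such that $g$ is a product of $n$ conjugates of elements of $A\cup A^{-1}$. Stable length: $\tau(g)=\lim_{n\to\infty}\|g^n\|/n$. An element $g$ of a group $\Gamma$ is pure if, whenever $g=h^n$ with $h\in\Gamma$ and $n\in\mathbb{Z}$, one has $h=g^{\pm1}$ and $n=\pm1$. Norms. A norm on a group $G$ is a function $\|\cdot\|\colon G\to[0,\infty)$ with $\|g\|=0\iff g=1$, $\|g^{-1}\|=\|g\|$ and $\|gh\|\le\|g\|+\|h\|$; for a pseudonorm one only requires $\|1\|=0$ instead of the first condition. It is conjugation-invariant if $\|hgh^{-1}\|=\|g\|$ for all $g,h$. It induces the bi-invariant (pseudo)metric $d(g,h)=\|g^{-1}h\|$; all metric notions refer to it. A homomorphism $\varphi$ is Lipschitz with constant $C$ iff $\|\varphi(g)\|\le C\|g\|$ for all $g$. A surjective homomorphism $p\colon K\to L$ of groups with conjugation-invariant pseudonorms is a metric quotient if $\|l\|_L=\inf\{\|k\|_K:k\in p^{-1}(l)\}$ for all $l\in L$. The groups $F_{\mathbb{R}}(G)$ and $F(G)$. Let $G$ be a group with a conjugation-invariant norm. $F_{\mathbb{R}}(G)$ is the free product of copies of the additive group $\mathbb{R}$ indexed by the elements $g$ of the set $G$; the element $r$ of the copy indexed by $g$ is written $\overline{g}(r)$. It carries the conjugation-invariant pseudonorm $$\|x\|=\inf\Big\{\sum_{i=1}^n |r_i|\,\|g_i\| : x=\prod_{i=1}^n h_i\,\overline{g_i}(r_i)^{\pm1}h_i^{-1},\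 h_i\in F_{\mathbb{R}}(G)\Big\}.$$ $F(G)\le F_{\mathbb{R}}(G)$ is the subgroup generated by the elements $\overline{g}:=\overline{g}(1)$; it is free on $\{\overline{g}: g\in G\}$. For $t\in\mathbb{R}$, $\psi_t\colon F_{\mathbb{R}}(G)\to F_{\mathbb{R}}(G)$ is the homomorphism with $\psi_t(\overline{g}(r))=\overline{g}(tr)$. $\pi\colon F(G)\to G$ is the homomorphism with $\pi(\overline{g})=g$. $F_{\mathbb{R}}(\Theta)\le F_{\mathbb{R}}(G)$ is the subgroup generated by all $\overline{\theta}(r)$, $\theta\in\Theta$, $r\in\mathbb{R}$ (the free product of copies of $\mathbb{R}$ indexed by $\Theta$). $F_{\mathbb{R}}(\Theta;\tau)$ is this group with the conjugation-invariant pseudonorm $\|x\|=\inf\{\sum_i|r_i|\tau(\theta_i): x=\prod_ih_i\overline{\theta_i}(r_i)^{\pm1}h_i^{-1},\ h_i\in F_{\mathbb{R}}(\Theta),\ \theta_i\in\Theta\}$, and the hat denotes its metric completion; $\hat\xi_\Theta$ is the continuous extension of $\xi_\Theta$. Directional asymptotic cone. A scaling set is an unbounded subset $T\subseteq(0,\infty)$; limits over $t\in T$ are taken as $t\to\infty$. A function $f$ from $T$ to a pseudometric space is Cauchy if for every $\epsilon>0$, $d(f(t),f(t'))<\epsilon$ for all sufficiently large $t,t'\in T$. $\mathcal{D}(G,T)$ is the group (pointwise product) of all functions $w\colon T\to F(G)$ such that $t\mapsto\psi_{1/t}(w(t))\in F_{\mathbb{R}}(G)$ is Cauchy, with pseudonorm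 $\|w\|=\lim_{t\in T}\|\psi_{1/t}(w(t))\|$. $\mathcal{C}(G,T)=\{\pi\circ w: w\in\mathcal{D}(G,T)\}$, a group of functions $T\to G$, with pseudonorm $\|g\|=\inf\{\|w\|: w\in\mathcal{D}(G,T),\ \pi\circ w=g\}$. The directional asymptotic cone $\hat{\mathcal{C}}(G,T)$ is the quotient of $\mathcal{C}(G,T)$ by the normal subgroup of elements of pseudonorm $0$, with the induced conjugation-invariant norm; $[g]$ denotes the class of $g$. Write $\hat{\mathcal{C}}(G)=\hat{\mathcal{C}}(G,(0,\infty))$; it is a complete metric group and $\eta$ is well defined. *)

theory Defs
  imports
    "HOL-Algebra.Product_Groups"
    "HOL-Analysis.Abstract_Metric_Spaces"
begin

section \<open>Groups with pseudonorms\<close>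

definition list_mult :: "('g, 'm) monoid_scheme \<Rightarrow> 'g list \<Rightarrow> 'g" where
  "list_mult K xs = foldr (\<otimes>\<^bsub>K\<^esub>) xs \<one>\<^bsub>K\<^esub>"

definition conj_inv_pseudonorm :: "('g, 'm) monoid_scheme \<Rightarrow> ('g \<Rightarrow> real) \<Rightarrow> bool" where
  "conj_inv_pseudonorm K \<nu> \<longleftrightarrow>
     (\<forall>g\<in>carrier K. 0 \<le> \<nu> g) \<and> \<nu> \<one>\<^bsub>K\<^esub> = 0 \<and>
     (\<forall>g\<in>carrier K. \<nu> (inv\<^bsub>K\<^esub> g) = \<nu> g) \<and>
     (\<forall>g\<in>carrier K. \<forall>h\<in>carrier K. \<nu> (g \<otimes>\<^bsub>K\<^esub> h) \<le> \<nu> g + \<nu> h) \<and>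
     (\<forall>g\<in>carrier K. \<forall>h\<in>carrier K. \<nu> (h \<otimes>\<^bsub>K\<^esub> g \<otimes>\<^bsub>K\<^esub> inv\<^bsub>K\<^esub> h) = \<nu> g)"

text \<open>The value off the carrier is set to zero, since \<^locale>\<open>Metric_space\<close> demands
  symmetry and nonnegativity on the whole type.\<close>

definition norm_dist :: "('g, 'm) monoid_scheme \<Rightarrow> ('g \<Rightarrow> real) \<Rightarrow> 'g \<Rightarrow> 'g \<Rightarrow> real" where
  "norm_dist K \<nu> g h =
     (if g \<in> carrier K \<and> h \<in> carrier K then \<nu> (inv\<^bsub>K\<^esub> g \<otimes>\<^bsub>K\<^esub> h) else 0)"

definition norm_topology :: "('g, 'm) monoid_scheme \<Rightarrow> ('g \<Rightarrow> real) \<Rightarrow> 'g topology" where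
  "norm_topology K \<nu> = Metric_space.mtopology (carrier K) (norm_dist K \<nu>)"

definition lipschitz_hom ::
  "real \<Rightarrow> ('g, 'm) monoid_scheme \<Rightarrow> ('g \<Rightarrow> real) \<Rightarrow> ('h, 'n) monoid_scheme \<Rightarrow> ('h \<Rightarrow> real)
    \<Rightarrow> ('g \<Rightarrow> 'h) \<Rightarrow> bool" where
  "lipschitz_hom c K \<kappa> L \<mu> f \<longleftrightarrow> f \<in> hom K L \<and> (\<forall>g\<in>carrier K. \<mu> (f g) \<le> c * \<kappa> g)"

definition metric_quotient ::
  "('g, 'm) monoid_scheme \<Rightarrow> ('g \<Rightarrow> real) \<Rightarrow> ('h, 'n) monoid_scheme \<Rightarrow> ('h \<Rightarrow> real)
    \<Rightarrow> ('g \<Rightarrow> 'h) \<Rightarrow> bool" where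
  "metric_quotient K \<kappa> L \<mu> p \<longleftrightarrow>
     group K \<and> conj_inv_pseudonorm K \<kappa> \<and> group L \<and> conj_inv_pseudonorm L \<mu> \<and>
     p \<in> hom K L \<and> p ` carrier K = carrier L \<and>
     (\<forall>l\<in>carrier L. \<mu> l = Inf (\<kappa> ` {k \<in> carrier K. p k = l}))"

definition null_elems :: "('g, 'm) monoid_scheme \<Rightarrow> ('g \<Rightarrow> real) \<Rightarrow> 'g set" where
  "null_elems K \<nu> = {g \<in> carrier K. \<nu> g = 0}"

text \<open>The norm induced on \<^term>\<open>K Mod null_elems K \<nu>\<close>: the pseudonorm is constant
  on every coset of its null subgroup.\<close>

definition coset_norm :: "('g \<Rightarrow> real) \<Rightarrow> 'g set \<Rightarrow> real" where
  "coset_norm \<nu> X = the_elem (\<nu> ` X)"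

text \<open>Functions that are Cauchy as the argument tends to infinity within \<open>T\<close>; used for an
  unbounded \<open>T \<subseteq> (0,\<infinity>)\<close> and for sequences, with \<open>T = UNIV :: nat set\<close>.\<close>

definition cauchy_along :: "'t::linorder set \<Rightarrow> ('g \<Rightarrow> 'g \<Rightarrow> real) \<Rightarrow> ('t \<Rightarrow> 'g) \<Rightarrow> bool" where
  "cauchy_along T d f \<longleftrightarrow>
     (\<forall>\<epsilon>>0. \<exists>b. \<forall>t\<in>T. \<forall>t'\<in>T. b \<le> t \<longrightarrow> b \<le> t' \<longrightarrow> d (f t) (f t') < \<epsilon>)"

subsection \<open>Metric completion\<close>

definition cauchy_seqs :: "('g, 'm) monoid_scheme \<Rightarrow> ('g \<Rightarrow> real) \<Rightarrow> (nat \<Rightarrow> 'g) monoid" where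
  "cauchy_seqs K \<nu> = (product_group UNIV (\<lambda>_. K))
     \<lparr>carrier := {s. range s \<subseteq> carrier K \<and> cauchy_along UNIV (norm_dist K \<nu>) s}\<rparr>"

definition seq_norm :: "('g \<Rightarrow> real) \<Rightarrow> (nat \<Rightarrow> 'g) \<Rightarrow> real" where
  "seq_norm \<nu> s = lim (\<lambda>n. \<nu> (s n))"

definition completion ::
  "('g, 'm) monoid_scheme \<Rightarrow> ('g \<Rightarrow> real) \<Rightarrow> (nat \<Rightarrow> 'g) set monoid" where
  "completion K \<nu> = cauchy_seqs K \<nu> Mod null_elems (cauchy_seqs K \<nu>) (seq_norm \<nu>)"

definition completion_norm :: "('g \<Rightarrow> real) \<Rightarrow> (nat \<Rightarrow> 'g) set \<Rightarrow> real" where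
  "completion_norm \<nu> = coset_norm (seq_norm \<nu>)"

definition completion_embed ::
  "('g, 'm) monoid_scheme \<Rightarrow> ('g \<Rightarrow> real) \<Rightarrow> 'g \<Rightarrow> (nat \<Rightarrow> 'g) set" where
  "completion_embed K \<nu> g =
     null_elems (cauchy_seqs K \<nu>) (seq_norm \<nu>) #>\<^bsub>cauchy_seqs K \<nu>\<^esub> (\<lambda>_. g)"

definition continuous_extension ::
  "('g, 'm) monoid_scheme \<Rightarrow> ('g \<Rightarrow> real) \<Rightarrow> ('h, 'n) monoid_scheme \<Rightarrow> ('h \<Rightarrow> real)
    \<Rightarrow> ('g \<Rightarrow> 'h) \<Rightarrow> ((nat \<Rightarrow> 'g) set \<Rightarrow> 'h) \<Rightarrow> bool" where
  "continuous_extension K \<kappa> L \<mu> f F \<longleftrightarrow>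
     continuous_map (norm_topology (completion K \<kappa>) (completion_norm \<kappa>)) (norm_topology L \<mu>) F \<and>
     (\<forall>g\<in>carrier K. F (completion_embed K \<kappa> g) = f g)"

section \<open>Free groups\<close>

text \<open>The letter \<open>(a, True)\<close> stands for \<open>a\<close> and \<open>(a, False)\<close> for its inverse. Elements of the
  free group are the reduced words.\<close>

definition letter_inv :: "'a \<times> bool \<Rightarrow> 'a \<times> bool" where
  "letter_inv x = (fst x, \<not> snd x)"

definition reduced :: "('a \<times> bool) list \<Rightarrow> bool" where
  "reduced w \<longleftrightarrow> successively (\<lambda>x y. y \<noteq> letter_inv x) w"

definition cyclically_reduced :: "('a \<times> bool) list \<Rightarrow> bool" where
  "cyclically_reduced w \<longleftrightarrow> reduced w \<and> (w \<noteq> [] \<longrightarrow> hd w \<noteq> letter_inv (last w))"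

definition push_letter :: "'a \<times> bool \<Rightarrow> ('a \<times> bool) list \<Rightarrow> ('a \<times> bool) list" where
  "push_letter x w =
     (case w of [] \<Rightarrow> [x] | y # v \<Rightarrow> if y = letter_inv x then v else x # w)"

definition free_group :: "'a set \<Rightarrow> ('a \<times> bool) list monoid" where
  "free_group A = \<lparr>carrier = {w. fst ` set w \<subseteq> A \<and> reduced w},
     monoid.mult = (\<lambda>u v. foldr push_letter u v), one = []\<rparr>"

lemma letter_inv_letter_inv [simp]: "letter_inv (letter_inv x) = x"
  by (cases x) (simp add: letter_inv_def)

lemma letter_inv_neq [simp]: "letter_inv x \<noteq> x" "x \<noteq> letter_inv x"
  by (cases x; auto simp: letter_inv_def)+

lemma fst_letter_inv [simp]: "fst (letter_inv x) = fst x"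
  by (simp add: letter_inv_def)

lemma reduced_push_letter: "reduced w \<Longrightarrow> reduced (push_letter x w)"
  by (cases w) (auto simp: reduced_def push_letter_def successively_Cons)

lemma set_push_letter: "fst ` set (push_letter x w) \<subseteq> insert (fst x) (fst ` set w)"
  by (cases w) (auto simp: push_letter_def)

lemma push_letter_cancel:
  assumes "reduced w" shows "push_letter (letter_inv x) (push_letter x w) = w"
proof (cases w)
  case (Cons y v)
  then show ?thesis
    using assms by (cases v) (auto simp: push_letter_def reduced_def)
qed (simp add: push_letter_def)

lemma push_letter_reduced: "reduced (x # w) \<Longrightarrow> push_letter x w = x # w"
  by (cases w) (auto simp: push_letter_def reduced_def)

lemma foldr_push_letter:
  "reduced v \<Longrightarrow> reduced (foldr push_letter u v)"
  "fst ` set (foldr push_letter u v) \<subseteq> fst ` set u \<union> fst ` set v"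
proof -
  show "reduced v \<Longrightarrow> reduced (foldr push_letter u v)"
    by (induction u) (simp_all add: reduced_push_letter)
  show "fst ` set (foldr push_letter u v) \<subseteq> fst ` set u \<union> fst ` set v"
  proof (induction u)
    case (Cons x u)
    then show ?case
      using set_push_letter[of x "foldr push_letter u v"] unfolding foldr_Cons o_apply list.set image_insert
      by blast
  qed simp
qed

lemma foldr_push_letter_push:
  assumes "reduced u" "reduced v"
  shows "foldr push_letter (push_letter x u) v = push_letter x (foldr push_letter u v)"
proof (cases u)
  case (Cons y w)
  show ?thesis
  proof (cases "y = letter_inv x")
    case True
    have "reduced (foldr push_letter w v)"
      by (rule foldr_push_letter(1)[OF assms(2)])
    then have "push_letter (letter_inv y) (push_letter y (foldr push_letter w v)) = foldr push_letter w v"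
      by (rule push_letter_cancel)
    moreover have "push_letter x u = w" "letter_inv y = x"
      unfolding Cons push_letter_def using True by simp_all
    ultimately show ?thesis
      unfolding Cons by simp
  next
    case False
    then have "push_letter x u = x # u"
      unfolding Cons push_letter_def by simp
    then show ?thesis
      by simp
  qed
next
  case Nil
  then show ?thesis
    unfolding Nil push_letter_def[of x "[]"] by simp
qed

lemma group_free_group: "group (free_group A)"
proof (rule groupI)
  fix u v w assume u: "u \<in> carrier (free_group A)" and v: "v \<in> carrier (free_group A)"
    and w: "w \<in> carrier (free_group A)"
  have "fst ` set u \<subseteq> A" "fst ` set v \<subseteq> A" "reduced v"
    using u v by (auto simp: free_group_def)
  then have "fst ` set (foldr push_letter u v) \<subseteq> A"
    by (intro order_trans[OF foldr_push_letter(2)]) simp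
  moreover have "reduced (foldr push_letter u v)"
    using \<open>reduced v\<close> by (rule foldr_push_letter(1))
  ultimately show "u \<otimes>\<^bsub>free_group A\<^esub> v \<in> carrier (free_group A)"
    by (simp add: free_group_def)
  have "reduced v" "reduced w"
    using v w by (auto simp: free_group_def)
  then have "foldr push_letter (foldr push_letter u v) w = foldr push_letter u (foldr push_letter v w)"
    by (induction u) (auto simp: foldr_push_letter_push foldr_push_letter)
  then show "u \<otimes>\<^bsub>free_group A\<^esub> v \<otimes>\<^bsub>free_group A\<^esub> w = u \<otimes>\<^bsub>free_group A\<^esub> (v \<otimes>\<^bsub>free_group A\<^esub> w)"
    by (simp add: free_group_def)
next
  fix u assume u: "u \<in> carrier (free_group A)"
  define v where "v = rev (map letter_inv u)"
  have "reduced v"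
  proof -
    have "successively (\<lambda>x y. y \<noteq> letter_inv x) u"
      using u by (simp add: reduced_def free_group_def)
    then have "successively (\<lambda>x y. letter_inv x \<noteq> letter_inv (letter_inv y)) u"
      by (rule successively_mono) (metis letter_inv_letter_inv)
    then show ?thesis
      by (simp only: v_def reduced_def successively_rev successively_map)
  qed
  moreover have "fst ` set v = fst ` set u"
    by (force simp: v_def image_image)
  moreover have "reduced u"
    using u by (auto simp: free_group_def)
  then have "foldr push_letter (rev (map letter_inv u)) u = []"
  proof (induction u)
    case (Cons x u)
    then have *: "reduced u"
      by (auto simp: reduced_def successively_Cons)
    with Cons.IH show ?case
      by (simp add: push_letter_def)
  qed simp
  ultimately show "\<exists>v\<in>carrier (free_group A). v \<otimes>\<^bsub>free_group A\<^esub> u = \<one>\<^bsub>free_group A\<^esub>"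
    using u by (intro bexI[of _ v]) (simp_all add: free_group_def flip: v_def)
qed (simp_all add: free_group_def reduced_def)

definition free_gen :: "'a \<Rightarrow> ('a \<times> bool) list" where
  "free_gen a = [(a, True)]"

definition conj_word_norm :: "('g, 'm) monoid_scheme \<Rightarrow> 'g set \<Rightarrow> 'g \<Rightarrow> real" where
  "conj_word_norm G S g = real (LEAST n. \<exists>cs. length cs = n \<and>
     set cs \<subseteq> {h \<otimes>\<^bsub>G\<^esub> s \<otimes>\<^bsub>G\<^esub> inv\<^bsub>G\<^esub> h | h s. h \<in> carrier G \<and> s \<in> S \<union> m_inv G ` S} \<and>
     g = list_mult G cs)"

definition stable_length :: "('g, 'm) monoid_scheme \<Rightarrow> ('g \<Rightarrow> real) \<Rightarrow> 'g \<Rightarrow> real" where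
  "stable_length G \<nu> g = lim (\<lambda>n::nat. \<nu> (g [^]\<^bsub>G\<^esub> n) / real n)"

definition pure_elem :: "('g, 'm) monoid_scheme \<Rightarrow> 'g \<Rightarrow> bool" where
  "pure_elem G g \<longleftrightarrow> g \<in> carrier G \<and>
     (\<forall>h\<in>carrier G. \<forall>n::int. g = h [^]\<^bsub>G\<^esub> n \<longrightarrow> (h = g \<or> h = inv\<^bsub>G\<^esub> g) \<and> (n = 1 \<or> n = -1))"

definition conj_or_inv :: "('g, 'm) monoid_scheme \<Rightarrow> 'g \<Rightarrow> 'g \<Rightarrow> bool" where
  "conj_or_inv G g g' \<longleftrightarrow>
     (\<exists>h\<in>carrier G. g' = h \<otimes>\<^bsub>G\<^esub> g \<otimes>\<^bsub>G\<^esub> inv\<^bsub>G\<^esub> h \<or> g' = h \<otimes>\<^bsub>G\<^esub> inv\<^bsub>G\<^esub> g \<otimes>\<^bsub>G\<^esub> inv\<^bsub>G\<^esub> h)"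

section \<open>Free products of copies of the reals\<close>

text \<open>Elements are normal forms: lists of pairs \<open>(g, r)\<close>, standing for the element \<open>r\<close> of the
  copy indexed by \<open>g\<close>, with \<open>r \<noteq> 0\<close> and distinct neighbouring indices.\<close>

definition push_syl :: "'i \<times> real \<Rightarrow> ('i \<times> real) list \<Rightarrow> ('i \<times> real) list" where
  "push_syl p w =
     (if snd p = 0 then w
      else case w of
        [] \<Rightarrow> [p]
      | q # v \<Rightarrow>
          if fst q = fst p
          then (if snd p + snd q = 0 then v else (fst p, snd p + snd q) # v)
          else p # w)"

definition free_real :: "'i set \<Rightarrow> ('i \<times> real) list monoid" where
  "free_real I =
     \<lparr>carrier = {w. set w \<subseteq> I \<times> (UNIV - {0}) \<and> successively (\<lambda>p q. fst p \<noteq> fst q) w},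
      monoid.mult = (\<lambda>u v. foldr push_syl u v), one = []\<rparr>"

definition bar :: "'i \<Rightarrow> real \<Rightarrow> ('i \<times> real) list" where
  "bar g r = (if r = 0 then [] else [(g, r)])"

lemma push_syl_carrier:
  assumes "w \<in> carrier (free_real I)" "fst p \<in> I"
  shows "push_syl p w \<in> carrier (free_real I)"
proof (cases w)
  case (Cons q v)
  then show ?thesis
    using assms by (cases p; cases q; cases v)
      (auto simp: free_real_def push_syl_def add_eq_0_iff)
qed (use assms in \<open>cases p; auto simp: free_real_def push_syl_def\<close>)

lemma push_syl_add:
  assumes "w \<in> carrier (free_real I)"
  shows "push_syl (g, r) (push_syl (g, s) w) = push_syl (g, r + s) w"
proof (cases w)
  case (Cons q v)
  then show ?thesis
    using assms by (cases q; cases v)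
      (auto simp: free_real_def push_syl_def add.assoc add_eq_0_iff)
qed (auto simp: push_syl_def)

lemma push_syl_0: "push_syl (g, 0) w = w"
  by (simp add: push_syl_def)

lemma foldr_push_syl_carrier:
  "fst ` set u \<subseteq> I \<Longrightarrow> v \<in> carrier (free_real I) \<Longrightarrow> foldr push_syl u v \<in> carrier (free_real I)"
  by (induction u) (auto simp: push_syl_carrier)

lemma foldr_push_syl_push:
  assumes "u \<in> carrier (free_real I)" "v \<in> carrier (free_real I)" "fst p \<in> I"
  shows "foldr push_syl (push_syl p u) v = push_syl p (foldr push_syl u v)"
proof (cases u)
  case (Cons q w)
  obtain g r h s where pq: "p = (g, r)" "q = (h, s)"
    by (cases p; cases q)
  have "fst ` set w \<subseteq> I"
    using assms Cons by (auto simp: free_real_def)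
  then have "foldr push_syl w v \<in> carrier (free_real I)"
    using assms by (intro foldr_push_syl_carrier)
  from push_syl_add[OF this, of g r s] show ?thesis
    by (auto simp: Cons pq push_syl_0 push_syl_def[of "(g, r)" "(h, s) # w"])
next
  case Nil
  then show ?thesis
    by (cases p) (simp add: push_syl_def[of _ "[]"] push_syl_0)
qed

lemma group_free_real: "group (free_real I)"
proof (rule groupI)
  fix u v w assume u: "u \<in> carrier (free_real I)" and v: "v \<in> carrier (free_real I)"
    and w: "w \<in> carrier (free_real I)"
  have uI: "fst ` set u \<subseteq> I"
    using u by (auto simp: free_real_def)
  show "u \<otimes>\<^bsub>free_real I\<^esub> v \<in> carrier (free_real I)"
    using foldr_push_syl_carrier[OF uI v] by (auto simp: free_real_def)
  have "foldr push_syl (foldr push_syl u v) w = foldr push_syl u (foldr push_syl v w)"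
    using uI
  proof (induction u)
    case (Cons p u)
    then have "foldr push_syl u v \<in> carrier (free_real I)"
      using v by (intro foldr_push_syl_carrier) auto
    with Cons show ?case
      using foldr_push_syl_push[OF _ w] by auto
  qed simp
  then show "u \<otimes>\<^bsub>free_real I\<^esub> v \<otimes>\<^bsub>free_real I\<^esub> w = u \<otimes>\<^bsub>free_real I\<^esub> (v \<otimes>\<^bsub>free_real I\<^esub> w)"
    by (simp add: free_real_def)
next
  fix u assume u: "u \<in> carrier (free_real I)"
  define v where "v = rev (map (apsnd uminus) u)"
  have "successively (\<lambda>p q. fst p \<noteq> fst q) v"
  proof -
    have "successively (\<lambda>p q. fst p \<noteq> fst q) u"
      using u by (simp add: free_real_def)
    then have "successively (\<lambda>p q. fst (apsnd uminus q) \<noteq> fst (apsnd uminus p)) u"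
      by (rule successively_mono) auto
    then show ?thesis
      by (simp only: v_def successively_rev successively_map)
  qed
  moreover have "set v \<subseteq> I \<times> (UNIV - {0})"
    using u by (auto simp: v_def free_real_def)
  moreover have "foldr push_syl (rev (map (apsnd uminus) u)) u = []"
    using u
  proof (induction u)
    case (Cons p u)
    then have "u \<in> carrier (free_real I)"
      by (auto simp: free_real_def successively_Cons)
    moreover have "push_syl (apsnd uminus p) (p # u) = u"
      using Cons.prems by (cases p) (auto simp: push_syl_def free_real_def)
    ultimately show ?case
      using Cons.IH by simp
  qed simp
  ultimately show "\<exists>v\<in>carrier (free_real I). v \<otimes>\<^bsub>free_real I\<^esub> u = \<one>\<^bsub>free_real I\<^esub>"
    by (intro bexI[of _ v]) (simp_all add: free_real_def flip: v_def)
qed (simp_all add: free_real_def)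

lemma bar_mult: "bar g r \<otimes>\<^bsub>free_real I\<^esub> bar g s = bar g (r + s)"
  by (auto simp: free_real_def bar_def push_syl_def)

lemma normal_form_eq_product:
  assumes "w \<in> carrier (free_real I)"
  shows "w = list_mult (free_real I) (map (\<lambda>(g, r). bar g r) w)"
  using assms
proof (induction w)
  case (Cons p w)
  then have "w \<in> carrier (free_real I)"
    by (auto simp: free_real_def successively_Cons)
  with Cons.IH have "w = list_mult (free_real I) (map (\<lambda>(g, r). bar g r) w)"
    by blast
  moreover have "bar (fst p) (snd p) \<otimes>\<^bsub>free_real I\<^esub> w = p # w"
    using Cons.prems by (cases w) (auto simp: free_real_def bar_def push_syl_def)
  ultimately show ?case
    by (cases p) (simp add: list_mult_def)
qed (simp add: list_mult_def free_real_def)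

definition FR :: "('g, 'm) monoid_scheme \<Rightarrow> ('g \<times> real) list monoid" where
  "FR G = free_real (carrier G)"

definition FR_sub :: "('g, 'm) monoid_scheme \<Rightarrow> 'g set \<Rightarrow> ('g \<times> real) list monoid" where
  "FR_sub G \<Theta> = (FR G)\<lparr>carrier := generate (FR G) {bar \<theta> r | \<theta> r. \<theta> \<in> \<Theta>}\<rparr>"

definition F_int :: "('g, 'm) monoid_scheme \<Rightarrow> ('g \<times> real) list monoid" where
  "F_int G = (FR G)\<lparr>carrier := generate (FR G) {bar g 1 | g. g \<in> carrier G}\<rparr>"

text \<open>For \<open>K\<close> the free product of the copies of the reals indexed by \<open>S\<close>: the pseudonorm with
  weights \<open>\<nu>\<close> on the indices. A list entry \<open>(h, g, r, e)\<close> encodes the factor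
  \<open>h \<cdot> (bar g r)\<^sup>e \<cdot> h\<^sup>-\<^sup>1\<close> with \<open>e = \<plusminus>1\<close>.\<close>

definition weight_pseudonorm ::
  "('i \<times> real) list monoid \<Rightarrow> 'i set \<Rightarrow> ('i \<Rightarrow> real) \<Rightarrow> ('i \<times> real) list \<Rightarrow> real" where
  "weight_pseudonorm K S \<nu> x =
     Inf {(\<Sum>(h, g, r, e)\<leftarrow>cs. \<bar>r\<bar> * \<nu> g) | cs.
       (\<forall>(h, g, r, e)\<in>set cs. h \<in> carrier K \<and> g \<in> S \<and> (e = 1 \<or> e = (-1::int))) \<and>
       x = list_mult K
         (map (\<lambda>(h, g, r, e). h \<otimes>\<^bsub>K\<^esub> (bar g r [^]\<^bsub>K\<^esub> e) \<otimes>\<^bsub>K\<^esub> inv\<^bsub>K\<^esub> h) cs)}"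

definition FR_norm :: "('g, 'm) monoid_scheme \<Rightarrow> ('g \<Rightarrow> real) \<Rightarrow> ('g \<times> real) list \<Rightarrow> real" where
  "FR_norm G \<nu> = weight_pseudonorm (FR G) (carrier G) \<nu>"

definition FR_sub_norm ::
  "('g, 'm) monoid_scheme \<Rightarrow> 'g set \<Rightarrow> ('g \<Rightarrow> real) \<Rightarrow> ('g \<times> real) list \<Rightarrow> real" where
  "FR_sub_norm G \<Theta> \<tau> = weight_pseudonorm (FR_sub G \<Theta>) \<Theta> \<tau>"

text \<open>The homomorphisms \<open>\<psi>\<^sub>t\<close> and \<open>\<pi>\<close>, evaluated on normal forms. On \<^const>\<open>F_int\<close> all
  exponents are integers, so the floor in \<open>\<pi>\<close> only converts the type.\<close>

definition psi ::
  "('g, 'm) monoid_scheme \<Rightarrow> real \<Rightarrow> ('g \<times> real) list \<Rightarrow> ('g \<times> real) list" where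
  "psi G t w = list_mult (FR G) (map (\<lambda>(g, r). bar g (t * r)) w)"

definition pi_hom :: "('g, 'm) monoid_scheme \<Rightarrow> ('g \<times> real) list \<Rightarrow> 'g" where
  "pi_hom G w = list_mult G (map (\<lambda>(g, r). g [^]\<^bsub>G\<^esub> \<lfloor>r\<rfloor>) w)"

section \<open>The directional asymptotic cone\<close>

text \<open>Throughout, \<open>T\<close> is a scaling set, i.e. an unbounded subset of \<open>(0,\<infinity>)\<close>.\<close>

definition D_group ::
  "('g, 'm) monoid_scheme \<Rightarrow> ('g \<Rightarrow> real) \<Rightarrow> real set \<Rightarrow> (real \<Rightarrow> ('g \<times> real) list) monoid" where
  "D_group G \<nu> T = (product_group T (\<lambda>_. F_int G))
     \<lparr>carrier := {w \<in> T \<rightarrow>\<^sub>E carrier (F_int G).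
        cauchy_along T (norm_dist (FR G) (FR_norm G \<nu>)) (\<lambda>t. psi G (1 / t) (w t))}\<rparr>"

definition D_norm ::
  "('g, 'm) monoid_scheme \<Rightarrow> ('g \<Rightarrow> real) \<Rightarrow> real set \<Rightarrow> (real \<Rightarrow> ('g \<times> real) list) \<Rightarrow> real" where
  "D_norm G \<nu> T w = Lim (inf at_top (principal T)) (\<lambda>t. FR_norm G \<nu> (psi G (1 / t) (w t)))"

definition C_group ::
  "('g, 'm) monoid_scheme \<Rightarrow> ('g \<Rightarrow> real) \<Rightarrow> real set \<Rightarrow> (real \<Rightarrow> 'g) monoid" where
  "C_group G \<nu> T = (product_group T (\<lambda>_. G))
     \<lparr>carrier := compose T (pi_hom G) ` carrier (D_group G \<nu> T)\<rparr>"

definition C_norm ::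
  "('g, 'm) monoid_scheme \<Rightarrow> ('g \<Rightarrow> real) \<Rightarrow> real set \<Rightarrow> (real \<Rightarrow> 'g) \<Rightarrow> real" where
  "C_norm G \<nu> T f =
     Inf (D_norm G \<nu> T ` {w \<in> carrier (D_group G \<nu> T). compose T (pi_hom G) w = f})"

definition asym_cone ::
  "('g, 'm) monoid_scheme \<Rightarrow> ('g \<Rightarrow> real) \<Rightarrow> real set \<Rightarrow> (real \<Rightarrow> 'g) set monoid" where
  "asym_cone G \<nu> T = C_group G \<nu> T Mod null_elems (C_group G \<nu> T) (C_norm G \<nu> T)"

definition cone_norm ::
  "('g, 'm) monoid_scheme \<Rightarrow> ('g \<Rightarrow> real) \<Rightarrow> real set \<Rightarrow> (real \<Rightarrow> 'g) set \<Rightarrow> real" where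
  "cone_norm G \<nu> T = coset_norm (C_norm G \<nu> T)"

definition cone_class ::
  "('g, 'm) monoid_scheme \<Rightarrow> ('g \<Rightarrow> real) \<Rightarrow> real set \<Rightarrow> (real \<Rightarrow> 'g) \<Rightarrow> (real \<Rightarrow> 'g) set" where
  "cone_class G \<nu> T f = null_elems (C_group G \<nu> T) (C_norm G \<nu> T) #>\<^bsub>C_group G \<nu> T\<^esub> f"

text \<open>\<open>\<eta>\<close> for the scaling set \<open>(0,\<infinity>)\<close>, evaluated on the normal form
  \<open>bar g\<^sub>1 r\<^sub>1 \<cdots> bar g\<^sub>k r\<^sub>k\<close> of its argument.\<close>

definition eta ::
  "('g, 'm) monoid_scheme \<Rightarrow> ('g \<Rightarrow> real) \<Rightarrow> ('g \<times> real) list \<Rightarrow> (real \<Rightarrow> 'g) set" where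
  "eta G \<nu> w = cone_class G \<nu> {0<..}
     (\<lambda>t\<in>{0<..}. list_mult G (map (\<lambda>(g, r). g [^]\<^bsub>G\<^esub> \<lfloor>r * t\<rfloor>) w))"

end

theory Submission imports Defs begin

text \<open>Write \<open>F\<close> for the free group, \<open>\<nu>\<close> for its word norm and \<open>\<tau>\<close> for the stable length.

  The cone only sees \<open>\<Theta>\<close>: every nontrivial \<open>g\<close> is \<open>k \<theta>\<^sup>z k\<^sup>-\<^sup>1\<close> with \<open>\<theta> \<in> \<Theta>\<close>, because \<open>g\<close> has a root
  that is not a proper power. Conjugation by a fixed element and a change of the rounding of the exponents
  move the path \<open>t \<mapsto> g ^ \<lfloor>r t\<rfloor>\<close> by a bounded amount only, so \<open>g(r)\<close> and \<open>\<theta>(z r)\<close> have the same class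
  (\<open>eta_bar_conj\<close>). Replacing one by the other is a homomorphism \<open>\<sigma>\<close> from the free product over \<open>F\<close> to the
  free product over \<open>\<Theta>\<close> through which \<open>\<eta>\<close> factors, and \<open>\<sigma>\<close> does not increase norms since
  \<open>\<bar>z\<bar> \<tau> \<theta> \<le> \<nu> g\<close>. Conversely \<open>\<theta>(r)\<close> has the same class as \<open>\<theta>\<^sup>n(r/n)\<close>, whose norm tends to \<open>\<bar>r\<bar> \<tau> \<theta>\<close>;
  hence \<open>\<xi>\<close> has Lipschitz constant 1 (\<open>\<eta>_lift\<close>).

  An element of the cone is the class of a Cauchy function \<open>w\<close>. Its rescaled values, sampled at the positive
  integers and mapped by \<open>\<sigma>\<close>, form a Cauchy sequence over \<open>\<Theta>\<close> whose norms are at most those of \<open>w\<close> and whose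
  images converge to the given class. This gives the density of the image, the surjectivity of the extension
  and the equality of the norm with the infimum over the fibre (\<open>extension_section\<close>). The extension exists
  because images of Cauchy sequences converge in the cone: a sequence over \<open>\<Theta>\<close> with summable steps is lifted
  to one over \<open>F\<close>, and a diagonal function represents the limit (\<open>eta_cauchy_limit\<close>).

  Norms in the cone are bounded below by \<open>\<nu> (f t) / t\<close>. This needs that the projection \<open>\<pi>\<close> from words with
  integral exponents is a contraction, although the pseudonorm there is an infimum over real expressions
  (\<open>norm_pi_hom_le\<close>). An expression of cost \<open>c\<close> is turned into a change of the exponents of the normal form,
  again of cost at most \<open>c\<close>, that makes the word trivial (\<open>wnorm_trivialisation\<close>). The changed exponents are then
  rounded to integers so that the word stays trivial, without an increase of the cost on average.
  With the lower bound the path of \<open>\<theta>(r)\<close> has norm \<open>\<bar>r\<bar> \<tau> \<theta>\<close>.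

  For injectivity, a word over \<open>\<Theta>\<close> whose path has sublinear norm must be empty (\<open>sublinear_path_trivial\<close>). Here
  a version of the counting quasimorphisms of Brooks with values in the free product is used: a reduced word is
  mapped to the product, over its windows of a fixed length, of \<open>\<theta>(1)\<close> for a window that is a power of \<open>\<theta>\<close> and
  \<open>\<theta>(-1)\<close> for the inverse of one. This map is a homomorphism up to a bounded error, so it is Lipschitz, and it
  takes the path of the word \<open>x\<close> at time \<open>t\<close> to \<open>x\<close> with its exponents multiplied by \<open>t\<close>, up to a bounded error.
  Since the pseudonorm on the free product vanishes on no nonempty word with positive weights (\<open>wnorm_pos\<close>),
  \<open>x\<close> is empty.\<close>

section \<open>Pseudonormed groups\<close>

lemma list_mult_Nil [simp]: "list_mult K [] = \<one>\<^bsub>K\<^esub>"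
  and list_mult_Cons [simp]: "list_mult K (x # xs) = x \<otimes>\<^bsub>K\<^esub> list_mult K xs"
  by (simp_all add: list_mult_def)

lemma (in monoid) list_mult_closed [simp, intro]:
  "set xs \<subseteq> carrier G \<Longrightarrow> list_mult G xs \<in> carrier G"
  by (induction xs) auto

lemma (in monoid) list_mult_append:
  "set xs \<subseteq> carrier G \<Longrightarrow> set ys \<subseteq> carrier G \<Longrightarrow>
    list_mult G (xs @ ys) = list_mult G xs \<otimes> list_mult G ys"
  by (induction xs) (auto simp: m_assoc)

lemma (in group) cancel_left [simp]:
  assumes "a \<in> carrier G" "b \<in> carrier G"
  shows "inv a \<otimes> (a \<otimes> b) = b" and "a \<otimes> (inv a \<otimes> b) = b"
  using assms by (simp_all flip: m_assoc)

lemmas (in group) group_normalize = m_assoc inv_mult_group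

locale pseudonormed_group = group K for K (structure) +
  fixes \<nu> :: "'a \<Rightarrow> real"
  assumes conj_inv: "conj_inv_pseudonorm K \<nu>"
begin

lemma norm_nonneg: "g \<in> carrier K \<Longrightarrow> 0 \<le> \<nu> g"
  and norm_one [simp]: "\<nu> \<one> = 0"
  and norm_inv: "g \<in> carrier K \<Longrightarrow> \<nu> (inv g) = \<nu> g"
  and norm_mult: "g \<in> carrier K \<Longrightarrow> h \<in> carrier K \<Longrightarrow> \<nu> (g \<otimes> h) \<le> \<nu> g + \<nu> h"
  and norm_conj: "g \<in> carrier K \<Longrightarrow> h \<in> carrier K \<Longrightarrow> \<nu> (h \<otimes> g \<otimes> inv h) = \<nu> g"
  using conj_inv unfolding conj_inv_pseudonorm_def by blast+

lemma norm_commute: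
  assumes "a \<in> carrier K" "b \<in> carrier K" shows "\<nu> (a \<otimes> b) = \<nu> (b \<otimes> a)"
proof -
  have "\<nu> (inv a \<otimes> (a \<otimes> b) \<otimes> inv (inv a)) = \<nu> (a \<otimes> b)"
    using assms by (intro norm_conj) auto
  then show ?thesis
    using assms by simp
qed

lemma norm_list_mult:
  "set xs \<subseteq> carrier K \<Longrightarrow> \<nu> (list_mult K xs) \<le> (\<Sum>x\<leftarrow>xs. \<nu> x)"
proof (induction xs)
  case (Cons x xs)
  then have "\<nu> (list_mult K (x # xs)) \<le> \<nu> x + \<nu> (list_mult K xs)"
    by (auto intro: norm_mult)
  with Cons show ?case by simp
qed simp

lemma norm_pow: "g \<in> carrier K \<Longrightarrow> \<nu> (g [^] (n::nat)) \<le> real n * \<nu> g"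
proof (induction n)
  case (Suc n)
  then have "\<nu> (g [^] Suc n) \<le> \<nu> (g [^] n) + \<nu> g"
    by (auto intro: norm_mult)
  with Suc show ?case by (simp add: algebra_simps)
qed simp

lemma norm_int_pow:
  assumes "g \<in> carrier K"
  shows "\<nu> (g [^] (n::int)) = \<nu> (g [^] nat \<bar>n\<bar>)"
proof (cases "n < 0")
  case True
  then have "g [^] n = inv (g [^] nat (- n))" "nat \<bar>n\<bar> = nat (- n)"
    by (auto simp: int_pow_def2[of _ g n])
  then show ?thesis
    using norm_inv[of "g [^] nat (- n)"] assms by (simp only: nat_pow_closed)
next
  case False
  then have "g [^] n = g [^] nat n" "nat \<bar>n\<bar> = nat n"
    using False by auto
  then show ?thesis
    by (simp only:)
qed

lemma norm_int_pow_le: "g \<in> carrier K \<Longrightarrow> \<nu> (g [^] (n::int)) \<le> \<bar>real_of_int n\<bar> * \<nu> g"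
  using norm_pow[of g "nat \<bar>n\<bar>"] unfolding norm_int_pow[of g n] by simp

abbreviation d where "d \<equiv> norm_dist K \<nu>"

lemma d_eq: "g \<in> carrier K \<Longrightarrow> h \<in> carrier K \<Longrightarrow> d g h = \<nu> (inv g \<otimes> h)"
  by (simp add: norm_dist_def)

lemma d_eq': "g \<in> carrier K \<Longrightarrow> h \<in> carrier K \<Longrightarrow> d g h = \<nu> (g \<otimes> inv h)"
  using norm_inv[of "inv g \<otimes> h"] norm_commute[of g "inv h"] by (simp add: d_eq inv_mult_group)

lemma d_nonneg: "0 \<le> d g h"
  by (simp add: norm_dist_def norm_nonneg)

lemma d_sym: "d g h = d h g"
proof (cases "g \<in> carrier K \<and> h \<in> carrier K")
  case True
  then show ?thesis
    using norm_inv[of "inv g \<otimes> h"] by (simp add: d_eq inv_mult_group)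
qed (auto simp: norm_dist_def)

lemma d_self [simp]: "d g g = 0"
  by (simp add: norm_dist_def)

lemma d_one: "g \<in> carrier K \<Longrightarrow> d \<one> g = \<nu> g"
  by (simp add: d_eq)

lemma d_triangle:
  assumes "a \<in> carrier K" "b \<in> carrier K" "c \<in> carrier K"
  shows "d a c \<le> d a b + d b c"
proof -
  have "inv a \<otimes> c = (inv a \<otimes> b) \<otimes> (inv b \<otimes> c)"
    using assms by (simp add: m_assoc)
  then show ?thesis
    using assms norm_mult[of "inv a \<otimes> b" "inv b \<otimes> c"] by (simp add: d_eq)
qed

lemma d_mult_left [simp]:
  assumes "a \<in> carrier K" "b \<in> carrier K" "c \<in> carrier K"
  shows "d (c \<otimes> a) (c \<otimes> b) = d a b"
proof -
  have "inv (c \<otimes> a) \<otimes> (c \<otimes> b) = inv a \<otimes> b"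
    using assms by (simp add: group_normalize)
  then show ?thesis using assms by (simp add: d_eq)
qed

lemma d_mult_right [simp]:
  assumes "a \<in> carrier K" "b \<in> carrier K" "c \<in> carrier K"
  shows "d (a \<otimes> c) (b \<otimes> c) = d a b"
proof -
  have "(a \<otimes> c) \<otimes> inv (b \<otimes> c) = a \<otimes> inv b"
    using assms by (simp add: group_normalize)
  then show ?thesis using assms by (simp add: d_eq')
qed

lemma d_mult:
  assumes "a \<in> carrier K" "b \<in> carrier K" "a' \<in> carrier K" "b' \<in> carrier K"
  shows "d (a \<otimes> b) (a' \<otimes> b') \<le> d a a' + d b b'"
  using d_triangle[of "a \<otimes> b" "a' \<otimes> b" "a' \<otimes> b'"] assms by simp

lemma d_inv:
  assumes "a \<in> carrier K" "b \<in> carrier K" shows "d (inv a) (inv b) = d a b"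
  using assms d_eq'[of a b] by (simp add: d_eq)

lemma norm_diff_le:
  assumes "a \<in> carrier K" "b \<in> carrier K" shows "\<bar>\<nu> a - \<nu> b\<bar> \<le> d a b"
  using d_triangle[of \<one> a b] d_triangle[of \<one> b a] assms by (simp add: d_one d_sym[of b a])

lemma norm_eq_if_d_0: "a \<in> carrier K \<Longrightarrow> b \<in> carrier K \<Longrightarrow> d a b = 0 \<Longrightarrow> \<nu> a = \<nu> b"
  using norm_diff_le[of a b] by simp

lemma d_list_mult:
  assumes "length xs = length ys" "set xs \<subseteq> carrier K" "set ys \<subseteq> carrier K"
  shows "d (list_mult K xs) (list_mult K ys) \<le> (\<Sum>(x, y)\<leftarrow>zip xs ys. d x y)"
  using assms
proof (induction xs ys rule: list_induct2)
  case (Cons x xs y ys)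
  then have "d (list_mult K (x # xs)) (list_mult K (y # ys))
      \<le> d x y + d (list_mult K xs) (list_mult K ys)"
    by (auto intro!: d_mult)
  with Cons show ?case by simp
qed simp

end

text \<open>The norm of the cone and the norm on cosets of null elements are both infima over the fibres of a surjective
  homomorphism. Each axiom is inherited by choosing almost optimal lifts.\<close>

lemma pseudonorm_quotient:
  assumes "pseudonormed_group D \<delta>" "group C" "p \<in> hom D C" "p ` carrier D = carrier C"
    and \<mu>: "\<And>f. f \<in> carrier C \<Longrightarrow> \<mu> f = Inf (\<delta> ` {w \<in> carrier D. p w = f})"
  shows "pseudonormed_group C \<mu>"
    and "w \<in> carrier D \<Longrightarrow> \<mu> (p w) \<le> \<delta> w"
    and "f \<in> carrier C \<Longrightarrow> \<mu> f < c \<Longrightarrow> \<exists>w\<in>carrier D. p w = f \<and> \<delta> w < c"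
proof -
  interpret D: pseudonormed_group D \<delta> by fact
  interpret C: group C by fact
  interpret p: group_hom D C p
    by unfold_locales (fact assms)
  have bdd: "bdd_below (\<delta> ` {w \<in> carrier D. p w = f})" for f
    by (rule bdd_belowI2[where m = 0]) (auto intro: D.norm_nonneg)
  have ne: "\<delta> ` {w \<in> carrier D. p w = f} \<noteq> {}" if "f \<in> carrier C" for f
    using that unfolding assms(4)[symmetric] by blast
  show le: "\<mu> (p w) \<le> \<delta> w" if "w \<in> carrier D" for w
    using that by (auto simp: \<mu> intro!: cInf_lower bdd)
  show approx: "\<exists>w\<in>carrier D. p w = f \<and> \<delta> w < c" if "f \<in> carrier C" "\<mu> f < c" for f c
    using that bdd[of f] ne[of f] by (auto simp: \<mu> cInf_less_iff)
  have approx': "\<exists>w\<in>carrier D. p w = f \<and> \<delta> w < \<mu> f + \<epsilon>" if "f \<in> carrier C" "\<epsilon> > 0" for f \<epsilon>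
    using that approx[of f "\<mu> f + \<epsilon>"] by simp
  have nonneg: "0 \<le> \<mu> f" if "f \<in> carrier C" for f
    unfolding \<mu>[OF that] by (rule cInf_greatest[OF ne[OF that]]) (auto intro: D.norm_nonneg)
  have inv_le: "\<mu> (inv\<^bsub>C\<^esub> f) \<le> \<mu> f" if f: "f \<in> carrier C" for f
  proof (rule field_le_epsilon)
    fix \<epsilon> :: real assume "\<epsilon> > 0"
    then obtain w where w: "w \<in> carrier D" "p w = f" "\<delta> w < \<mu> f + \<epsilon>"
      using approx' f by blast
    then show "\<mu> (inv\<^bsub>C\<^esub> f) \<le> \<mu> f + \<epsilon>"
      using le[of "inv\<^bsub>D\<^esub> w"] by (simp add: D.norm_inv)
  qed
  have conj_le: "\<mu> (h \<otimes>\<^bsub>C\<^esub> f \<otimes>\<^bsub>C\<^esub> inv\<^bsub>C\<^esub> h) \<le> \<mu> f"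
    if f: "f \<in> carrier C" and h: "h \<in> carrier C" for f h
  proof (rule field_le_epsilon)
    fix \<epsilon> :: real assume "\<epsilon> > 0"
    then obtain w where w: "w \<in> carrier D" "p w = f" "\<delta> w < \<mu> f + \<epsilon>"
      using approx' f by blast
    obtain k where k: "k \<in> carrier D" "p k = h"
      using h unfolding assms(4)[symmetric] by blast
    show "\<mu> (h \<otimes>\<^bsub>C\<^esub> f \<otimes>\<^bsub>C\<^esub> inv\<^bsub>C\<^esub> h) \<le> \<mu> f + \<epsilon>"
      using le[of "k \<otimes>\<^bsub>D\<^esub> w \<otimes>\<^bsub>D\<^esub> inv\<^bsub>D\<^esub> k"] w k by (simp add: D.norm_conj)
  qed
  show "pseudonormed_group C \<mu>"
  proof (unfold_locales, unfold conj_inv_pseudonorm_def, intro conjI ballI)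
    show "\<mu> \<one>\<^bsub>C\<^esub> = 0"
      using le[of "\<one>\<^bsub>D\<^esub>"] nonneg[of "\<one>\<^bsub>C\<^esub>"] by simp
    show "\<mu> (inv\<^bsub>C\<^esub> f) = \<mu> f" if "f \<in> carrier C" for f
      using inv_le[of f] inv_le[of "inv\<^bsub>C\<^esub> f"] that by simp
    show "\<mu> (f \<otimes>\<^bsub>C\<^esub> g) \<le> \<mu> f + \<mu> g" if f: "f \<in> carrier C" and g: "g \<in> carrier C" for f g
    proof (rule field_le_epsilon)
      fix \<epsilon> :: real assume "\<epsilon> > 0"
      then obtain v w where w: "w \<in> carrier D" "p w = f" "\<delta> w < \<mu> f + \<epsilon> / 2"
        "v \<in> carrier D" "p v = g" "\<delta> v < \<mu> g + \<epsilon> / 2"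
        using approx'[of f "\<epsilon> / 2"] approx'[of g "\<epsilon> / 2"] f g by auto
      then show "\<mu> (f \<otimes>\<^bsub>C\<^esub> g) \<le> \<mu> f + \<mu> g + \<epsilon>"
        using le[of "w \<otimes>\<^bsub>D\<^esub> v"] D.norm_mult[of w v] by simp
    qed
    show "\<mu> (h \<otimes>\<^bsub>C\<^esub> f \<otimes>\<^bsub>C\<^esub> inv\<^bsub>C\<^esub> h) = \<mu> f"
      if f: "f \<in> carrier C" and h: "h \<in> carrier C" for f h
    proof -
      have "inv\<^bsub>C\<^esub> h \<otimes>\<^bsub>C\<^esub> (h \<otimes>\<^bsub>C\<^esub> f \<otimes>\<^bsub>C\<^esub> inv\<^bsub>C\<^esub> h) \<otimes>\<^bsub>C\<^esub> inv\<^bsub>C\<^esub> (inv\<^bsub>C\<^esub> h) = f"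
        using f h by (simp add: C.group_normalize)
      then show ?thesis
        using conj_le[of f h] conj_le[of "h \<otimes>\<^bsub>C\<^esub> f \<otimes>\<^bsub>C\<^esub> inv\<^bsub>C\<^esub> h" "inv\<^bsub>C\<^esub> h"] f h by simp
    qed
  qed (use nonneg in auto)
qed

subsection \<open>The quotient by the elements of pseudonorm zero\<close>

context pseudonormed_group
begin

lemma null_iff: "g \<in> null_elems K \<nu> \<longleftrightarrow> g \<in> carrier K \<and> \<nu> g = 0"
  by (auto simp: null_elems_def)

lemma null_subgroup: "subgroup (null_elems K \<nu>) K"
proof
  show "g \<otimes> h \<in> null_elems K \<nu>" if "g \<in> null_elems K \<nu>" "h \<in> null_elems K \<nu>" for g h
    using that norm_mult[of g h] norm_nonneg[of "g \<otimes> h"] by (auto simp: null_iff)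
qed (auto simp: null_iff norm_inv)

lemma null_normal: "null_elems K \<nu> \<lhd> K"
  using null_subgroup by (auto simp: normal_inv_iff null_iff norm_conj)

text \<open>Both the completion and the cone are quotients of this form.\<close>

definition cls where "cls g = null_elems K \<nu> #> g"
definition Quot where "Quot = K Mod null_elems K \<nu>"

lemma cls_eq_iff:
  assumes "g \<in> carrier K" "h \<in> carrier K"
  shows "cls g = cls h \<longleftrightarrow> d g h = 0"
proof
  assume "cls g = cls h"
  then have "h \<in> null_elems K \<nu> #> g"
    using rcos_self[OF assms(2) null_subgroup] by (simp add: cls_def)
  then obtain n where "n \<in> carrier K" "\<nu> n = 0" "h = n \<otimes> g"
    by (auto simp: r_coset_def null_iff)
  then show "d g h = 0"
    using assms by (simp add: d_eq' d_sym[of g] group_normalize)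
next
  assume "d g h = 0"
  then have "h \<otimes> inv g \<in> null_elems K \<nu>"
    using assms by (simp add: null_iff d_eq' d_sym[of g])
  moreover have "h = (h \<otimes> inv g) \<otimes> g"
    using assms by (simp add: group_normalize)
  ultimately have "h \<in> null_elems K \<nu> #> g"
    unfolding r_coset_def by blast
  then show "cls g = cls h"
    unfolding cls_def using assms null_subgroup by (intro repr_independence) auto
qed

lemma group_Quot: "group Quot"
  unfolding Quot_def by (rule normal.factorgroup_is_group[OF null_normal])

lemma carrier_Quot: "carrier Quot = cls ` carrier K"
  by (simp add: Quot_def carrier_FactGroup cls_def[abs_def])

lemma cls_hom: "cls \<in> hom K Quot"
  using normal.r_coset_hom_Mod[OF null_normal] by (simp add: cls_def[abs_def] Quot_def)

lemma cls_closed [simp, intro]: "g \<in> carrier K \<Longrightarrow> cls g \<in> carrier Quot"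
  by (simp add: carrier_Quot)

lemma coset_norm_cls:
  assumes "g \<in> carrier K" shows "coset_norm \<nu> (cls g) = \<nu> g"
proof -
  have eq: "\<nu> h = \<nu> g" if h: "h \<in> cls g" for h
  proof -
    obtain n where n: "n \<in> carrier K" "\<nu> n = 0" "h = n \<otimes> g"
      using h by (auto simp: cls_def r_coset_def null_iff)
    then have "d h g = 0"
      using assms by (simp add: d_eq' group_normalize)
    with n assms show ?thesis
      by (intro norm_eq_if_d_0) auto
  qed
  have "\<nu> ` cls g = (\<lambda>_. \<nu> g) ` cls g"
    by (rule image_cong[OF refl eq])
  moreover have "g \<in> cls g"
    unfolding cls_def using null_subgroup assms by (intro rcos_self)
  then have "(\<lambda>_. \<nu> g) ` cls g = {\<nu> g}"
    by (rule image_constant)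
  ultimately show ?thesis
    by (simp add: coset_norm_def)
qed

sublocale cls: group_hom K Quot cls
  by (intro group_hom.intro group_hom_axioms.intro group_axioms group_Quot cls_hom)

lemma pseudonormed_Quot: "pseudonormed_group Quot (coset_norm \<nu>)"
proof (rule pseudonorm_quotient(1)[OF pseudonormed_group_axioms group_Quot cls_hom])
  fix f assume "f \<in> carrier Quot"
  then obtain g where "g \<in> carrier K" "f = cls g"
    by (auto simp: carrier_Quot)
  then have "\<nu> ` {w \<in> carrier K. cls w = f} = {coset_norm \<nu> f}"
    by (auto simp: coset_norm_cls[symmetric])
  then show "coset_norm \<nu> f = Inf (\<nu> ` {w \<in> carrier K. cls w = f})"
    by simp
qed (simp add: carrier_Quot)

lemma d_cls:
  assumes "g \<in> carrier K" "h \<in> carrier K"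
  shows "norm_dist Quot (coset_norm \<nu>) (cls g) (cls h) = d g h"
proof -
  have "inv\<^bsub>Quot\<^esub> (cls g) \<otimes>\<^bsub>Quot\<^esub> cls h = cls (inv g \<otimes> h)"
    using assms by simp
  then show ?thesis
    using assms by (simp add: norm_dist_def coset_norm_cls del: cls.hom_mult cls.hom_inv)
qed

lemma Quot_Metric_space: "Metric_space (carrier Quot) (norm_dist Quot (coset_norm \<nu>))"
proof -
  interpret Quot: pseudonormed_group Quot "coset_norm \<nu>"
    by (rule pseudonormed_Quot)
  show ?thesis
  proof (unfold_locales)
    show "norm_dist Quot (coset_norm \<nu>) X Y = 0 \<longleftrightarrow> X = Y"
      if XY: "X \<in> carrier Quot" "Y \<in> carrier Quot" for X Y
    proof -
      obtain g h where "g \<in> carrier K" "h \<in> carrier K" "X = cls g" "Y = cls h"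
        using XY by (auto simp: carrier_Quot)
      then show ?thesis
        by (simp add: d_cls cls_eq_iff)
    qed
  qed (auto simp: Quot.d_nonneg Quot.d_sym Quot.d_triangle)
qed

end

section \<open>Groups of Cauchy functions\<close>

abbreviation along :: "'t::linorder set \<Rightarrow> 't filter" where
  "along T \<equiv> inf at_top (principal T)"

definition cofinal :: "'t::linorder set \<Rightarrow> bool" where
  "cofinal T \<longleftrightarrow> (\<forall>b. \<exists>t\<in>T. b \<le> t)"

lemma eventually_along:
  fixes T :: "'t::linorder set"
  assumes "cofinal T"
  shows "eventually P (along T) \<longleftrightarrow> (\<exists>b. \<forall>t\<in>T. b \<le> t \<longrightarrow> P t)"
  unfolding eventually_inf_principal eventually_at_top_linorder by blast

lemma along_nontrivial: "cofinal T \<Longrightarrow> along T \<noteq> bot"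
  unfolding trivial_limit_def eventually_along by (auto simp: cofinal_def)

lemma cofinal_UNIV: "cofinal (UNIV :: nat set)"
  and cofinal_pos: "cofinal {0::real<..}"
proof -
  show "cofinal {0::real<..}"
    unfolding cofinal_def
  proof
    fix b :: real
    have "max b 1 \<in> {0<..}" "b \<le> max b 1" by auto
    then show "\<exists>t\<in>{0<..}. b \<le> t" ..
  qed
qed (auto simp: cofinal_def)

lemma cauchy_along_iff:
  assumes "cofinal T"
  shows "cauchy_along T d f \<longleftrightarrow>
    (\<forall>\<epsilon>>0. \<exists>P. eventually P (along T) \<and> (\<forall>t\<in>T. \<forall>t'\<in>T. P t \<longrightarrow> P t' \<longrightarrow> d (f t) (f t') < \<epsilon>))"
    (is "?l \<longleftrightarrow> ?r")
proof
  assume ?l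
  show ?r
  proof (intro allI impI)
    fix \<epsilon> :: real assume "\<epsilon> > 0"
    with \<open>?l\<close> obtain b where "\<forall>t\<in>T. \<forall>t'\<in>T. b \<le> t \<longrightarrow> b \<le> t' \<longrightarrow> d (f t) (f t') < \<epsilon>"
      unfolding cauchy_along_def by blast
    moreover have "eventually (\<lambda>t. b \<le> t) (along T)"
      unfolding eventually_along[OF assms] by blast
    ultimately show "\<exists>P. eventually P (along T) \<and>
        (\<forall>t\<in>T. \<forall>t'\<in>T. P t \<longrightarrow> P t' \<longrightarrow> d (f t) (f t') < \<epsilon>)"
      by blast
  qed
next
  assume r: ?r
  show ?l
    unfolding cauchy_along_def
  proof (intro allI impI)
    fix \<epsilon> :: real assume "\<epsilon> > 0"
    with r obtain P where "eventually P (along T)"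
      and P: "\<forall>t\<in>T. \<forall>t'\<in>T. P t \<longrightarrow> P t' \<longrightarrow> d (f t) (f t') < \<epsilon>"
      by blast
    then obtain b where "\<forall>t\<in>T. b \<le> t \<longrightarrow> P t"
      unfolding eventually_along[OF assms] by blast
    with P show "\<exists>b. \<forall>t\<in>T. \<forall>t'\<in>T. b \<le> t \<longrightarrow> b \<le> t' \<longrightarrow> d (f t) (f t') < \<epsilon>"
      by blast
  qed
qed

lemma cauchy_alongD:
  assumes "cofinal T" "cauchy_along T d f" "\<epsilon> > 0"
  obtains b where "b \<in> T" "\<And>t t'. t \<in> T \<Longrightarrow> t' \<in> T \<Longrightarrow> b \<le> t \<Longrightarrow> b \<le> t' \<Longrightarrow> d (f t) (f t') < \<epsilon>"
proof -
  obtain c where c: "\<forall>t\<in>T. \<forall>t'\<in>T. c \<le> t \<longrightarrow> c \<le> t' \<longrightarrow> d (f t) (f t') < \<epsilon>"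
    using assms unfolding cauchy_along_def by blast
  obtain b where "b \<in> T" "c \<le> b"
    using assms(1) unfolding cofinal_def by blast
  then show ?thesis
    using c that[of b] by (meson order_trans)
qed

text \<open>The image filter of a Cauchy function is a Cauchy filter, and the reals are complete as a uniform space.\<close>

lemma convergent_along:
  fixes f :: "'t::linorder \<Rightarrow> real"
  assumes T: "cofinal T" and f: "cauchy_along T (\<lambda>x y. \<bar>x - y\<bar>) f"
  shows "\<exists>l. (f \<longlongrightarrow> l) (along T)"
proof -
  have "cauchy_filter (filtermap f (along T))"
    unfolding cauchy_filter_metric_filtermap
  proof (intro allI impI)
    fix e :: real assume "e > 0"
    with f obtain P where P: "eventually P (along T)"
      "\<forall>t\<in>T. \<forall>t'\<in>T. P t \<longrightarrow> P t' \<longrightarrow> \<bar>f t - f t'\<bar> < e"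
      unfolding cauchy_along_iff[OF T] by blast
    have "eventually (\<lambda>t. t \<in> T \<and> P t) (along T)"
      using P(1) unfolding eventually_along[OF T] by blast
    with P(2) show "\<exists>P. eventually P (along T) \<and> (\<forall>x y. P x \<and> P y \<longrightarrow> dist (f x) (f y) < e)"
      unfolding dist_real_def by blast
  qed
  moreover have "filtermap f (along T) \<noteq> bot"
    using along_nontrivial[OF T] by (simp add: filtermap_bot_iff)
  ultimately obtain l where "filtermap f (along T) \<le> nhds l"
    using complete_UNIV[where ?'a = real] unfolding complete_uniform by auto
  then show ?thesis
    by (auto simp: filterlim_def)
qed

text \<open>The common form of two constructions: Cauchy sequences, with the identity for every \<open>\<psi> t\<close>, give the
  completion, and functions that become Cauchy after rescaling by \<open>\<psi> t\<close> give the cone.\<close>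

locale cauchy_group = H: group H + K: pseudonormed_group K \<kappa>
  for H :: "('h, 'm) monoid_scheme" and K :: "('k, 'n) monoid_scheme" and \<kappa> +
  fixes T :: "'t::linorder set" and \<psi> :: "'t \<Rightarrow> 'h \<Rightarrow> 'k"
  assumes cofinal: "cofinal T" and \<psi>_hom: "t \<in> T \<Longrightarrow> \<psi> t \<in> hom H K"
begin

definition CG where
  "CG = (product_group T (\<lambda>_. H))
     \<lparr>carrier := {w \<in> T \<rightarrow>\<^sub>E carrier H. cauchy_along T K.d (\<lambda>t. \<psi> t (w t))}\<rparr>"

definition CN where "CN w = Lim (along T) (\<lambda>t. \<kappa> (\<psi> t (w t)))"

lemma \<psi>_group_hom: "t \<in> T \<Longrightarrow> group_hom H K (\<psi> t)"
  by (intro group_hom.intro group_hom_axioms.intro \<psi>_hom H.group_axioms K.group_axioms)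

lemma carrier_CG_iff:
  "w \<in> carrier CG \<longleftrightarrow> w \<in> T \<rightarrow>\<^sub>E carrier H \<and> cauchy_along T K.d (\<lambda>t. \<psi> t (w t))"
  by (simp add: CG_def)

lemma CG_mem: "w \<in> carrier CG \<Longrightarrow> t \<in> T \<Longrightarrow> w t \<in> carrier H"
  by (auto simp: carrier_CG_iff)

lemma \<psi>_closed: "t \<in> T \<Longrightarrow> x \<in> carrier H \<Longrightarrow> \<psi> t x \<in> carrier K"
  using group_hom.hom_closed[OF \<psi>_group_hom] .

lemma cauchy_mult:
  assumes "\<And>t. t \<in> T \<Longrightarrow> f t \<in> carrier K" "\<And>t. t \<in> T \<Longrightarrow> g t \<in> carrier K"
    and "cauchy_along T K.d f" "cauchy_along T K.d g"
  shows "cauchy_along T K.d (\<lambda>t. f t \<otimes>\<^bsub>K\<^esub> g t)"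
  unfolding cauchy_along_iff[OF cofinal]
proof (intro allI impI)
  fix \<epsilon> :: real assume "\<epsilon> > 0"
  then have "\<epsilon> / 2 > 0" by simp
  then obtain P Q where "eventually P (along T)" "eventually Q (along T)"
    and PQ: "\<forall>t\<in>T. \<forall>t'\<in>T. P t \<longrightarrow> P t' \<longrightarrow> K.d (f t) (f t') < \<epsilon> / 2"
      "\<forall>t\<in>T. \<forall>t'\<in>T. Q t \<longrightarrow> Q t' \<longrightarrow> K.d (g t) (g t') < \<epsilon> / 2"
    using assms(3,4)[unfolded cauchy_along_iff[OF cofinal]] by metis
  then have "eventually (\<lambda>t. P t \<and> Q t) (along T)"
    by (simp add: eventually_conj)
  moreover have "K.d (f t \<otimes>\<^bsub>K\<^esub> g t) (f t' \<otimes>\<^bsub>K\<^esub> g t') < \<epsilon>"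
    if "t \<in> T" "t' \<in> T" "P t \<and> Q t" "P t' \<and> Q t'" for t t'
  proof -
    have "K.d (f t \<otimes>\<^bsub>K\<^esub> g t) (f t' \<otimes>\<^bsub>K\<^esub> g t') \<le> K.d (f t) (f t') + K.d (g t) (g t')"
      using that assms(1,2) by (intro K.d_mult) auto
    also have "\<dots> < \<epsilon> / 2 + \<epsilon> / 2"
      using that PQ by (intro add_strict_mono) auto
    finally show ?thesis by simp
  qed
  ultimately show "\<exists>P. eventually P (along T) \<and> (\<forall>t\<in>T. \<forall>t'\<in>T. P t \<longrightarrow> P t' \<longrightarrow>
      K.d (f t \<otimes>\<^bsub>K\<^esub> g t) (f t' \<otimes>\<^bsub>K\<^esub> g t') < \<epsilon>)"
    by (intro exI[of _ "\<lambda>t. P t \<and> Q t"]) blast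
qed

lemma cauchy_along_cong:
  "(\<And>t t'. t \<in> T \<Longrightarrow> t' \<in> T \<Longrightarrow> K.d (f t) (f t') = K.d (g t) (g t')) \<Longrightarrow>
    cauchy_along T K.d f \<longleftrightarrow> cauchy_along T K.d g"
  by (simp add: cauchy_along_def)

lemma subgroup_CG: "subgroup (carrier CG) (product_group T (\<lambda>_. H))"
proof
  show "w \<otimes>\<^bsub>product_group T (\<lambda>_. H)\<^esub> v \<in> carrier CG"
    if w: "w \<in> carrier CG" and v: "v \<in> carrier CG" for w v
  proof -
    have "cauchy_along T K.d (\<lambda>t. \<psi> t (w t) \<otimes>\<^bsub>K\<^esub> \<psi> t (v t))"
      using w v by (intro cauchy_mult) (auto simp: carrier_CG_iff \<psi>_closed CG_mem)
    also have "?this \<longleftrightarrow> cauchy_along T K.d (\<lambda>t. \<psi> t (w t \<otimes>\<^bsub>H\<^esub> v t))"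
      using w v by (intro cauchy_along_cong) (simp add: CG_mem group_hom.hom_mult[OF \<psi>_group_hom])
    also have "\<dots> \<longleftrightarrow> cauchy_along T K.d (\<lambda>t. \<psi> t ((\<lambda>t\<in>T. w t \<otimes>\<^bsub>H\<^esub> v t) t))"
      by (intro cauchy_along_cong) simp
    finally show ?thesis
      using w v by (auto simp: carrier_CG_iff)
  qed
  show "\<one>\<^bsub>product_group T (\<lambda>_. H)\<^esub> \<in> carrier CG"
  proof -
    have "cauchy_along T K.d (\<lambda>t. \<one>\<^bsub>K\<^esub>)"
      by (auto simp: cauchy_along_def)
    also have "?this \<longleftrightarrow> cauchy_along T K.d (\<lambda>t. \<psi> t ((\<lambda>t\<in>T. \<one>\<^bsub>H\<^esub>) t))"
      by (intro cauchy_along_cong) (simp add: group_hom.hom_one[OF \<psi>_group_hom])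
    finally show ?thesis
      by (auto simp: carrier_CG_iff)
  qed
  show "inv\<^bsub>product_group T (\<lambda>_. H)\<^esub> w \<in> carrier CG" if w: "w \<in> carrier CG" for w
  proof -
    have "cauchy_along T K.d (\<lambda>t. \<psi> t (w t))"
      using w by (simp add: carrier_CG_iff)
    also have "?this \<longleftrightarrow> cauchy_along T K.d (\<lambda>t. \<psi> t ((\<lambda>t\<in>T. inv\<^bsub>H\<^esub> (w t)) t))"
      using w by (intro cauchy_along_cong)
        (simp add: CG_mem group_hom.hom_inv[OF \<psi>_group_hom] \<psi>_closed K.d_inv)
    finally show ?thesis
      using w by (auto simp: carrier_CG_iff H.group_axioms)
  qed
qed (auto simp: carrier_CG_iff)

lemma group_CG: "group CG"
proof -
  have "CG = (product_group T (\<lambda>_. H))\<lparr>carrier := carrier CG\<rparr>"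
    by (simp add: CG_def)
  with subgroup.subgroup_is_group[OF subgroup_CG] H.group_axioms show ?thesis
    by simp
qed

lemma mult_CG: "w \<otimes>\<^bsub>CG\<^esub> v = (\<lambda>t\<in>T. w t \<otimes>\<^bsub>H\<^esub> v t)"
  and one_CG: "\<one>\<^bsub>CG\<^esub> = (\<lambda>t\<in>T. \<one>\<^bsub>H\<^esub>)"
  by (simp_all add: CG_def)

lemma inv_CG: assumes "w \<in> carrier CG" shows "inv\<^bsub>CG\<^esub> w = (\<lambda>t\<in>T. inv\<^bsub>H\<^esub> (w t))"
proof (rule group.inv_equality[OF group_CG])
  have eq: "inv\<^bsub>product_group T (\<lambda>_. H)\<^esub> w = (\<lambda>t\<in>T. inv\<^bsub>H\<^esub> (w t))"
    using assms by (auto simp: carrier_CG_iff H.group_axioms)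
  show "(\<lambda>t\<in>T. inv\<^bsub>H\<^esub> w t) \<in> carrier CG"
    using subgroup.m_inv_closed[OF subgroup_CG assms] unfolding eq .
  show "(\<lambda>t\<in>T. inv\<^bsub>H\<^esub> w t) \<otimes>\<^bsub>CG\<^esub> w = \<one>\<^bsub>CG\<^esub>"
    using assms by (auto simp: mult_CG one_CG CG_mem)
qed fact

lemma CN_tendsto:
  assumes w: "w \<in> carrier CG" shows "((\<lambda>t. \<kappa> (\<psi> t (w t))) \<longlongrightarrow> CN w) (along T)"
proof -
  have "cauchy_along T (\<lambda>x y. \<bar>x - y\<bar>) (\<lambda>t. \<kappa> (\<psi> t (w t)))"
    unfolding cauchy_along_def
  proof (intro allI impI)
    fix \<epsilon> :: real assume "\<epsilon> > 0"
    then obtain b where "\<forall>t\<in>T. \<forall>t'\<in>T. b \<le> t \<longrightarrow> b \<le> t' \<longrightarrow> K.d (\<psi> t (w t)) (\<psi> t' (w t')) < \<epsilon>"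
      using w unfolding carrier_CG_iff cauchy_along_def by blast
    moreover have "\<bar>\<kappa> (\<psi> t (w t)) - \<kappa> (\<psi> t' (w t'))\<bar> \<le> K.d (\<psi> t (w t)) (\<psi> t' (w t'))"
      if "t \<in> T" "t' \<in> T" for t t'
      using that w by (intro K.norm_diff_le \<psi>_closed CG_mem)
    ultimately show "\<exists>b. \<forall>t\<in>T. \<forall>t'\<in>T. b \<le> t \<longrightarrow> b \<le> t' \<longrightarrow>
        \<bar>\<kappa> (\<psi> t (w t)) - \<kappa> (\<psi> t' (w t'))\<bar> < \<epsilon>"
      by (meson le_less_trans)
  qed
  from convergent_along[OF cofinal this] obtain l
    where l: "((\<lambda>t. \<kappa> (\<psi> t (w t))) \<longlongrightarrow> l) (along T)" ..
  then show ?thesis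
    unfolding CN_def using tendsto_Lim[OF along_nontrivial[OF cofinal] l] by simp
qed

lemma CN_eqI:
  assumes "((\<lambda>t. \<kappa> (\<psi> t (w t))) \<longlongrightarrow> l) (along T)" shows "CN w = l"
  unfolding CN_def by (rule tendsto_Lim[OF along_nontrivial[OF cofinal] assms])

lemma eventually_along_T: "(\<And>t. t \<in> T \<Longrightarrow> P t) \<Longrightarrow> eventually P (along T)"
  unfolding eventually_inf_principal by simp

lemma CN_cong:
  assumes "w \<in> carrier CG" "\<And>t. t \<in> T \<Longrightarrow> \<kappa> (\<psi> t (v t)) = \<kappa> (\<psi> t (w t))"
  shows "CN v = CN w"
proof (rule CN_eqI)
  have "eventually (\<lambda>t. \<kappa> (\<psi> t (w t)) = \<kappa> (\<psi> t (v t))) (along T)"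
    using assms(2) by (intro eventually_along_T) simp
  from Lim_transform_eventually[OF CN_tendsto[OF assms(1)] this]
  show "((\<lambda>t. \<kappa> (\<psi> t (v t))) \<longlongrightarrow> CN w) (along T)" .
qed

lemma pseudonormed_CG: "pseudonormed_group CG CN"
proof -
  interpret CG: group CG by (rule group_CG)
  note nontriv = along_nontrivial[OF cofinal]
  show ?thesis
  proof (unfold_locales, unfold conj_inv_pseudonorm_def, intro conjI ballI)
    show "0 \<le> CN w" if w: "w \<in> carrier CG" for w
      by (rule tendsto_lowerbound[OF CN_tendsto[OF w] _ nontriv])
        (use w in \<open>auto intro!: eventually_along_T K.norm_nonneg \<psi>_closed CG_mem\<close>)
    show "CN \<one>\<^bsub>CG\<^esub> = 0"
    proof (rule CN_eqI, rule tendsto_eventually)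
      show "eventually (\<lambda>t. \<kappa> (\<psi> t (\<one>\<^bsub>CG\<^esub> t)) = 0) (along T)"
        by (rule eventually_along_T) (simp add: one_CG group_hom.hom_one[OF \<psi>_group_hom])
    qed
    show "CN (inv\<^bsub>CG\<^esub> w) = CN w" if w: "w \<in> carrier CG" for w
      using w by (intro CN_cong)
        (auto simp: inv_CG CG_mem group_hom.hom_inv[OF \<psi>_group_hom] \<psi>_closed K.norm_inv)
    show "CN (w \<otimes>\<^bsub>CG\<^esub> v) \<le> CN w + CN v" if w: "w \<in> carrier CG" and v: "v \<in> carrier CG" for w v
    proof (rule tendsto_le[OF nontriv])
      show "((\<lambda>t. \<kappa> (\<psi> t (w t)) + \<kappa> (\<psi> t (v t))) \<longlongrightarrow> CN w + CN v) (along T)"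
        by (intro tendsto_add CN_tendsto w v)
      show "((\<lambda>t. \<kappa> (\<psi> t ((w \<otimes>\<^bsub>CG\<^esub> v) t))) \<longlongrightarrow> CN (w \<otimes>\<^bsub>CG\<^esub> v)) (along T)"
        using w v by (intro CN_tendsto CG.m_closed)
      show "eventually (\<lambda>t. \<kappa> (\<psi> t ((w \<otimes>\<^bsub>CG\<^esub> v) t)) \<le> \<kappa> (\<psi> t (w t)) + \<kappa> (\<psi> t (v t))) (along T)"
        by (rule eventually_along_T)
          (use w v in \<open>simp add: mult_CG group_hom.hom_mult[OF \<psi>_group_hom] CG_mem
            K.norm_mult \<psi>_closed\<close>)
    qed
    show "CN (v \<otimes>\<^bsub>CG\<^esub> w \<otimes>\<^bsub>CG\<^esub> inv\<^bsub>CG\<^esub> v) = CN w"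
      if w: "w \<in> carrier CG" and v: "v \<in> carrier CG" for w v
      using w v by (intro CN_cong)
        (auto simp: mult_CG inv_CG group_hom.hom_mult[OF \<psi>_group_hom]
          group_hom.hom_inv[OF \<psi>_group_hom] CG_mem \<psi>_closed K.norm_conj)
  qed
qed

sublocale CG: pseudonormed_group CG CN
  by (rule pseudonormed_CG)

lemma d_CG_tendsto:
  assumes w: "w \<in> carrier CG" and v: "v \<in> carrier CG"
  shows "((\<lambda>t. K.d (\<psi> t (w t)) (\<psi> t (v t))) \<longlongrightarrow> CG.d w v) (along T)"
proof -
  have "((\<lambda>t. \<kappa> (\<psi> t ((inv\<^bsub>CG\<^esub> w \<otimes>\<^bsub>CG\<^esub> v) t))) \<longlongrightarrow> CG.d w v) (along T)"
    using CN_tendsto[of "inv\<^bsub>CG\<^esub> w \<otimes>\<^bsub>CG\<^esub> v"] w v by (simp add: CG.d_eq)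
  moreover have "eventually (\<lambda>t. \<kappa> (\<psi> t ((inv\<^bsub>CG\<^esub> w \<otimes>\<^bsub>CG\<^esub> v) t))
      = K.d (\<psi> t (w t)) (\<psi> t (v t))) (along T)"
    by (rule eventually_along_T)
      (use w v in \<open>simp add: mult_CG inv_CG K.d_eq group_hom.hom_mult[OF \<psi>_group_hom]
        group_hom.hom_inv[OF \<psi>_group_hom] CG_mem \<psi>_closed\<close>)
  ultimately show ?thesis
    by (rule Lim_transform_eventually)
qed

end

section \<open>Free products of copies of the reals\<close>

lemma carrier_free_real:
  "w \<in> carrier (free_real I) \<longleftrightarrow>
    set w \<subseteq> I \<times> (UNIV - {0}) \<and> successively (\<lambda>p q. fst p \<noteq> fst q) w"
  by (simp add: free_real_def)

lemma mult_free_real: "u \<otimes>\<^bsub>free_real I\<^esub> v = foldr push_syl u v"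
  and one_free_real: "\<one>\<^bsub>free_real I\<^esub> = []"
  by (simp_all add: free_real_def)

lemma free_real_mono: "I \<subseteq> J \<Longrightarrow> w \<in> carrier (free_real I) \<Longrightarrow> w \<in> carrier (free_real J)"
  by (auto simp: carrier_free_real)

text \<open>The element spelled by a list that need not be in normal form.\<close>

definition word :: "('i \<times> real) list \<Rightarrow> ('i \<times> real) list" where
  "word W = foldr push_syl W []"

lemma word_Nil [simp]: "word [] = []"
  and word_Cons: "word (p # W) = push_syl p (word W)"
  by (simp_all add: word_def)

context
  fixes I :: "'i set"
begin

interpretation group "free_real I" by (rule group_free_real)

lemma bar_closed [simp, intro]: "g \<in> I \<Longrightarrow> bar g r \<in> carrier (free_real I)"
  by (auto simp: bar_def carrier_free_real)

lemma bar_0: "bar g 0 = []"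
  by (simp add: bar_def)

lemma bar_inv: assumes "g \<in> I" shows "inv\<^bsub>free_real I\<^esub> (bar g r) = bar g (- r)"
  by (rule inv_equality) (use assms in \<open>auto simp: bar_mult bar_0 one_free_real\<close>)

lemma bar_nat_pow: "g \<in> I \<Longrightarrow> bar g r [^]\<^bsub>free_real I\<^esub> (n::nat) = bar g (real n * r)"
  by (induction n) (auto simp: bar_mult bar_0 one_free_real algebra_simps)

lemma bar_int_pow:
  assumes "g \<in> I" shows "bar g r [^]\<^bsub>free_real I\<^esub> (n::int) = bar g (real_of_int n * r)"
proof (cases n rule: int_cases2)
  case (nonneg k)
  then show ?thesis
    using assms by (simp add: int_pow_int bar_nat_pow)
next
  case (nonpos k)
  then show ?thesis
    using assms by (simp add: int_pow_neg int_pow_int bar_nat_pow bar_inv)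
qed

lemma push_syl_eq_mult:
  "push_syl p w = bar (fst p) (snd p) \<otimes>\<^bsub>free_real I\<^esub> w"
  by (cases p) (simp add: bar_def mult_free_real push_syl_0)

lemma word_closed [simp, intro]: "fst ` set W \<subseteq> I \<Longrightarrow> word W \<in> carrier (free_real I)"
  unfolding word_def by (rule foldr_push_syl_carrier) (auto simp: carrier_free_real)

lemma word_append:
  "fst ` set U \<subseteq> I \<Longrightarrow> fst ` set V \<subseteq> I \<Longrightarrow> word (U @ V) = word U \<otimes>\<^bsub>free_real I\<^esub> word V"
proof (induction U)
  case (Cons p U)
  then have "push_syl p (word (U @ V)) = push_syl p (word U \<otimes>\<^bsub>free_real I\<^esub> word V)"
    by simp
  with Cons.prems show ?case
    by (simp add: word_Cons push_syl_eq_mult m_assoc)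
qed (simp add: mult_free_real)

lemma word_eq_list_mult: "word W = list_mult (free_real I) (map (\<lambda>(g, r). bar g r) W)"
  by (induction W) (auto simp: word_Cons push_syl_eq_mult one_free_real)

lemma word_normal: "w \<in> carrier (free_real I) \<Longrightarrow> word w = w"
  unfolding word_eq_list_mult by (rule normal_form_eq_product[symmetric])

lemma word_single: "word [(g, r)] = bar g r"
  by (simp add: word_Cons push_syl_def bar_def)

lemma mult_eq_word:
  assumes "u \<in> carrier (free_real I)" "v \<in> carrier (free_real I)"
  shows "u \<otimes>\<^bsub>free_real I\<^esub> v = word (u @ v)"
proof -
  have "fst ` set u \<subseteq> I" "fst ` set v \<subseteq> I"
    using assms by (auto simp: carrier_free_real)
  then show ?thesis
    using assms by (simp add: word_append word_normal)
qed

end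

subsection \<open>Homomorphisms out of a free product of copies of the reals\<close>

definition additive_subgroup :: "real set \<Rightarrow> bool" where
  "additive_subgroup S \<longleftrightarrow> 0 \<in> S \<and> (\<forall>r\<in>S. \<forall>s\<in>S. r + s \<in> S) \<and> (\<forall>r\<in>S. - r \<in> S)"

lemma additive_subgroup_UNIV [simp]: "additive_subgroup UNIV"
  and additive_subgroup_Ints [simp]: "additive_subgroup \<int>"
  by (auto simp: additive_subgroup_def)

lemma set_push_syl:
  assumes "additive_subgroup S" "p \<in> J \<times> S" "set w \<subseteq> J \<times> S"
  shows "set (push_syl p w) \<subseteq> J \<times> S"
  using assms by (cases w) (auto simp: push_syl_def additive_subgroup_def)

lemma set_foldr_push_syl:
  assumes "additive_subgroup S"
  shows "set u \<subseteq> J \<times> S \<Longrightarrow> set v \<subseteq> J \<times> S \<Longrightarrow> set (foldr push_syl u v) \<subseteq> J \<times> S"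
proof (induction u)
  case (Cons p u)
  then show ?case
    using set_push_syl[OF assms, of p J "foldr push_syl u v"] by simp
qed simp

lemma subgroup_words:
  assumes S: "additive_subgroup S"
  shows "subgroup {w \<in> carrier (free_real I). set w \<subseteq> J \<times> S} (free_real I)"
proof -
  interpret group "free_real I" by (rule group_free_real)
  have mult: "u \<otimes>\<^bsub>free_real I\<^esub> v \<in> {w \<in> carrier (free_real I). set w \<subseteq> J \<times> S}"
    if "u \<in> {w \<in> carrier (free_real I). set w \<subseteq> J \<times> S}"
      "v \<in> {w \<in> carrier (free_real I). set w \<subseteq> J \<times> S}" for u v
    using that set_foldr_push_syl[OF S, of u J v] m_closed[of u v] by (simp add: mult_free_real)
  have inv: "inv\<^bsub>free_real I\<^esub> w \<in> {w \<in> carrier (free_real I). set w \<subseteq> J \<times> S}"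
    if "w \<in> {w \<in> carrier (free_real I). set w \<subseteq> J \<times> S}" for w
    using that
  proof (induction w)
    case Nil
    then show ?case
      using inv_one by (simp add: one_free_real)
  next
    case (Cons p w)
    then have p: "fst p \<in> I" "p \<in> J \<times> S" and w: "w \<in> {w \<in> carrier (free_real I). set w \<subseteq> J \<times> S}"
      by (auto simp: carrier_free_real successively_Cons)
    then have "bar (fst p) (- snd p) \<in> {w \<in> carrier (free_real I). set w \<subseteq> J \<times> S}"
      using S by (auto simp: bar_def carrier_free_real additive_subgroup_def)
    with Cons.IH[OF w] have
      "inv\<^bsub>free_real I\<^esub> w \<otimes>\<^bsub>free_real I\<^esub> bar (fst p) (- snd p)
        \<in> {w \<in> carrier (free_real I). set w \<subseteq> J \<times> S}"
      by (rule mult)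
    also have "inv\<^bsub>free_real I\<^esub> w \<otimes>\<^bsub>free_real I\<^esub> bar (fst p) (- snd p) =
        inv\<^bsub>free_real I\<^esub> (bar (fst p) (snd p) \<otimes>\<^bsub>free_real I\<^esub> w)"
      using p w by (simp add: inv_mult_group bar_inv)
    also have "bar (fst p) (snd p) \<otimes>\<^bsub>free_real I\<^esub> w = p # w"
      using word_normal[of "p # w" I] word_normal[of w I] w Cons.prems
      by (simp add: word_Cons push_syl_eq_mult[of _ _ I])
    finally show ?case .
  qed
  show ?thesis
    by (intro subgroupI) (use mult inv in \<open>auto simp: carrier_free_real intro!: exI[of _ "[]"]\<close>)
qed

text \<open>With integral exponents this describes the free group on the letters \<open>bar g 1\<close>, and with real exponents the
  free product over a subset of the indices.\<close>

lemma generate_words: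
  assumes S: "additive_subgroup S" and J: "J \<subseteq> I"
    and X: "X \<subseteq> {bar g r | g r. g \<in> J \<and> r \<in> S}"
    and gen: "\<And>g r. g \<in> J \<Longrightarrow> r \<in> S \<Longrightarrow> bar g r \<in> generate (free_real I) X"
  shows "generate (free_real I) X = {w \<in> carrier (free_real I). set w \<subseteq> J \<times> S}"
proof
  interpret group "free_real I" by (rule group_free_real)
  have "X \<subseteq> {w \<in> carrier (free_real I). set w \<subseteq> J \<times> S}"
  proof
    fix x assume "x \<in> X"
    then obtain g r where "x = bar g r" "g \<in> J" "r \<in> S"
      using X by blast
    then show "x \<in> {w \<in> carrier (free_real I). set w \<subseteq> J \<times> S}"
      using J by (auto simp: bar_def carrier_free_real)
  qed
  then show "generate (free_real I) X \<subseteq> {w \<in> carrier (free_real I). set w \<subseteq> J \<times> S}"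
    by (intro generate_subgroup_incl subgroup_words S)
  show "{w \<in> carrier (free_real I). set w \<subseteq> J \<times> S} \<subseteq> generate (free_real I) X"
  proof
    fix w assume w: "w \<in> {w \<in> carrier (free_real I). set w \<subseteq> J \<times> S}"
    have "set W \<subseteq> J \<times> S \<Longrightarrow> word W \<in> generate (free_real I) X" for W
    proof (induction W)
      case Nil
      then show ?case
        using generate.one[of "free_real I" X] by (simp add: one_free_real)
    next
      case (Cons p W)
      then show ?case
        using gen[of "fst p" "snd p"] by (auto simp: word_Cons push_syl_eq_mult[of _ _ I] intro: generate.eng)
    qed
    from this[of w] w show "w \<in> generate (free_real I) X"
      using word_normal[of w I] by auto
  qed
qed

lemma FR_sub_eq_free_real: "\<Theta> \<subseteq> carrier G \<Longrightarrow> FR_sub G \<Theta> = free_real \<Theta>"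
proof -
  assume \<Theta>: "\<Theta> \<subseteq> carrier G"
  have "generate (free_real (carrier G)) {bar \<theta> r | \<theta> r. \<theta> \<in> \<Theta>}
      = {w \<in> carrier (free_real (carrier G)). set w \<subseteq> \<Theta> \<times> UNIV}"
    by (rule generate_words) (use \<Theta> in \<open>auto intro!: generate.incl\<close>)
  also have "\<dots> = carrier (free_real \<Theta>)"
    by (rule Set.set_eqI) (use \<Theta> in \<open>auto simp: carrier_free_real subset_iff\<close>)
  finally show ?thesis
    by (simp add: FR_sub_def FR_def free_real_def)
qed

lemma carrier_F_int:
  "carrier (F_int G) = {w \<in> carrier (FR G). set w \<subseteq> carrier G \<times> \<int>}"
proof -
  interpret group "free_real (carrier G)" by (rule group_free_real)
  have "generate (free_real (carrier G)) {bar g 1 | g. g \<in> carrier G}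
      = {w \<in> carrier (free_real (carrier G)). set w \<subseteq> carrier G \<times> \<int>}"
  proof (rule generate_words)
    fix g and r :: real assume g: "g \<in> carrier G" and "r \<in> \<int>"
    then obtain n where n: "r = of_int n" by (auto elim: Ints_cases)
    have "bar g 1 [^]\<^bsub>free_real (carrier G)\<^esub> n \<in> generate (free_real (carrier G)) {bar g 1 | g. g \<in> carrier G}"
      by (rule subgroup_int_pow_closed[OF generate_is_subgroup])
        (use g in \<open>auto intro: generate.incl\<close>)
    then show "bar g r \<in> generate (free_real (carrier G)) {bar g 1 | g. g \<in> carrier G}"
      using g by (simp add: bar_int_pow n)
  qed (force intro: Ints_1)+
  then show ?thesis
    by (simp add: F_int_def FR_def)
qed

lemma group_FR: "group (FR G)"
  by (simp add: FR_def group_free_real)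

lemma group_F_int: "group (F_int G)"
  and subgroup_F_int: "subgroup (carrier (F_int G)) (FR G)"
proof -
  show sub: "subgroup (carrier (F_int G)) (FR G)"
    unfolding carrier_F_int unfolding FR_def by (rule subgroup_words) simp
  have "F_int G = (FR G)\<lparr>carrier := carrier (F_int G)\<rparr>"
    by (simp add: F_int_def)
  then show "group (F_int G)"
    using subgroup.subgroup_is_group[OF sub group_FR] by simp
qed

lemma mult_F_int: "u \<otimes>\<^bsub>F_int G\<^esub> v = u \<otimes>\<^bsub>FR G\<^esub> v"
  by (simp add: F_int_def)

definition lift :: "('g, 'm) monoid_scheme \<Rightarrow> ('i \<Rightarrow> real \<Rightarrow> 'g) \<Rightarrow> ('i \<times> real) list \<Rightarrow> 'g" where
  "lift L \<phi> W = list_mult L (map (\<lambda>(g, r). \<phi> g r) W)"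

lemma lift_Nil [simp]: "lift L \<phi> [] = \<one>\<^bsub>L\<^esub>"
  and lift_Cons: "lift L \<phi> (p # W) = \<phi> (fst p) (snd p) \<otimes>\<^bsub>L\<^esub> lift L \<phi> W"
  by (simp_all add: lift_def split: prod.split)

text \<open>Additivity is only demanded for exponents in \<open>S\<close>: the powers \<open>g ^ \<lfloor>r\<rfloor>\<close> that define the projection to
  the group are additive in \<open>r\<close> for integral \<open>r\<close> only.\<close>

locale additive_family = group L for L (structure) +
  fixes J :: "'i set" and S :: "real set" and \<phi> :: "'i \<Rightarrow> real \<Rightarrow> 'a"
  assumes S: "additive_subgroup S"
    and \<phi>_closed: "g \<in> J \<Longrightarrow> r \<in> S \<Longrightarrow> \<phi> g r \<in> carrier L"
    and \<phi>_add: "g \<in> J \<Longrightarrow> r \<in> S \<Longrightarrow> s \<in> S \<Longrightarrow> \<phi> g (r + s) = \<phi> g r \<otimes> \<phi> g s"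
begin

lemma \<phi>_0: assumes "g \<in> J" shows "\<phi> g 0 = \<one>"
proof -
  have "0 \<in> S"
    using S by (simp add: additive_subgroup_def)
  then show ?thesis
    using \<phi>_add[OF assms, of 0 0] \<phi>_closed[OF assms, of 0] by simp
qed

lemma lift_closed: "set W \<subseteq> J \<times> S \<Longrightarrow> lift L \<phi> W \<in> carrier L"
  by (induction W) (auto simp: lift_Cons \<phi>_closed)

lemma lift_push_syl:
  assumes p: "p \<in> J \<times> S" and w: "set w \<subseteq> J \<times> S"
  shows "lift L \<phi> (push_syl p w) = \<phi> (fst p) (snd p) \<otimes> lift L \<phi> w"
proof (cases "snd p = 0")
  case True
  then show ?thesis
    using p w by (auto simp: push_syl_def \<phi>_0 lift_closed)
next
  case p0: False
  show ?thesis
  proof (cases w)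
    case Nil
    then show ?thesis
      using p p0 by (auto simp: push_syl_def lift_Cons \<phi>_closed)
  next
    case (Cons q v)
    have q: "fst q \<in> J" "snd q \<in> S" and v: "set v \<subseteq> J \<times> S"
      using w Cons by auto
    show ?thesis
    proof (cases "fst q = fst p")
      case True
      then have "\<phi> (fst p) (snd p) \<otimes> lift L \<phi> w = \<phi> (fst p) (snd p + snd q) \<otimes> lift L \<phi> v"
        using p q v by (auto simp: Cons lift_Cons \<phi>_add \<phi>_closed lift_closed m_assoc)
      then show ?thesis
        using p v p0 True by (auto simp: Cons push_syl_def lift_Cons \<phi>_0 lift_closed)
    next
      case False
      then show ?thesis
        using p0 by (simp add: Cons push_syl_def lift_Cons)
    qed
  qed
qed

lemma lift_foldr_push_syl:
  "set u \<subseteq> J \<times> S \<Longrightarrow> set v \<subseteq> J \<times> S \<Longrightarrow>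
    lift L \<phi> (foldr push_syl u v) = lift L \<phi> u \<otimes> lift L \<phi> v"
proof (induction u)
  case (Cons p u)
  then show ?case
    using set_foldr_push_syl[OF S, of u J v]
    by (auto simp: lift_push_syl lift_Cons m_assoc \<phi>_closed lift_closed)
qed (simp add: lift_closed)

lemma lift_word: "set W \<subseteq> J \<times> S \<Longrightarrow> lift L \<phi> (word W) = lift L \<phi> W"
  using lift_foldr_push_syl[of W "[]"] by (simp add: word_def lift_closed)

lemma lift_bar: "g \<in> J \<Longrightarrow> r \<in> S \<Longrightarrow> lift L \<phi> (bar g r) = \<phi> g r"
  by (simp add: bar_def lift_Cons \<phi>_0 \<phi>_closed)

end

lemma lift_hom:
  assumes "additive_family L I UNIV \<phi>"
  shows "lift L \<phi> \<in> hom (free_real I) L"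
proof (rule homI)
  interpret additive_family L I UNIV \<phi> by fact
  show "lift L \<phi> x \<in> carrier L" if "x \<in> carrier (free_real I)" for x
    using that by (intro lift_closed) (auto simp: carrier_free_real)
  show "lift L \<phi> (x \<otimes>\<^bsub>free_real I\<^esub> y) = lift L \<phi> x \<otimes>\<^bsub>L\<^esub> lift L \<phi> y"
    if "x \<in> carrier (free_real I)" "y \<in> carrier (free_real I)" for x y
    unfolding mult_free_real using that by (intro lift_foldr_push_syl) (auto simp: carrier_free_real)
qed

lemma pi_hom_eq_lift: "pi_hom G = lift G (\<lambda>g r. g [^]\<^bsub>G\<^esub> \<lfloor>r\<rfloor>)"
  by (rule ext) (simp add: pi_hom_def lift_def)

lemma psi_eq_lift: "psi G t = lift (FR G) (\<lambda>g r. bar g (t * r))"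
  by (rule ext) (simp add: psi_def lift_def)

lemma additive_family_pi:
  assumes "group G" shows "additive_family G (carrier G) \<int> (\<lambda>g r. g [^]\<^bsub>G\<^esub> \<lfloor>r\<rfloor>)"
proof -
  interpret group G by fact
  show ?thesis
    by unfold_locales (auto elim!: Ints_cases simp: int_pow_mult simp flip: of_int_add)
qed

lemma additive_family_psi: "additive_family (FR G) (carrier G) UNIV (\<lambda>g r. bar g (t * r))"
proof -
  interpret group "FR G" by (rule group_FR)
  show ?thesis
    by unfold_locales (auto simp: FR_def bar_mult distrib_left)
qed

lemma psi_hom: "psi G t \<in> hom (FR G) (FR G)"
  using lift_hom[OF additive_family_psi] by (simp add: psi_eq_lift FR_def)

lemma pi_hom_hom: assumes "group G" shows "pi_hom G \<in> hom (F_int G) G"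
proof (rule homI)
  interpret additive_family G "carrier G" \<int> "\<lambda>g r. g [^]\<^bsub>G\<^esub> \<lfloor>r\<rfloor>"
    by (rule additive_family_pi) fact
  show "pi_hom G x \<in> carrier G" if "x \<in> carrier (F_int G)" for x
    using that by (auto simp: pi_hom_eq_lift carrier_F_int intro: lift_closed)
  show "pi_hom G (x \<otimes>\<^bsub>F_int G\<^esub> y) = pi_hom G x \<otimes>\<^bsub>G\<^esub> pi_hom G y"
    if "x \<in> carrier (F_int G)" "y \<in> carrier (F_int G)" for x y
    using that by (simp add: mult_F_int FR_def mult_free_real pi_hom_eq_lift carrier_F_int
        lift_foldr_push_syl)
qed

section \<open>The weighted pseudonorm\<close>

text \<open>An expression of \<open>x\<close> as a product of conjugates of syllables, recorded by its cost \<open>c\<close>. The signs in the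
  factors are absorbed into the exponents.\<close>

inductive expr :: "'i set \<Rightarrow> ('i \<Rightarrow> real) \<Rightarrow> ('i \<times> real) list \<Rightarrow> real \<Rightarrow> bool" for I \<omega> where
  expr_one: "expr I \<omega> \<one>\<^bsub>free_real I\<^esub> 0"
| expr_step: "expr I \<omega> x c \<Longrightarrow> h \<in> carrier (free_real I) \<Longrightarrow> g \<in> I \<Longrightarrow>
    expr I \<omega> ((h \<otimes>\<^bsub>free_real I\<^esub> bar g r \<otimes>\<^bsub>free_real I\<^esub> inv\<^bsub>free_real I\<^esub> h) \<otimes>\<^bsub>free_real I\<^esub> x)
      (\<bar>r\<bar> * \<omega> g + c)"

locale weighted =
  fixes I :: "'i set" and \<omega> :: "'i \<Rightarrow> real"
  assumes \<omega>_nonneg: "g \<in> I \<Longrightarrow> 0 \<le> \<omega> g"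
begin

abbreviation "K \<equiv> free_real I"
abbreviation wnorm where "wnorm \<equiv> weight_pseudonorm (free_real I) I \<omega>"

sublocale K: group K by (rule group_free_real)

lemma expr_closed: "expr I \<omega> x c \<Longrightarrow> x \<in> carrier K"
  by (induction rule: expr.induct) auto

lemma expr_nonneg: "expr I \<omega> x c \<Longrightarrow> 0 \<le> c"
  by (induction rule: expr.induct) (auto simp: \<omega>_nonneg)

lemma wnorm_eq: "wnorm x = Inf {c. expr I \<omega> x c}"
proof -
  define ev where "ev = (\<lambda>(h, g, r, e). h \<otimes>\<^bsub>K\<^esub> (bar g r [^]\<^bsub>K\<^esub> (e::int)) \<otimes>\<^bsub>K\<^esub> inv\<^bsub>K\<^esub> h)"
  define ok where "ok = (\<lambda>(h, g, r :: real, e). h \<in> carrier K \<and> g \<in> I \<and> (e = 1 \<or> e = (-1::int)))"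
  define cost where "cost cs = (\<Sum>(h :: ('i \<times> real) list, g, r, e :: int)\<leftarrow>cs. \<bar>r\<bar> * \<omega> g)" for cs
  have "expr I \<omega> x c \<longleftrightarrow> (\<exists>cs. c = cost cs \<and> (\<forall>q\<in>set cs. ok q) \<and> x = list_mult K (map ev cs))"
    for c
  proof
    assume "expr I \<omega> x c"
    then show "\<exists>cs. c = cost cs \<and> (\<forall>q\<in>set cs. ok q) \<and> x = list_mult K (map ev cs)"
    proof (induction rule: expr.induct)
      case expr_one
      show ?case
        by (rule exI[of _ "[]"]) (simp add: cost_def)
    next
      case (expr_step x c h g r)
      then obtain cs where "c = cost cs" "\<forall>q\<in>set cs. ok q" "x = list_mult K (map ev cs)"
        by blast
      with expr_step.hyps show ?case
        by (intro exI[of _ "(h, g, r, 1) # cs"]) (simp add: cost_def ok_def ev_def bar_int_pow)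
    qed
  next
    assume "\<exists>cs. c = cost cs \<and> (\<forall>q\<in>set cs. ok q) \<and> x = list_mult K (map ev cs)"
    then obtain cs where "c = cost cs" "\<forall>q\<in>set cs. ok q" "x = list_mult K (map ev cs)"
      by blast
    then show "expr I \<omega> x c"
    proof (induction cs arbitrary: x c)
      case Nil
      then show ?case
        by (simp add: cost_def expr_one)
    next
      case (Cons q cs)
      obtain h g r e where q: "q = (h, g, r, e)" by (cases q)
      have hg: "h \<in> carrier K" "g \<in> I" "e = 1 \<or> e = -1"
        using Cons.prems by (auto simp: q ok_def)
      have "expr I \<omega> ((h \<otimes>\<^bsub>K\<^esub> bar g (of_int e * r) \<otimes>\<^bsub>K\<^esub> inv\<^bsub>K\<^esub> h) \<otimes>\<^bsub>K\<^esub> list_mult K (map ev cs))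
          (\<bar>of_int e * r\<bar> * \<omega> g + cost cs)"
        using Cons.prems hg by (intro expr_step Cons.IH) auto
      moreover have "\<bar>of_int e * r\<bar> = \<bar>r\<bar>"
        using hg by auto
      ultimately show ?case
        using Cons.prems hg by (simp add: q cost_def ev_def bar_int_pow)
    qed
  qed
  then have "{c. expr I \<omega> x c} = {cost cs | cs. (\<forall>q\<in>set cs. ok q) \<and> x = list_mult K (map ev cs)}"
    by blast
  then show ?thesis
    unfolding weight_pseudonorm_def cost_def ok_def ev_def by simp
qed

lemma expr_mult:
  assumes "expr I \<omega> x a" "expr I \<omega> y b" shows "expr I \<omega> (x \<otimes>\<^bsub>K\<^esub> y) (a + b)"
  using assms(1)
proof (induction rule: expr.induct)
  case expr_one
  then show ?case
    using assms(2) expr_closed[OF assms(2)] by simp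
next
  case (expr_step x c h g r)
  have "expr I \<omega> ((h \<otimes>\<^bsub>K\<^esub> bar g r \<otimes>\<^bsub>K\<^esub> inv\<^bsub>K\<^esub> h) \<otimes>\<^bsub>K\<^esub> (x \<otimes>\<^bsub>K\<^esub> y)) (\<bar>r\<bar> * \<omega> g + (c + b))"
    by (intro expr.expr_step expr_step)
  then show ?case
    using expr_step.hyps expr_closed[OF assms(2)] expr_closed[OF expr_step.hyps(1)]
    by (simp add: K.m_assoc add.assoc)
qed

lemma expr_conj_bar:
  assumes "h \<in> carrier K" "g \<in> I"
  shows "expr I \<omega> (h \<otimes>\<^bsub>K\<^esub> bar g r \<otimes>\<^bsub>K\<^esub> inv\<^bsub>K\<^esub> h) (\<bar>r\<bar> * \<omega> g)"
  using expr_step[OF expr_one assms] assms by simp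

lemma expr_bar: "g \<in> I \<Longrightarrow> expr I \<omega> (bar g r) (\<bar>r\<bar> * \<omega> g)"
  using expr_conj_bar[of "\<one>\<^bsub>K\<^esub>" g r] by simp

lemma expr_exists: assumes "x \<in> carrier K" shows "\<exists>c. expr I \<omega> x c"
proof -
  have "fst ` set W \<subseteq> I \<Longrightarrow> \<exists>c. expr I \<omega> (word W) c" for W
  proof (induction W)
    case Nil
    then show ?case
      using expr_one[of I \<omega>] by (auto simp: one_free_real)
  next
    case (Cons p W)
    then show ?case
      using expr_mult[OF expr_bar[of "fst p" "snd p"]] by (auto simp: word_Cons push_syl_eq_mult[of _ _ I])
  qed
  moreover have "fst ` set x \<subseteq> I"
    using assms by (auto simp: carrier_free_real)
  ultimately show ?thesis
    using word_normal[OF assms] by metis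
qed

lemma expr_conj:
  assumes "expr I \<omega> x c" "k \<in> carrier K" shows "expr I \<omega> (k \<otimes>\<^bsub>K\<^esub> x \<otimes>\<^bsub>K\<^esub> inv\<^bsub>K\<^esub> k) c"
  using assms(1)
proof (induction rule: expr.induct)
  case expr_one
  then show ?case
    using assms(2) expr.expr_one[of I \<omega>] by simp
next
  case (expr_step x c h g r)
  have "expr I \<omega> (((k \<otimes>\<^bsub>K\<^esub> h) \<otimes>\<^bsub>K\<^esub> bar g r \<otimes>\<^bsub>K\<^esub> inv\<^bsub>K\<^esub> (k \<otimes>\<^bsub>K\<^esub> h)) \<otimes>\<^bsub>K\<^esub> (k \<otimes>\<^bsub>K\<^esub> x \<otimes>\<^bsub>K\<^esub> inv\<^bsub>K\<^esub> k))
      (\<bar>r\<bar> * \<omega> g + c)"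
    by (intro expr.expr_step) (use expr_step assms(2) in auto)
  then show ?case
    using expr_step.hyps assms(2) expr_closed[OF expr_step.hyps(1)]
    by (simp add: K.group_normalize)
qed

lemma expr_inv:
  assumes "expr I \<omega> x c" shows "expr I \<omega> (inv\<^bsub>K\<^esub> x) c"
  using assms
proof (induction rule: expr.induct)
  case expr_one
  then show ?case
    using expr.expr_one[of I \<omega>] by simp
next
  case (expr_step x c h g r)
  have "expr I \<omega> (inv\<^bsub>K\<^esub> x \<otimes>\<^bsub>K\<^esub> (h \<otimes>\<^bsub>K\<^esub> bar g (- r) \<otimes>\<^bsub>K\<^esub> inv\<^bsub>K\<^esub> h)) (c + \<bar>- r\<bar> * \<omega> g)"
    using expr_step by (intro expr_mult expr_conj_bar)
  then show ?case
    using expr_step.hyps expr_closed[OF expr_step.hyps(1)]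
    by (simp add: K.group_normalize bar_inv[symmetric] add.commute)
qed

lemma expr_bdd: "bdd_below {c. expr I \<omega> x c}"
  by (rule bdd_belowI[of _ 0]) (simp add: expr_nonneg)

lemma wnorm_le: "expr I \<omega> x c \<Longrightarrow> wnorm x \<le> c"
  unfolding wnorm_eq by (rule cInf_lower[OF _ expr_bdd]) simp

lemma wnorm_greatest:
  assumes "x \<in> carrier K" "\<And>c. expr I \<omega> x c \<Longrightarrow> b \<le> c" shows "b \<le> wnorm x"
  unfolding wnorm_eq using expr_exists[OF assms(1)] assms(2) by (intro cInf_greatest) auto

lemma wnorm_approx:
  assumes "x \<in> carrier K" "wnorm x < b" obtains c where "expr I \<omega> x c" "c < b"
  using assms expr_exists[OF assms(1)] cInf_less_iff[OF _ expr_bdd[of x], of b]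
  unfolding wnorm_eq by auto

lemma wnorm_bar_le: "g \<in> I \<Longrightarrow> wnorm (bar g r) \<le> \<bar>r\<bar> * \<omega> g"
  by (intro wnorm_le expr_bar)

lemma pseudonormed_wnorm: "pseudonormed_group K wnorm"
proof (unfold_locales, unfold conj_inv_pseudonorm_def, intro conjI ballI)
  show nonneg: "0 \<le> wnorm x" if "x \<in> carrier K" for x
    using that by (intro wnorm_greatest expr_nonneg)
  show "wnorm \<one>\<^bsub>K\<^esub> = 0"
    using wnorm_le[OF expr_one] nonneg[of "\<one>\<^bsub>K\<^esub>"] by simp
  have inv_le: "wnorm (inv\<^bsub>K\<^esub> x) \<le> wnorm x" if "x \<in> carrier K" for x
    using that by (intro wnorm_greatest[of x] wnorm_le expr_inv)
  show "wnorm (inv\<^bsub>K\<^esub> x) = wnorm x" if "x \<in> carrier K" for x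
    using inv_le[of x] inv_le[of "inv\<^bsub>K\<^esub> x"] that by simp
  show "wnorm (x \<otimes>\<^bsub>K\<^esub> y) \<le> wnorm x + wnorm y" if "x \<in> carrier K" "y \<in> carrier K" for x y
  proof -
    have "wnorm (x \<otimes>\<^bsub>K\<^esub> y) - a \<le> wnorm y" if "expr I \<omega> x a" for a
    proof (rule wnorm_greatest[OF \<open>y \<in> carrier K\<close>])
      fix b assume "expr I \<omega> y b"
      then show "wnorm (x \<otimes>\<^bsub>K\<^esub> y) - a \<le> b"
        using wnorm_le[OF expr_mult[OF that]] by fastforce
    qed
    then have "wnorm (x \<otimes>\<^bsub>K\<^esub> y) - wnorm y \<le> wnorm x"
      by (intro wnorm_greatest[OF \<open>x \<in> carrier K\<close>]) (simp add: algebra_simps)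
    then show ?thesis by simp
  qed
  have conj_le: "wnorm (h \<otimes>\<^bsub>K\<^esub> x \<otimes>\<^bsub>K\<^esub> inv\<^bsub>K\<^esub> h) \<le> wnorm x" if "x \<in> carrier K" "h \<in> carrier K" for x h
    using that by (intro wnorm_greatest[of x] wnorm_le expr_conj)
  show "wnorm (h \<otimes>\<^bsub>K\<^esub> x \<otimes>\<^bsub>K\<^esub> inv\<^bsub>K\<^esub> h) = wnorm x" if "x \<in> carrier K" "h \<in> carrier K" for x h
    using conj_le[of x h] conj_le[of "h \<otimes>\<^bsub>K\<^esub> x \<otimes>\<^bsub>K\<^esub> inv\<^bsub>K\<^esub> h" "inv\<^bsub>K\<^esub> h"] that
    by (simp add: K.group_normalize)
qed

text \<open>The weighted pseudonorm is the largest conjugation-invariant pseudonorm with the prescribed bounds on single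
  syllables, so Lipschitz bounds need only be checked there.\<close>

lemma hom_le_wnorm:
  assumes "pseudonormed_group L \<mu>" "f \<in> hom K L"
    and bar_le: "\<And>g r. g \<in> I \<Longrightarrow> \<mu> (f (bar g r)) \<le> \<bar>r\<bar> * \<omega> g"
    and x: "x \<in> carrier K"
  shows "\<mu> (f x) \<le> wnorm x"
proof (rule wnorm_greatest[OF x])
  interpret L: pseudonormed_group L \<mu> by fact
  interpret f: group_hom K L f by unfold_locales fact
  fix c assume "expr I \<omega> x c"
  then show "\<mu> (f x) \<le> c"
  proof (induction rule: expr.induct)
    case (expr_step x c h g r)
    let ?y = "h \<otimes>\<^bsub>K\<^esub> bar g r \<otimes>\<^bsub>K\<^esub> inv\<^bsub>K\<^esub> h"
    have x: "x \<in> carrier K" by (rule expr_closed[OF expr_step.hyps(1)])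
    have "\<mu> (f ?y) = \<mu> (f (bar g r))"
      using expr_step.hyps by (simp add: L.norm_conj)
    then have "\<mu> (f (?y \<otimes>\<^bsub>K\<^esub> x)) \<le> \<mu> (f (bar g r)) + \<mu> (f x)"
      using L.norm_mult[of "f ?y" "f x"] expr_step.hyps x by simp
    then show ?case
      using expr_step.IH bar_le[OF expr_step.hyps(3), of r] by simp
  qed simp
qed

end

section \<open>Trivialising a word by changing its exponents\<close>

definition head_coord :: "'i \<Rightarrow> ('i \<times> real) list \<Rightarrow> real" where
  "head_coord g w = (if w \<noteq> [] \<and> fst (hd w) = g then snd (hd w) else 0)"

definition last_coord :: "'i \<Rightarrow> ('i \<times> real) list \<Rightarrow> real" where
  "last_coord g w = (if w \<noteq> [] \<and> fst (last w) = g then snd (last w) else 0)"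

text \<open>A new first syllable can change the last one only if the word has no other syllable.\<close>

lemma last_coord_push_syl:
  assumes w: "w \<in> carrier (free_real UNIV)" and "fst p = g \<Longrightarrow> \<nexists>b. w = bar g b"
  shows "last_coord g (push_syl p w) = last_coord g w"
proof (cases w)
  case Nil
  then have "fst p \<noteq> g"
    using assms(2) bar_0[of g] by metis
  then show ?thesis
    by (simp add: Nil push_syl_def last_coord_def)
next
  case (Cons q v)
  show ?thesis
  proof (cases v)
    case Nil
    show ?thesis
    proof (cases "fst p = g")
      case True
      have "snd q \<noteq> 0"
        using w by (auto simp: Cons carrier_free_real)
      then have "fst q \<noteq> g"
        using assms(2)[OF True] Cons Nil by (metis bar_def prod.collapse)
      then show ?thesis
        using True by (auto simp: Cons Nil push_syl_def last_coord_def)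
    next
      case False
      then show ?thesis
        by (auto simp: Cons Nil push_syl_def last_coord_def)
    qed
  qed (auto simp: Cons push_syl_def last_coord_def)
qed

text \<open>Read from the right, the exponent of \<open>g\<close> in the last syllable starts at \<open>0\<close> and ends at \<open>c\<close>. It can only
  change at a syllable of index \<open>g\<close> that is read when the element spelled so far is a power of \<open>g\<close>.\<close>

lemma syllable_of_power:
  assumes "word Y = bar g c" "c \<noteq> 0"
  obtains Y1 d Y2 b where "Y = Y1 @ (g, d) # Y2" "word Y2 = bar g b"
proof -
  have "(\<exists>Y1 d Y2 b. Y = Y1 @ (g, d) # Y2 \<and> word Y2 = bar g b) \<or> last_coord g (word Y) = 0" for Y
  proof (induction Y)
    case (Cons p Y)
    show ?case
    proof (cases "fst p = g \<and> (\<exists>b. word Y = bar g b)")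
      case True
      then have "p # Y = [] @ (g, snd p) # Y" by auto
      with True show ?thesis by blast
    next
      case False
      then have "last_coord g (word (p # Y)) = last_coord g (word Y)"
        unfolding word_Cons by (intro last_coord_push_syl word_closed) blast+
      with Cons.IH show ?thesis
        by (metis append_Cons)
    qed
  qed (simp add: last_coord_def)
  moreover have "last_coord g (word Y) = c"
    using assms by (simp add: last_coord_def bar_def)
  ultimately show ?thesis
    using assms that by blast
qed

text \<open>Read cyclically, the rest of the word spells \<open>g(-s)\<close>. So it contains a syllable of index \<open>g\<close> that is separated
  from \<open>g(s)\<close> by a power of \<open>g\<close>. The two syllables can be brought together by commutation, which shows that the exponent \<open>s\<close> may as
  well be added to the other one.\<close>

lemma move_syllable:
  assumes I: "fst ` set U \<subseteq> I" "fst ` set V \<subseteq> I" "g \<in> I"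
    and triv: "word (U @ (g, s) # V) = []" and s: "s \<noteq> 0"
  shows "(\<exists>U1 d U2. U = U1 @ (g, d) # U2 \<and> word (U1 @ (g, d + s) # U2 @ V) = []) \<or>
    (\<exists>V1 d V2. V = V1 @ (g, d) # V2 \<and> word (U @ V1 @ (g, d + s) # V2) = [])"
proof -
  interpret group "free_real I" by (rule group_free_real)
  have one: "\<one>\<^bsub>free_real I\<^esub> = []" by (rule one_free_real)
  have word3: "word (X @ (g, r) # Y) = word X \<otimes>\<^bsub>free_real I\<^esub> (bar g r \<otimes>\<^bsub>free_real I\<^esub> word Y)"
    if "fst ` set X \<subseteq> I" "fst ` set Y \<subseteq> I" for X Y r
    using that I by (simp add: word_append[of _ I] word_Cons push_syl_eq_mult[of _ _ I])
  have rot: "b \<otimes>\<^bsub>free_real I\<^esub> a = \<one>\<^bsub>free_real I\<^esub>"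
    if "a \<otimes>\<^bsub>free_real I\<^esub> b = \<one>\<^bsub>free_real I\<^esub>" "a \<in> carrier (free_real I)" "b \<in> carrier (free_real I)" for a b
    using that inv_comm by blast
  have wU: "word U \<in> carrier (free_real I)" and wV: "word V \<in> carrier (free_real I)"
    using I by auto
  have comm: "bar g r \<otimes>\<^bsub>free_real I\<^esub> bar g r' = bar g r' \<otimes>\<^bsub>free_real I\<^esub> bar g r" for r r'
    by (simp add: bar_mult add.commute)
  have "bar g s \<otimes>\<^bsub>free_real I\<^esub> (word V \<otimes>\<^bsub>free_real I\<^esub> word U) = \<one>\<^bsub>free_real I\<^esub>"
    using rot[of "word U" "bar g s \<otimes>\<^bsub>free_real I\<^esub> word V"] triv wU wV I
    by (simp add: word3 one m_assoc)
  then have "word (V @ U) = inv\<^bsub>free_real I\<^esub> (bar g s)"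
    using I wU wV inv_equality[OF rot] by (simp add: word_append[of _ I])
  then have "word (V @ U) = bar g (- s)"
    using I by (simp add: bar_inv)
  moreover have "- s \<noteq> 0"
    using s by simp
  ultimately obtain Y1 d Y2 b where Y: "V @ U = Y1 @ (g, d) # Y2" "word Y2 = bar g b"
    by (rule syllable_of_power)
  from Y(1) consider U1 where "U = U1 @ (g, d) # Y2" "Y1 = V @ U1"
    | V2 where "V = Y1 @ (g, d) # V2" "Y2 = V2 @ U"
    by (auto simp: append_eq_append_conv2 Cons_eq_append_conv append_eq_Cons_conv)
  then show ?thesis
  proof cases
    case 1
    then have I1: "fst ` set U1 \<subseteq> I" "fst ` set Y2 \<subseteq> I"
      using I by auto
    have "word (U1 @ (g, d + s) # Y2 @ V)
        = word U1 \<otimes>\<^bsub>free_real I\<^esub> (bar g (d + s) \<otimes>\<^bsub>free_real I\<^esub> (bar g b \<otimes>\<^bsub>free_real I\<^esub> word V))"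
      using I I1 Y(2) word3[of U1 "Y2 @ V" "d + s"] by (simp add: word_append[of Y2 I V] image_Un)
    also have "bar g (d + s) \<otimes>\<^bsub>free_real I\<^esub> (bar g b \<otimes>\<^bsub>free_real I\<^esub> word V)
        = bar g d \<otimes>\<^bsub>free_real I\<^esub> (bar g b \<otimes>\<^bsub>free_real I\<^esub> (bar g s \<otimes>\<^bsub>free_real I\<^esub> word V))"
      using I wV by (simp add: m_assoc[symmetric] bar_mult algebra_simps)
    also have "word U1 \<otimes>\<^bsub>free_real I\<^esub> \<dots> = word (U @ (g, s) # V)"
      using I I1 Y(2) wV 1(1) word3[of U1 Y2] word3[of U V s] by (simp add: m_assoc)
    finally show ?thesis
      using triv 1(1) by metis
  next
    case 2
    then have I1: "fst ` set Y1 \<subseteq> I" "fst ` set V2 \<subseteq> I"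
      using I by auto
    then have w: "word Y1 \<in> carrier (free_real I)" "word V2 \<in> carrier (free_real I)"
      by auto
    have b: "word V2 \<otimes>\<^bsub>free_real I\<^esub> word U = bar g b"
      using I I1 2 Y(2) by (simp add: word_append[of _ I])
    have "\<one>\<^bsub>free_real I\<^esub> = word U \<otimes>\<^bsub>free_real I\<^esub> (bar g s \<otimes>\<^bsub>free_real I\<^esub> (word Y1 \<otimes>\<^bsub>free_real I\<^esub>
        (bar g d \<otimes>\<^bsub>free_real I\<^esub> word V2)))"
      using triv I I1 word3[of U V s] word3[of Y1 V2 d] by (simp add: one 2(1))
    then have "word Y1 \<otimes>\<^bsub>free_real I\<^esub> (bar g d \<otimes>\<^bsub>free_real I\<^esub> (word V2 \<otimes>\<^bsub>free_real I\<^esub> (word U \<otimes>\<^bsub>free_real I\<^esub>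
        bar g s))) = \<one>\<^bsub>free_real I\<^esub>"
      using rot[of "word U \<otimes>\<^bsub>free_real I\<^esub> bar g s" "word Y1 \<otimes>\<^bsub>free_real I\<^esub> (bar g d \<otimes>\<^bsub>free_real I\<^esub> word V2)"]
        I w wU by (simp add: m_assoc)
    also have "word V2 \<otimes>\<^bsub>free_real I\<^esub> (word U \<otimes>\<^bsub>free_real I\<^esub> bar g s) = bar g b \<otimes>\<^bsub>free_real I\<^esub> bar g s"
      using I w wU by (simp add: m_assoc[symmetric] b)
    also have "bar g d \<otimes>\<^bsub>free_real I\<^esub> \<dots> = bar g (d + s) \<otimes>\<^bsub>free_real I\<^esub> bar g b"
      by (simp add: bar_mult algebra_simps)
    finally have "word Y1 \<otimes>\<^bsub>free_real I\<^esub> (bar g (d + s) \<otimes>\<^bsub>free_real I\<^esub> (word V2 \<otimes>\<^bsub>free_real I\<^esub> word U)) = \<one>\<^bsub>free_real I\<^esub>"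
      by (simp add: b)
    then have "word U \<otimes>\<^bsub>free_real I\<^esub> (word Y1 \<otimes>\<^bsub>free_real I\<^esub> (bar g (d + s) \<otimes>\<^bsub>free_real I\<^esub> word V2)) = \<one>\<^bsub>free_real I\<^esub>"
      using rot[of "word Y1 \<otimes>\<^bsub>free_real I\<^esub> (bar g (d + s) \<otimes>\<^bsub>free_real I\<^esub> word V2)" "word U"] I w wU
      by (simp add: m_assoc)
    then have "word (U @ Y1 @ (g, d + s) # V2) = []"
      using I I1 word3[of Y1 V2 "d + s"] word_append[of U I "Y1 @ (g, d + s) # V2"]
      by (simp add: image_Un one)
    then show ?thesis
      using 2(1) by blast
  qed
qed

text \<open>In a list of triples \<open>(g, r, s)\<close>, the first exponents spell the given word and the second
  exponents spell a trivial word.\<close>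

definition src :: "('i \<times> real \<times> real) list \<Rightarrow> ('i \<times> real) list" where
  "src Z = map (\<lambda>(g, r, s). (g, r)) Z"

definition tgt :: "('i \<times> real \<times> real) list \<Rightarrow> ('i \<times> real) list" where
  "tgt Z = map (\<lambda>(g, r, s). (g, s)) Z"

definition change :: "('i \<Rightarrow> real) \<Rightarrow> ('i \<times> real \<times> real) list \<Rightarrow> real" where
  "change \<omega> Z = (\<Sum>(g, r, s)\<leftarrow>Z. \<bar>r - s\<bar> * \<omega> g)"

lemma src_simps [simp]:
  "src [] = []" "src ((g, r, s) # Z) = (g, r) # src Z" "src (X @ Y) = src X @ src Y"
  and tgt_simps [simp]:
  "tgt [] = []" "tgt ((g, r, s) # Z) = (g, s) # tgt Z" "tgt (X @ Y) = tgt X @ tgt Y"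
  and change_simps [simp]:
  "change \<omega> [] = 0" "change \<omega> ((g, r, s) # Z) = \<bar>r - s\<bar> * \<omega> g + change \<omega> Z"
  "change \<omega> (X @ Y) = change \<omega> X + change \<omega> Y"
  by (simp_all add: src_def tgt_def change_def)

lemma fst_set_src [simp]: "fst ` set (src Z) = fst ` set Z" and fst_set_tgt [simp]: "fst ` set (tgt Z) = fst ` set Z"
  by (force simp: src_def tgt_def image_image split: prod.split)+

lemma tgt_split:
  assumes "tgt Z = X @ (g, d) # Y"
  obtains Z1 r Z2 where "Z = Z1 @ (g, r, d) # Z2" "tgt Z1 = X" "tgt Z2 = Y"
  using assms unfolding tgt_def by (fastforce simp: map_eq_append_conv split: prod.splits)

context weighted
begin

lemma change_nonneg: "fst ` set Z \<subseteq> I \<Longrightarrow> 0 \<le> change \<omega> Z"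
  by (induction Z) (auto simp: \<omega>_nonneg)

text \<open>Deletion of a conjugate of \<open>g(r)\<close> is the change of one exponent from \<open>r\<close> to \<open>0\<close>.\<close>

lemma expr_trivialisation:
  assumes "expr I \<omega> x c"
  shows "\<exists>Z. fst ` set Z \<subseteq> I \<and> word (src Z) = x \<and> word (tgt Z) = [] \<and> change \<omega> Z = c"
  using assms
proof (induction rule: expr.induct)
  case expr_one
  show ?case
    by (rule exI[of _ "[]"]) (simp add: one_free_real)
next
  case (expr_step x c h g r)
  then obtain Z where Z: "fst ` set Z \<subseteq> I" "word (src Z) = x" "word (tgt Z) = []" "change \<omega> Z = c"
    by blast
  define dup :: "('i \<times> real) list \<Rightarrow> ('i \<times> real \<times> real) list"
    where "dup = map (\<lambda>(g, r). (g, r, r))"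
  have dup: "src (dup w) = w" "tgt (dup w) = w" "change \<omega> (dup w) = 0"
    "fst ` set (dup w) = fst ` set w" for w
    by (induction w) (auto simp: dup_def)
  define k where "k = inv\<^bsub>K\<^esub> h"
  have k: "k \<in> carrier K"
    using expr_step.hyps by (simp add: k_def)
  have fst_hk: "fst ` set h \<subseteq> I" "fst ` set k \<subseteq> I"
    using k expr_step.hyps by (auto simp: carrier_free_real)
  have word_hk: "word h = h" "word k = k"
    using k expr_step.hyps by (auto simp: word_normal[of _ I])
  have x: "x \<in> carrier K" "word (src Z) = x"
    using Z expr_closed[OF expr_step.hyps(1)] by auto
  let ?Z = "dup h @ (g, r, 0) # dup k @ Z"
  have "word (src ?Z) = (h \<otimes>\<^bsub>K\<^esub> bar g r \<otimes>\<^bsub>K\<^esub> inv\<^bsub>K\<^esub> h) \<otimes>\<^bsub>K\<^esub> x"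
    using fst_hk Z(1) x k expr_step.hyps
    by (simp add: dup word_append[of _ I] word_Cons push_syl_eq_mult[of _ _ I] word_hk image_Un K.m_assoc
        flip: k_def)
  moreover have "word (tgt ?Z) = []"
    using fst_hk Z(1,3) k expr_step.hyps
    by (simp add: dup word_append[of _ I] word_Cons push_syl_eq_mult[of _ _ I] word_hk image_Un bar_0
        flip: one_free_real[of I]) (simp add: k_def)
  ultimately show ?case
    using Z(1,4) fst_hk expr_step.hyps
    by (intro exI[of _ ?Z]) (simp add: dup image_Un)
qed

lemma not_normal_form_cases:
  assumes "set (src Z) \<subseteq> I \<times> UNIV" "src Z \<notin> carrier (free_real I)"
  obtains U g s V where "Z = U @ (g, 0, s) # V"
    | U g r s r' s' V where "Z = U @ (g, r, s) # (g, r', s') # V"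
proof -
  have "(\<exists>U g s V. Z = U @ (g, 0, s) # V) \<or> (\<exists>U g r s r' s' V. Z = U @ (g, r, s) # (g, r', s') # V)"
    using assms
  proof (induction Z)
    case (Cons z Z)
    obtain g r s where z: "z = (g, r, s)" by (cases z)
    show ?case
    proof (cases "src Z \<in> carrier (free_real I)")
      case False
      with Cons show ?thesis
        by (auto simp: z) (metis append_Cons)+
    next
      case True
      show ?thesis
      proof (cases "r = 0")
        case True
        then have "z # Z = [] @ (g, 0, s) # Z"
          by (simp add: z)
        then show ?thesis by blast
      next
        case r: False
        show ?thesis
        proof (cases Z)
          case Nil
          with Cons.prems r show ?thesis
            by (auto simp: z carrier_free_real)
        next
          case (Cons z' Z')
          obtain g' r' s' where z': "z' = (g', r', s')" by (cases z')
          have "g' = g"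
            using Cons.prems True r Cons by (auto simp: z z' carrier_free_real)
          then have "z # Z = [] @ (g, r, s) # (g, r', s') # Z'"
            by (simp add: z z' Cons)
          then show ?thesis by blast
        qed
      qed
    qed
  qed (simp add: carrier_free_real)
  then show ?thesis
    using that by blast
qed

text \<open>The target exponent \<open>s\<close> of a syllable that is absent from the source word is moved to another syllable; there it
  costs at most as much as it did before.\<close>

lemma trivialisation_remove_zero:
  assumes "fst ` set (U @ (g, 0, s) # V) \<subseteq> I" and triv: "word (tgt (U @ (g, 0, s) # V)) = []"
  shows "\<exists>Z. fst ` set Z \<subseteq> I \<and> length Z = length (U @ V) \<and> src Z = src (U @ V) \<and>
    word (tgt Z) = [] \<and> change \<omega> Z \<le> change \<omega> (U @ (g, 0, s) # V)"
proof (cases "s = 0")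
  case True
  have "word (tgt (U @ V)) = word (tgt (U @ (g, 0, s) # V))"
    using assms(1) by (simp add: True word_append[of _ I] word_Cons push_syl_0 image_Un)
  then show ?thesis
    using assms True by (intro exI[of _ "U @ V"]) (simp add: image_Un)
next
  case False
  have I: "fst ` set (tgt U) \<subseteq> I" "fst ` set (tgt V) \<subseteq> I" "g \<in> I"
    using assms(1) by auto
  have tri: "\<bar>r - (e + s)\<bar> * \<omega> g \<le> \<bar>s\<bar> * \<omega> g + \<bar>r - e\<bar> * \<omega> g" for r e
  proof -
    have "\<bar>r - (e + s)\<bar> * \<omega> g \<le> (\<bar>s\<bar> + \<bar>r - e\<bar>) * \<omega> g"
      using \<omega>_nonneg[OF I(3)] by (intro mult_right_mono) auto
    then show ?thesis
      by (simp add: distrib_right)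
  qed
  have "word (tgt U @ (g, s) # tgt V) = []"
    using triv by simp
  from move_syllable[OF I this False] show ?thesis
  proof (elim disjE exE conjE)
    fix X e Y assume X: "tgt U = X @ (g, e) # Y" and w: "word (X @ (g, e + s) # Y @ tgt V) = []"
    obtain U1 r U2 where U: "U = U1 @ (g, r, e) # U2" "tgt U1 = X" "tgt U2 = Y"
      using X by (rule tgt_split)
    show ?thesis
      using w assms(1) tri[of r e] by (intro exI[of _ "U1 @ (g, r, e + s) # U2 @ V"]) (auto simp: U)
  next
    fix X e Y assume X: "tgt V = X @ (g, e) # Y" and w: "word (tgt U @ X @ (g, e + s) # Y) = []"
    obtain V1 r V2 where V: "V = V1 @ (g, r, e) # V2" "tgt V1 = X" "tgt V2 = Y"
      using X by (rule tgt_split)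
    show ?thesis
      using w assms(1) tri[of r e] by (intro exI[of _ "U @ V1 @ (g, r, e + s) # V2"]) (auto simp: V)
  qed
qed

text \<open>The source word is brought into normal form by merging neighbours with the same index, which is harmless by the
  triangle inequality, and by removing syllables with exponent \<open>0\<close>.\<close>

lemma trivialisation_reduce:
  assumes "fst ` set Z \<subseteq> I" "word (tgt Z) = []"
  shows "\<exists>Z'. fst ` set Z' \<subseteq> I \<and> src Z' = word (src Z) \<and> word (tgt Z') = [] \<and> change \<omega> Z' \<le> change \<omega> Z"
  using assms
proof (induction "length Z" arbitrary: Z rule: less_induct)
  case less
  show ?case
  proof (cases "src Z \<in> carrier (free_real I)")
    case True
    then show ?thesis
      using less.prems by (intro exI[of _ Z]) (simp add: word_normal)
  next
    case False
    have "set (src Z) \<subseteq> I \<times> UNIV"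
      using less.prems(1)[folded fst_set_src] by (auto simp: image_subset_iff simp del: fst_set_src)
    with False consider U g s V where "Z = U @ (g, 0, s) # V"
      | U g r s r' s' V where "Z = U @ (g, r, s) # (g, r', s') # V"
      by (metis not_normal_form_cases)
    then show ?thesis
    proof cases
      case (1 U g s V)
      obtain Y where Y: "fst ` set Y \<subseteq> I" "length Y = length (U @ V)" "src Y = src (U @ V)"
        "word (tgt Y) = []" "change \<omega> Y \<le> change \<omega> Z"
        using trivialisation_remove_zero[of U g s V] less.prems unfolding 1 by blast
      have "word (src Y) = word (src Z)"
        using less.prems(1) Y(3) by (simp add: 1 word_append[of _ I] word_Cons push_syl_0 image_Un)
      moreover have "length Y < length Z"
        by (simp add: 1 Y(2))
      from less.hyps[OF this Y(1,4)] obtain Z' where "fst ` set Z' \<subseteq> I" "src Z' = word (src Y)"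
        "word (tgt Z') = []" "change \<omega> Z' \<le> change \<omega> Y"
        by blast
      ultimately show ?thesis
        using Y(5) by (intro exI[of _ Z']) simp
    next
      case (2 U g r s r' s' V)
      let ?Y = "U @ (g, r + r', s + s') # V"
      have I: "fst ` set ?Y \<subseteq> I"
        using less.prems(1) by (auto simp: 2)
      have merge: "word (X @ (g, a + b) # Y) = word (X @ (g, a) # (g, b) # Y)"
        if "fst ` set X \<subseteq> I" "fst ` set Y \<subseteq> I" for X Y a b
        using that I push_syl_add[OF word_closed[OF that(2)]]
        by (simp add: word_append[of _ I] word_Cons)
      have "\<bar>r + r' - (s + s')\<bar> * \<omega> g \<le> (\<bar>r - s\<bar> + \<bar>r' - s'\<bar>) * \<omega> g"
        using \<omega>_nonneg[of g] I by (intro mult_right_mono) auto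
      then have "change \<omega> ?Y \<le> change \<omega> Z"
        by (simp add: 2 distrib_right)
      moreover have "word (src ?Y) = word (src Z)" "word (tgt ?Y) = word (tgt Z)"
        using I merge[of "src U" "src V"] merge[of "tgt U" "tgt V"] by (auto simp: 2 image_Un)
      moreover have "length ?Y < length Z"
        by (simp add: 2)
      then obtain Z' where "fst ` set Z' \<subseteq> I" "src Z' = word (src ?Y)"
        "word (tgt Z') = []" "change \<omega> Z' \<le> change \<omega> ?Y"
        using less.hyps[of ?Y] I less.prems(2) \<open>word (tgt ?Y) = word (tgt Z)\<close> by metis
      ultimately show ?thesis
        by (metis order_trans)
    qed
  qed
qed

text \<open>This replaces expressions with arbitrary conjugating elements by finitely many real parameters, the changed
  exponents of the given normal form.\<close>

lemma wnorm_trivialisation: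
  assumes "x \<in> carrier K" "wnorm x < b"
  obtains Z where "fst ` set Z \<subseteq> I" "src Z = x" "word (tgt Z) = []" "change \<omega> Z < b"
proof -
  obtain c where "expr I \<omega> x c" "c < b"
    using assms by (rule wnorm_approx)
  then obtain Y where Y: "fst ` set Y \<subseteq> I" "word (src Y) = x" "word (tgt Y) = []" "change \<omega> Y < b"
    using expr_trivialisation by blast
  from trivialisation_reduce[OF Y(1,3)] obtain Z where "fst ` set Z \<subseteq> I" "src Z = x" "word (tgt Z) = []"
    "change \<omega> Z \<le> change \<omega> Y"
    using Y(2) by blast
  with Y(4) that[of Z] show ?thesis
    by simp
qed

text \<open>If the cost is smaller than the weight of every syllable, then no changed exponent vanishes. So the changed word is
  still a nonempty normal form and cannot be trivial.\<close>

lemma wnorm_pos: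
  assumes x: "x \<in> carrier K" "x \<noteq> []" and pos: "\<And>g. g \<in> fst ` set x \<Longrightarrow> 0 < \<omega> g"
  shows "0 < wnorm x"
proof -
  define m where "m = Min ((\<lambda>(g, r). \<bar>r\<bar> * \<omega> g) ` set x)"
  have m_le: "m \<le> \<bar>r\<bar> * \<omega> g" if "(g, r) \<in> set x" for g r
    unfolding m_def using that by (intro Min_le) (auto intro: rev_image_eqI)
  have "m \<in> (\<lambda>(g, r). \<bar>r\<bar> * \<omega> g) ` set x"
    unfolding m_def using x(2) by (intro Min_in) auto
  then obtain g r where gr: "(g, r) \<in> set x" "m = \<bar>r\<bar> * \<omega> g"
    by auto
  then have "g \<in> fst ` set x" "r \<noteq> 0"
    using x(1) by (force simp: carrier_free_real)+
  then have "m > 0"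
    using pos[of g] by (simp add: gr)
  have "m \<le> wnorm x"
  proof (rule ccontr)
    assume "\<not> m \<le> wnorm x"
    then obtain Z where Z: "fst ` set Z \<subseteq> I" "src Z = x" "word (tgt Z) = []" "change \<omega> Z < m"
      using wnorm_trivialisation[OF x(1), of m] by auto
    have term_le: "\<bar>r - s\<bar> * \<omega> g \<le> change \<omega> Y"
      if "(g, r, s) \<in> set Y" "fst ` set Y \<subseteq> I" for g r s Y
      using that
    proof (induction Y)
      case (Cons y Y)
      obtain a b e where y: "y = (a, b, e)" by (cases y)
      have "0 \<le> change \<omega> Y" "0 \<le> \<bar>b - e\<bar> * \<omega> a"
        using Cons.prems(2) by (auto simp: y intro!: change_nonneg \<omega>_nonneg mult_nonneg_nonneg)
      with Cons show ?case
        by (auto simp: y)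
    qed simp
    have "s \<noteq> 0" if "(g, r, s) \<in> set Z" for g r s
    proof
      assume "s = 0"
      moreover have "(g, r) \<in> set x"
        using that unfolding Z(2)[symmetric] src_def by force
      ultimately show False
        using term_le[OF that Z(1)] m_le[of g r] Z(4) by simp
    qed
    moreover have "successively (\<lambda>p q. fst p \<noteq> fst q) (tgt Z)"
      using x(1) unfolding Z(2)[symmetric]
      by (simp add: carrier_free_real src_def tgt_def successively_map case_prod_unfold)
    ultimately have "tgt Z \<in> carrier K"
      using Z(1) by (auto simp: carrier_free_real tgt_def)
    then have "tgt Z = []"
      using Z(3) by (simp add: word_normal)
    then show False
      using Z(2) x(2) by (simp add: tgt_def src_def)
  qed
  with \<open>m > 0\<close> show ?thesis by simp
qed

end

section \<open>Rounding the exponents\<close>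

text \<open>Replacing \<open>k\<close> by \<open>k + 1\<close> shifts the summation range by one, which changes the sum by
  \<open>(k + M) div M - k div M = 1\<close>.\<close>

lemma sum_div_shift:
  fixes k :: int and M :: nat
  assumes "M > 0"
  shows "(\<Sum>j<M. (k + int j) div int M) = k"
proof -
  define f where "f k = (\<Sum>j<M. (k + int j) div int M)" for k
  have step: "f (k + 1) = f k + 1" for k
  proof -
    have "f (k + 1) = (\<Sum>j<M. (k + int (Suc j)) div int M)"
      unfolding f_def by (rule sum.cong) (auto simp: algebra_simps)
    also have "\<dots> = (\<Sum>j<Suc M. (k + int j) div int M) - k div int M"
      by (subst sum.lessThan_Suc_shift) simp
    also have "\<dots> = f k + 1"
      using assms by (simp add: f_def)
    finally show ?thesis .
  qed
  have "f 0 = 0"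
    unfolding f_def by (rule sum.neutral) simp
  have "f k = k"
  proof (induction k rule: int_induct[of _ 0])
    case (step2 i)
    then show ?case
      using step[of "i - 1"] by simp
  qed (use \<open>f 0 = 0\<close> step in auto)
  then show ?thesis
    by (simp add: f_def)
qed

lemma sum_floor_shift:
  fixes x :: real
  assumes "M > 0"
  shows "(\<Sum>j<M. \<lfloor>x + real j / real M\<rfloor>) = \<lfloor>real M * x\<rfloor>"
proof -
  have "\<lfloor>x + real j / real M\<rfloor> = (\<lfloor>real M * x\<rfloor> + int j) div int M" for j
  proof -
    have "x + real j / real M = (real M * x + real_of_int (int j)) / real_of_int (int M)"
      using assms by (simp add: field_simps)
    then have "\<lfloor>x + real j / real M\<rfloor> = \<lfloor>real M * x + real_of_int (int j)\<rfloor> div int M"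
      using floor_divide_real_eq_div[of "int M"] by simp
    then show ?thesis
      by (simp only: floor_add_int)
  qed
  then show ?thesis
    using sum_div_shift[OF assms] by simp
qed

text \<open>The average, over equidistributed offsets, of the distance from an integer \<open>n\<close> to the rounding of
  \<open>x - y\<close> is at most \<open>\<bar>n - (x - y)\<bar>\<close> up to the discretisation error: all roundings lie on one side of \<open>n\<close>.\<close>

lemma sum_rounding_error:
  fixes x y :: real and n :: int
  assumes "M > 0"
  shows "(\<Sum>j<M. \<bar>real_of_int (n - (\<lfloor>x + real j / real M\<rfloor> - \<lfloor>y + real j / real M\<rfloor>))\<bar>)
    \<le> real M * \<bar>real_of_int n - (x - y)\<bar> + 1"
proof -
  define f where "f j = \<lfloor>x + real j / real M\<rfloor> - \<lfloor>y + real j / real M\<rfloor>" for j :: nat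
  have sum_f: "(\<Sum>j<M. real_of_int (f j)) = real_of_int (\<lfloor>real M * x\<rfloor> - \<lfloor>real M * y\<rfloor>)"
    unfolding f_def by (simp add: sum_subtractf sum_floor_shift[OF assms] flip: of_int_sum)
  have near: "\<bar>real_of_int (\<lfloor>real M * x\<rfloor> - \<lfloor>real M * y\<rfloor>) - real M * (x - y)\<bar> \<le> 1"
  proof -
    have "real M * x - 1 < real_of_int \<lfloor>real M * x\<rfloor>" "real_of_int \<lfloor>real M * x\<rfloor> \<le> real M * x"
      "real M * y - 1 < real_of_int \<lfloor>real M * y\<rfloor>" "real_of_int \<lfloor>real M * y\<rfloor> \<le> real M * y"
      by linarith+
    then show ?thesis
      unfolding right_diff_distrib of_int_diff by linarith
  qed
  have f_near: "real_of_int (f j) < x - y + 1" "x - y - 1 < real_of_int (f j)" for j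
    unfolding f_def by linarith+
  have "(\<Sum>j<M. \<bar>real_of_int (n - f j)\<bar>) \<le> real M * \<bar>real_of_int n - (x - y)\<bar> + 1"
  proof (cases "real_of_int n \<ge> x - y")
    case True
    have "f j \<le> n" for j
      using f_near(1)[of j] True by linarith
    then have "(\<Sum>j<M. \<bar>real_of_int (n - f j)\<bar>) = (\<Sum>j<M. real_of_int n - real_of_int (f j))"
      by (intro sum.cong) auto
    also have "\<dots> = real M * n - (\<Sum>j<M. real_of_int (f j))"
      by (simp add: sum_subtractf)
    also have "\<dots> \<le> real M * (n - (x - y)) + 1"
      using near unfolding sum_f by (simp add: algebra_simps abs_le_iff)
    finally show ?thesis
      using True by simp
  next
    case False
    have "f j \<ge> n" for j
      using f_near(2)[of j] False by linarith
    then have "(\<Sum>j<M. \<bar>real_of_int (n - f j)\<bar>) = (\<Sum>j<M. real_of_int (f j) - real_of_int n)"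
      by (intro sum.cong) auto
    also have "\<dots> = (\<Sum>j<M. real_of_int (f j)) - real M * n"
      by (simp add: sum_subtractf)
    also have "\<dots> \<le> real M * ((x - y) - n) + 1"
      using near unfolding sum_f by (simp add: algebra_simps abs_le_iff)
    finally show ?thesis
      using False by simp
  qed
  then show ?thesis
    by (simp add: f_def)
qed

text \<open>The free product acts on a tree of lines, one for each coset of each factor. Every line is marked at the points
  of \<open>\<int> - u\<close>, and a syllable is rounded to the signed number of marked points that it crosses. This number depends only
  on the end points, so along a closed path the rounded exponents still multiply to the identity.\<close>

fun roundings :: "real \<Rightarrow> ('i \<times> real) list \<Rightarrow> ('i \<times> int) list" where
  "roundings u [] = []"
| "roundings u ((g, r) # W) =
    (g, \<lfloor>head_coord g (word W) + r + u\<rfloor> - \<lfloor>head_coord g (word W) + u\<rfloor>) # roundings u W"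

definition int_prod :: "('g, 'm) monoid_scheme \<Rightarrow> ('g \<times> int) list \<Rightarrow> 'g" where
  "int_prod G W = list_mult G (map (\<lambda>(g, n). g [^]\<^bsub>G\<^esub> n) W)"

text \<open>The crossings of a syllable telescope with those counted from the origin of its line. The assumption on
  \<open>u\<close> makes the origin itself have the count \<open>\<lfloor>u\<rfloor> = 0\<close>, which is needed when the path enters or leaves a line.\<close>

lemma (in group) rounding_push_syl:
  assumes w: "w \<in> carrier (free_real (carrier G))" and g: "g \<in> carrier G" and u: "0 \<le> u" "u < 1"
  shows "lift G (\<lambda>g r. g [^] \<lfloor>r + u\<rfloor>) (push_syl (g, r) w)
    = g [^] (\<lfloor>head_coord g w + r + u\<rfloor> - \<lfloor>head_coord g w + u\<rfloor>) \<otimes> lift G (\<lambda>g r. g [^] \<lfloor>r + u\<rfloor>) w"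
proof -
  have u0: "\<lfloor>u\<rfloor> = 0"
    using u by (simp add: floor_eq_iff)
  have lift_closed: "lift G (\<lambda>g r. g [^] \<lfloor>r + u\<rfloor>) v \<in> carrier G" if "fst ` set v \<subseteq> carrier G" for v
    using that by (induction v) (auto simp: lift_Cons)
  have fst_w: "fst ` set w \<subseteq> carrier G"
    using w by (auto simp: carrier_free_real)
  show ?thesis
  proof (cases "w \<noteq> [] \<and> fst (hd w) = g")
    case True
    then obtain s v where wv: "w = (g, s) # v"
      by (cases w) auto
    have v: "fst ` set v \<subseteq> carrier G"
      using fst_w by (simp add: wv)
    have "g [^] (\<lfloor>s + r + u\<rfloor> - \<lfloor>s + u\<rfloor>) \<otimes> (g [^] \<lfloor>s + u\<rfloor> \<otimes> lift G (\<lambda>g r. g [^] \<lfloor>r + u\<rfloor>) v)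
        = g [^] \<lfloor>s + r + u\<rfloor> \<otimes> lift G (\<lambda>g r. g [^] \<lfloor>r + u\<rfloor>) v"
      using g lift_closed[OF v] by (simp add: m_assoc[symmetric] int_pow_mult[symmetric])
    moreover have "\<lfloor>r + (s + u)\<rfloor> = 0" if "r + s = 0"
      using u0 that by (simp flip: add.assoc)
    ultimately show ?thesis
      using g lift_closed[OF v] by (auto simp: wv push_syl_def head_coord_def lift_Cons u0 add_ac)
  next
    case False
    then show ?thesis
      using g u0 lift_closed[OF fst_w]
      by (cases w) (auto simp: push_syl_def head_coord_def lift_Cons)
  qed
qed

lemma (in group) int_prod_roundings:
  assumes W: "fst ` set W \<subseteq> carrier G" and u: "0 \<le> u" "u < 1"
  shows "int_prod G (roundings u W) = lift G (\<lambda>g r. g [^] \<lfloor>r + u\<rfloor>) (word W)"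
  using W
proof (induction W)
  case (Cons p W)
  obtain g r where p: "p = (g, r)" by (cases p)
  have "word W \<in> carrier (free_real (carrier G))" "g \<in> carrier G"
    using Cons.prems by (auto simp: p)
  with Cons show ?case
    by (simp add: p word_Cons rounding_push_syl[OF _ _ u] int_prod_def)
qed (simp add: int_prod_def)

definition rounding_cost :: "('i \<Rightarrow> real) \<Rightarrow> real \<Rightarrow> ('i \<times> real \<times> real) list \<Rightarrow> real" where
  "rounding_cost \<omega> u Z =
    (\<Sum>((g, r, s), (h, m))\<leftarrow>zip Z (roundings u (tgt Z)). \<bar>real_of_int (\<lfloor>r\<rfloor> - m)\<bar> * \<omega> g)"

lemma rounding_cost_simps [simp]:
  "rounding_cost \<omega> u [] = 0"
  "rounding_cost \<omega> u ((g, r, s) # Z) =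
    \<bar>real_of_int (\<lfloor>r\<rfloor> - (\<lfloor>head_coord g (word (tgt Z)) + s + u\<rfloor> - \<lfloor>head_coord g (word (tgt Z)) + u\<rfloor>))\<bar> * \<omega> g
      + rounding_cost \<omega> u Z"
  by (simp_all add: rounding_cost_def)

lemma sum_rounding_cost:
  assumes \<omega>: "\<And>g. g \<in> fst ` set Z \<Longrightarrow> 0 \<le> \<omega> g" and int: "snd ` set (src Z) \<subseteq> \<int>" and M: "M > 0"
  shows "(\<Sum>j<M. rounding_cost \<omega> (real j / real M) Z)
    \<le> real M * change \<omega> Z + (\<Sum>g\<leftarrow>map fst Z. \<omega> g)"
  using \<omega> int
proof (induction Z)
  case (Cons z Z)
  obtain g r s where z: "z = (g, r, s)" by (cases z)
  define x where "x = head_coord g (word (tgt Z))"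
  have r: "r = real_of_int \<lfloor>r\<rfloor>"
    using Cons.prems by (auto simp: z elim: Ints_cases)
  have "(\<Sum>j<M. \<bar>real_of_int (\<lfloor>r\<rfloor> - (\<lfloor>x + s + real j / real M\<rfloor> - \<lfloor>x + real j / real M\<rfloor>))\<bar>)
      \<le> real M * \<bar>real_of_int \<lfloor>r\<rfloor> - ((x + s) - x)\<bar> + 1"
    by (rule sum_rounding_error[OF M])
  also have "\<dots> = real M * \<bar>r - s\<bar> + 1"
    using r by simp
  finally have "(\<Sum>j<M. \<bar>real_of_int (\<lfloor>r\<rfloor> - (\<lfloor>x + s + real j / real M\<rfloor> - \<lfloor>x + real j / real M\<rfloor>))\<bar>) * \<omega> g
      \<le> (real M * \<bar>r - s\<bar> + 1) * \<omega> g"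
    using Cons.prems(1) by (intro mult_right_mono) (auto simp: z)
  moreover have "(\<Sum>j<M. rounding_cost \<omega> (real j / real M) Z) \<le> real M * change \<omega> Z + (\<Sum>g\<leftarrow>map fst Z. \<omega> g)"
    using Cons by (auto simp: z)
  moreover have "(\<Sum>j<M. rounding_cost \<omega> (real j / real M) (z # Z))
      = (\<Sum>j<M. \<bar>real_of_int (\<lfloor>r\<rfloor> - (\<lfloor>x + s + real j / real M\<rfloor> - \<lfloor>x + real j / real M\<rfloor>))\<bar>) * \<omega> g
        + (\<Sum>j<M. rounding_cost \<omega> (real j / real M) Z)"
    by (simp only: z rounding_cost_simps sum.distrib sum_distrib_right x_def)
  moreover have "real M * change \<omega> (z # Z) + (\<Sum>g\<leftarrow>map fst (z # Z). \<omega> g)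
      = (real M * \<bar>r - s\<bar> + 1) * \<omega> g + (real M * change \<omega> Z + (\<Sum>g\<leftarrow>map fst Z. \<omega> g))"
    by (simp add: z distrib_left distrib_right)
  ultimately show ?case
    by linarith
qed simp

context pseudonormed_group
begin

text \<open>The rounded exponents spell the identity, so the norm of the word is at most the cost of changing its own exponents into
  them.\<close>

lemma norm_int_prod_le:
  assumes "fst ` set Z \<subseteq> carrier K" and "int_prod K (roundings u (tgt Z)) = \<one>"
  shows "\<nu> (pi_hom K (src Z)) \<le> rounding_cost \<nu> u Z"
proof -
  have "d (int_prod K (roundings u (tgt Z))) (pi_hom K (src Z)) \<le> rounding_cost \<nu> u Z"
    using assms(1)
  proof (induction Z)
    case Nil
    then show ?case
      by (simp add: int_prod_def pi_hom_def)
  next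
    case (Cons z Z)
    obtain g r s where z: "z = (g, r, s)" by (cases z)
    define m where "m = \<lfloor>head_coord g (word (tgt Z)) + s + u\<rfloor> - \<lfloor>head_coord g (word (tgt Z)) + u\<rfloor>"
    have g: "g \<in> carrier K"
      using Cons.prems by (simp add: z)
    have cl: "int_prod K (roundings u (tgt Z)) \<in> carrier K" "pi_hom K (src Z) \<in> carrier K"
      using Cons.prems
      by (induction Z) (auto simp: int_prod_def pi_hom_def)
    have "d (int_prod K (roundings u (tgt (z # Z)))) (pi_hom K (src (z # Z)))
        = d (g [^] m \<otimes> int_prod K (roundings u (tgt Z))) (g [^] \<lfloor>r\<rfloor> \<otimes> pi_hom K (src Z))"
      by (simp add: z int_prod_def pi_hom_def m_def)
    also have "\<dots> \<le> d (g [^] m) (g [^] \<lfloor>r\<rfloor>) + d (int_prod K (roundings u (tgt Z))) (pi_hom K (src Z))"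
      using g cl by (intro d_mult) auto
    also have "d (g [^] m) (g [^] \<lfloor>r\<rfloor>) = \<nu> (g [^] (\<lfloor>r\<rfloor> - m))"
      using g by (simp add: d_eq int_pow_mult[symmetric] int_pow_neg[symmetric])
    also have "\<dots> \<le> \<bar>real_of_int (\<lfloor>r\<rfloor> - m)\<bar> * \<nu> g"
      using g by (rule norm_int_pow_le)
    finally show ?case
      using Cons by (simp add: z m_def)
  qed
  moreover have "pi_hom K (src Z) \<in> carrier K"
    using assms(1) by (induction Z) (auto simp: pi_hom_def)
  ultimately show ?thesis
    using assms(2) by (simp add: d_one)
qed

lemma weighted_carrier: "weighted (carrier K) \<nu>"
  by unfold_locales (rule norm_nonneg)

text \<open>A trivialisation with real exponents is rounded with the offsets \<open>j / M\<close> for \<open>j < M\<close>. The average of the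
  resulting bounds exceeds the cost of the trivialisation by at most \<open>B / M\<close>, where \<open>B\<close> is the total weight of the word.\<close>

lemma norm_pi_hom_le:
  assumes w: "w \<in> carrier (F_int K)"
  shows "\<nu> (pi_hom K w) \<le> FR_norm K \<nu> w"
proof (rule field_le_epsilon)
  interpret W: weighted "carrier K" \<nu> by (rule weighted_carrier)
  fix \<epsilon> :: real assume \<epsilon>: "\<epsilon> > 0"
  have wK: "w \<in> carrier (free_real (carrier K))" "set w \<subseteq> carrier K \<times> \<int>"
    using w by (auto simp: carrier_F_int FR_def)
  have "W.wnorm w < FR_norm K \<nu> w + \<epsilon> / 2"
    using \<epsilon> by (simp add: FR_norm_def FR_def)
  with wK(1) obtain Z where Z: "fst ` set Z \<subseteq> carrier K" "src Z = w" "word (tgt Z) = []"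
    "change \<nu> Z < FR_norm K \<nu> w + \<epsilon> / 2"
    by (rule W.wnorm_trivialisation)
  define B where "B = (\<Sum>g\<leftarrow>map fst Z. \<nu> g)"
  obtain M :: nat where "B / (\<epsilon> / 2) < real M"
    using reals_Archimedean2 by blast
  then have B: "B \<le> real (Suc M) * (\<epsilon> / 2)"
    using \<epsilon> by (simp add: field_simps)
  have *: "\<nu> (pi_hom K w) \<le> rounding_cost \<nu> (real j / real (Suc M)) Z" if "j < Suc M" for j
  proof -
    have "int_prod K (roundings (real j / real (Suc M)) (tgt Z)) = \<one>"
      using Z(1,3) that by (subst int_prod_roundings) auto
    then show ?thesis
      using norm_int_prod_le[OF Z(1)] Z(2) by metis
  qed
  have "real (Suc M) * \<nu> (pi_hom K w) = (\<Sum>j<Suc M. \<nu> (pi_hom K w))"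
    by simp
  also have "\<dots> \<le> (\<Sum>j<Suc M. rounding_cost \<nu> (real j / real (Suc M)) Z)"
    using * by (intro sum_mono) auto
  also have "\<dots> \<le> real (Suc M) * change \<nu> Z + B"
    unfolding B_def
    by (rule sum_rounding_cost) (use Z wK in \<open>auto intro: norm_nonneg\<close>)
  also have "\<dots> \<le> real (Suc M) * (FR_norm K \<nu> w + \<epsilon> / 2) + real (Suc M) * (\<epsilon> / 2)"
    using Z(4) B by (intro add_mono mult_left_mono) auto
  also have "\<dots> = real (Suc M) * (FR_norm K \<nu> w + \<epsilon>)"
    by (simp add: algebra_simps)
  finally show "\<nu> (pi_hom K w) \<le> FR_norm K \<nu> w + \<epsilon>"
    by (simp only: mult_le_cancel_left_pos of_nat_0_less_iff zero_less_Suc)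
qed

end

section \<open>The directional asymptotic cone\<close>

lemma pseudonormed_scaled:
  assumes "pseudonormed_group K \<nu>" "c \<ge> 0" shows "pseudonormed_group K (\<lambda>x. c * \<nu> x)"
proof -
  interpret pseudonormed_group K \<nu> by fact
  show ?thesis
  proof (unfold_locales, unfold conj_inv_pseudonorm_def, intro conjI ballI)
    show "c * \<nu> (g \<otimes>\<^bsub>K\<^esub> h) \<le> c * \<nu> g + c * \<nu> h" if "g \<in> carrier K" "h \<in> carrier K" for g h
      using mult_left_mono[OF norm_mult[OF that] assms(2)] by (simp add: distrib_left)
  qed (use assms(2) in \<open>auto simp: norm_nonneg norm_inv norm_conj\<close>)
qed

lemma (in pseudonormed_group) cauchy_along_close:
  assumes T: "cofinal T" and f: "\<And>t. t \<in> T \<Longrightarrow> f t \<in> carrier K" and g: "\<And>t. t \<in> T \<Longrightarrow> g t \<in> carrier K"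
    and cauchy: "cauchy_along T d g" and close: "((\<lambda>t. d (f t) (g t)) \<longlongrightarrow> 0) (along T)"
  shows "cauchy_along T d f"
  unfolding cauchy_along_iff[OF T]
proof (intro allI impI)
  fix \<epsilon> :: real assume "\<epsilon> > 0"
  then have "\<epsilon> / 3 > 0" by simp
  with cauchy obtain P where P: "eventually P (along T)"
    "\<forall>t\<in>T. \<forall>t'\<in>T. P t \<longrightarrow> P t' \<longrightarrow> d (g t) (g t') < \<epsilon> / 3"
    unfolding cauchy_along_iff[OF T] by blast
  have ev: "eventually (\<lambda>t. d (f t) (g t) < \<epsilon> / 3) (along T)"
    using order_tendstoD(2)[OF close \<open>\<epsilon> / 3 > 0\<close>] .
  show "\<exists>P. eventually P (along T) \<and> (\<forall>t\<in>T. \<forall>t'\<in>T. P t \<longrightarrow> P t' \<longrightarrow> d (f t) (f t') < \<epsilon>)"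
  proof (intro exI conjI ballI impI)
    show "eventually (\<lambda>t. P t \<and> d (f t) (g t) < \<epsilon> / 3) (along T)"
      using P(1) ev by (rule eventually_conj)
    fix t t' assume t: "t \<in> T" "t' \<in> T" "P t \<and> d (f t) (g t) < \<epsilon> / 3" "P t' \<and> d (f t') (g t') < \<epsilon> / 3"
    have "d (f t) (f t') \<le> d (f t) (g t) + (d (g t) (g t') + d (g t') (f t'))"
      using t f g d_triangle[of "f t" "g t" "f t'"] d_triangle[of "g t" "g t'" "f t'"] by fastforce
    moreover have "d (g t) (g t') < \<epsilon> / 3"
      using P(2) t by blast
    ultimately show "d (f t) (f t') < \<epsilon>"
      using t by (simp add: d_sym[of "g t'"])
  qed
qed

text \<open>The number \<open>N t\<close> grows so slowly that the error constant \<open>c (N t)\<close>, divided by \<open>t\<close>, still tends to zero. This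
  is used to form diagonal functions.\<close>

lemma slow_reparametrisation:
  fixes c :: "nat \<Rightarrow> real"
  shows "\<exists>N :: real \<Rightarrow> nat. filterlim N at_top at_top \<and>
    eventually (\<lambda>t. c (N t) * (real (N t) + 1) \<le> t) at_top"
proof -
  define ok where "ok t n \<longleftrightarrow> real n \<le> t \<and> (\<forall>k\<le>n. c k * (real k + 1) \<le> t)" for t n
  define N where "N t = (GREATEST n. ok t n)" for t
  have N: "ok t (N t)" "n \<le> N t" if "ok t n" for t n
  proof -
    have bd: "\<And>m. ok t m \<Longrightarrow> m \<le> nat \<lceil>t\<rceil>"
      unfolding ok_def by linarith
    show "ok t (N t)"
      unfolding N_def using that bd by (rule GreatestI_nat)
    show "n \<le> N t"
      unfolding N_def using that bd by (rule Greatest_le_nat)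
  qed
  define b where "b n = max (real n) (Max ((\<lambda>k. c k * (real k + 1)) ` {..n}))" for n
  have ok: "ok t n" if "b n \<le> t" for t n
  proof -
    have "c k * (real k + 1) \<le> b n" if "k \<le> n" for k
      unfolding b_def using that by (intro max.coboundedI2 Max_ge) auto
    moreover have "real n \<le> b n"
      by (simp add: b_def)
    ultimately show ?thesis
      using that unfolding ok_def by (meson order_trans)
  qed
  have "filterlim N at_top at_top"
    unfolding filterlim_at_top eventually_at_top_linorder using ok N(2) by blast
  moreover have "eventually (\<lambda>t. c (N t) * (real (N t) + 1) \<le> t) at_top"
    unfolding eventually_at_top_linorder using ok[of 0] N(1)[of _ 0] unfolding ok_def by blast
  ultimately show ?thesis by blast
qed

locale directional_cone = G: pseudonormed_group G \<nu> for G :: "('g, 'm) monoid_scheme" and \<nu>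
begin

abbreviation T :: "real set" where "T \<equiv> {0<..}"
abbreviation "FG \<equiv> FR G"
abbreviation "fn \<equiv> FR_norm G \<nu>"

sublocale W: weighted "carrier G" \<nu>
  by (rule G.weighted_carrier)

sublocale FR: pseudonormed_group "FR G" "FR_norm G \<nu>"
  using W.pseudonormed_wnorm by (simp add: FR_def FR_norm_def)

lemma fn_bar_le: "g \<in> carrier G \<Longrightarrow> fn (bar g r) \<le> \<bar>r\<bar> * \<nu> g"
  using W.wnorm_bar_le by (simp add: FR_def FR_norm_def)

lemma hom_le_fn:
  assumes "pseudonormed_group L \<mu>" "f \<in> hom (FR G) L"
    and "\<And>g r. g \<in> carrier G \<Longrightarrow> \<mu> (f (bar g r)) \<le> \<bar>r\<bar> * \<nu> g" and "x \<in> carrier (FR G)"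
  shows "\<mu> (f x) \<le> fn x"
  using W.hom_le_wnorm[of L \<mu> f x] assms by (simp add: FR_def FR_norm_def)

lemma bar_FR [simp, intro]: "g \<in> carrier G \<Longrightarrow> bar g r \<in> carrier (FR G)"
  by (simp add: FR_def bar_closed)

lemma F_int_FR [simp, intro]: "x \<in> carrier (F_int G) \<Longrightarrow> x \<in> carrier (FR G)"
  by (simp add: carrier_F_int)

lemma word_FR [simp, intro]: "fst ` set W \<subseteq> carrier G \<Longrightarrow> word W \<in> carrier (FR G)"
  by (simp add: FR_def word_closed)

lemma fst_FR: "x \<in> carrier (FR G) \<Longrightarrow> fst ` set x \<subseteq> carrier G"
  by (auto simp: FR_def carrier_free_real)

lemma word_FR_normal: "x \<in> carrier (FR G) \<Longrightarrow> word x = x"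
  by (simp add: FR_def word_normal)

lemma psi_closed [simp, intro]: "x \<in> carrier (FR G) \<Longrightarrow> psi G t x \<in> carrier (FR G)"
  using psi_hom by (auto simp: hom_def)

lemma psi_word:
  assumes "fst ` set W \<subseteq> carrier G"
  shows "psi G t (word W) = list_mult (FR G) (map (\<lambda>(g, r). bar g (t * r)) W)"
proof -
  interpret P: additive_family "FR G" "carrier G" UNIV "\<lambda>g r. bar g (t * r)"
    by (rule additive_family_psi)
  show ?thesis
    unfolding psi_eq_lift using assms by (subst P.lift_word) (auto simp: lift_def)
qed

lemma psi_eq_word: "psi G t x = word (map (\<lambda>(g, r). (g, t * r)) x)"
  by (simp add: psi_def word_eq_list_mult[of _ "carrier G"] FR_def comp_def case_prod_unfold)

lemma psi_psi:
  assumes "x \<in> carrier (FR G)" shows "psi G s (psi G t x) = psi G (s * t) x"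
proof -
  have "fst ` set (map (\<lambda>(g, r). (g, t * r)) x) \<subseteq> carrier G"
    using fst_FR[OF assms] by force
  then have "psi G s (psi G t x) = list_mult (FR G) (map (\<lambda>(g, r). bar g (s * r)) (map (\<lambda>(g, r). (g, t * r)) x))"
    unfolding psi_eq_word[of t] by (rule psi_word)
  then show ?thesis
    by (simp add: psi_def comp_def case_prod_unfold mult.assoc)
qed

lemma psi_1: "x \<in> carrier (FR G) \<Longrightarrow> psi G 1 x = x"
  by (simp add: psi_eq_word word_FR_normal case_prod_unfold)

text \<open>Rescaling by \<open>t\<close> multiplies the bounds on single syllables by \<open>t\<close>, so the claim follows from the maximality of
  the pseudonorm.\<close>

lemma fn_psi_le:
  assumes "x \<in> carrier (FR G)" "t > 0" shows "fn (psi G t x) \<le> t * fn x"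
proof -
  have "(1 / t) * fn (psi G t x) \<le> fn x"
  proof (rule hom_le_fn[OF _ psi_hom _ assms(1)])
    show "pseudonormed_group (FR G) (\<lambda>x. (1 / t) * fn x)"
      using assms(2) by (intro pseudonormed_scaled FR.pseudonormed_group_axioms) simp
    fix g r assume g: "g \<in> carrier G"
    then have "psi G t (bar g r) = bar g (t * r)"
      using psi_word[of "[(g, r)]" t] by (simp add: word_single)
    then have "fn (psi G t (bar g r)) \<le> t * (\<bar>r\<bar> * \<nu> g)"
      using fn_bar_le[OF g, of "t * r"] assms(2) by (simp add: abs_mult mult.assoc)
    then show "(1 / t) * fn (psi G t (bar g r)) \<le> \<bar>r\<bar> * \<nu> g"
      using assms(2) by (simp add: field_simps)
  qed
  then show ?thesis
    using assms(2) by (simp add: field_simps)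
qed

lemma fn_le_psi:
  assumes "x \<in> carrier (FR G)" "t > 0" shows "fn x \<le> t * fn (psi G (1 / t) x)"
  using fn_psi_le[of "psi G (1 / t) x" t] assms by (simp add: psi_psi psi_1)

sublocale D: cauchy_group "F_int G" "FR G" "FR_norm G \<nu>" "{0<..}" "\<lambda>t. psi G (1 / t)"
proof -
  interpret Fi: group "F_int G" by (rule group_F_int)
  show "cauchy_group (F_int G) (FR G) (FR_norm G \<nu>) {0<..} (\<lambda>t. psi G (1 / t))"
  proof
    show "psi G (1 / t) \<in> hom (F_int G) (FR G)" for t
      using psi_hom[of G "1 / t"] by (auto simp: hom_def mult_F_int)
  qed (rule cofinal_pos)
qed

lemma D_group_eq: "D_group G \<nu> T = D.CG"
  by (simp add: D_group_def D.CG_def)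

lemma D_norm_eq: "D_norm G \<nu> T = D.CN"
  by (rule ext) (simp add: D_norm_def D.CN_def)

abbreviation "C \<equiv> C_group G \<nu> {0<..}"
abbreviation "\<pi> \<equiv> compose {0::real<..} (pi_hom G)"

lemma pi_hom_closed [simp, intro]: "x \<in> carrier (F_int G) \<Longrightarrow> pi_hom G x \<in> carrier G"
  using pi_hom_hom[OF G.group_axioms] by (auto simp: hom_def)

lemma \<pi>_hom: "\<pi> \<in> hom D.CG (product_group T (\<lambda>_. G))"
proof (rule homI)
  show "\<pi> x \<in> carrier (product_group T (\<lambda>_. G))" if "x \<in> carrier D.CG" for x
    using that D.CG_mem by (auto simp: compose_def)
  show "\<pi> (x \<otimes>\<^bsub>D.CG\<^esub> y) = \<pi> x \<otimes>\<^bsub>product_group T (\<lambda>_. G)\<^esub> \<pi> y"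
    if "x \<in> carrier D.CG" "y \<in> carrier D.CG" for x y
  proof (rule ext)
    fix t show "\<pi> (x \<otimes>\<^bsub>D.CG\<^esub> y) t = (\<pi> x \<otimes>\<^bsub>product_group T (\<lambda>_. G)\<^esub> \<pi> y) t"
      using that D.CG_mem[of _ t] hom_mult[OF pi_hom_hom[OF G.group_axioms]]
      by (auto simp: compose_def D.mult_CG)
  qed
qed

lemma C_eq: "C = (product_group T (\<lambda>_. G))\<lparr>carrier := \<pi> ` carrier D.CG\<rparr>"
  by (simp add: C_group_def D_group_eq)

lemma carrier_C: "carrier C = \<pi> ` carrier D.CG"
  by (simp add: C_eq)

lemma mult_C: "f \<otimes>\<^bsub>C\<^esub> g = (\<lambda>t\<in>T. f t \<otimes>\<^bsub>G\<^esub> g t)"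
  by (simp add: C_eq)

lemma group_C: "group C"
proof -
  interpret P: group "product_group T (\<lambda>_. G)"
    by (simp add: G.group_axioms)
  interpret \<pi>: group_hom D.CG "product_group T (\<lambda>_. G)" \<pi>
    by unfold_locales (rule \<pi>_hom)
  show ?thesis
    unfolding C_eq by (rule subgroup.subgroup_is_group[OF \<pi>.img_is_subgroup P.group_axioms])
qed

lemma \<pi>_hom_C: "\<pi> \<in> hom D.CG C"
  using \<pi>_hom by (auto simp: hom_def carrier_C mult_C)

lemma C_norm_eq: "C_norm G \<nu> T f = Inf (D.CN ` {w \<in> carrier D.CG. \<pi> w = f})"
  by (simp add: C_norm_def D_group_eq D_norm_eq)

lemmas C_quotient = pseudonorm_quotient[OF D.CG.pseudonormed_group_axioms group_C \<pi>_hom_C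
    carrier_C[symmetric] C_norm_eq]

sublocale C: pseudonormed_group "C_group G \<nu> {0<..}" "C_norm G \<nu> {0<..}"
  by (rule C_quotient(1))

sublocale \<pi>: group_hom D.CG "C_group G \<nu> {0<..}" "compose {0<..} (pi_hom G)"
  by unfold_locales (rule \<pi>_hom_C)

abbreviation "L \<equiv> asym_cone G \<nu> {0<..}"
abbreviation "\<mu> \<equiv> cone_norm G \<nu> {0<..}"

lemma L_eq: "L = C.Quot" and \<mu>_eq: "\<mu> = coset_norm (C_norm G \<nu> T)"
  and cone_class_eq: "cone_class G \<nu> T f = C.cls f"
  by (simp_all add: asym_cone_def C.Quot_def cone_norm_def cone_class_def C.cls_def)

sublocale L: pseudonormed_group "asym_cone G \<nu> {0<..}" "cone_norm G \<nu> {0<..}"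
  using C.pseudonormed_Quot by (simp add: L_eq \<mu>_eq)

lemma C_d_le: "w \<in> carrier D.CG \<Longrightarrow> v \<in> carrier D.CG \<Longrightarrow> C.d (\<pi> w) (\<pi> v) \<le> D.CG.d w v"
  using C_quotient(2)[of "inv\<^bsub>D.CG\<^esub> w \<otimes>\<^bsub>D.CG\<^esub> v"] by (simp add: C.d_eq D.CG.d_eq)

lemma L_d_cls: "f \<in> carrier C \<Longrightarrow> g \<in> carrier C \<Longrightarrow> L.d (C.cls f) (C.cls g) = C.d f g"
  using C.d_cls by (simp add: L_eq \<mu>_eq)

lemma \<mu>_cls: "f \<in> carrier C \<Longrightarrow> \<mu> (C.cls f) = C_norm G \<nu> T f"
  by (simp add: \<mu>_eq C.coset_norm_cls)

lemma carrier_L: "carrier L = C.cls ` \<pi> ` carrier D.CG"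
  by (simp add: L_eq C.carrier_Quot carrier_C)

lemma tendsto_along_T: "(f \<longlongrightarrow> l) at_top \<Longrightarrow> (f \<longlongrightarrow> l) (along T)"
  by (rule filterlim_mono[OF _ order.refl]) auto

text \<open>Every lower bound for norms in the cone comes from here. It combines the contraction property of the
  projection to the group with the scaling behaviour of the pseudonorm.\<close>

lemma norm_ratio_le:
  assumes w: "w \<in> carrier D.CG" and t: "t \<in> T"
  shows "\<nu> (\<pi> w t) / t \<le> fn (psi G (1 / t) (w t))"
proof -
  have wt: "w t \<in> carrier (F_int G)"
    using w t by (rule D.CG_mem)
  have "\<nu> (\<pi> w t) = \<nu> (pi_hom G (w t))"
    using t by (simp add: compose_def)
  also have "\<dots> \<le> fn (w t)"
    using wt by (rule G.norm_pi_hom_le)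
  also have "\<dots> \<le> t * fn (psi G (1 / t) (w t))"
    using wt t by (intro fn_le_psi) auto
  finally show ?thesis
    using t by (simp add: field_simps)
qed

lemma C_norm_ge:
  assumes f: "f \<in> carrier C" and lim: "((\<lambda>t. \<nu> (f t) / t) \<longlongrightarrow> c) at_top"
  shows "c \<le> C_norm G \<nu> T f"
  unfolding C_norm_eq
proof (rule cInf_greatest)
  show "D.CN ` {w \<in> carrier D.CG. \<pi> w = f} \<noteq> {}"
    using f by (auto simp: carrier_C)
  fix b assume "b \<in> D.CN ` {w \<in> carrier D.CG. \<pi> w = f}"
  then obtain w where w: "w \<in> carrier D.CG" "\<pi> w = f" "b = D.CN w"
    by blast
  show "c \<le> b"
    unfolding w(3)
  proof (rule tendsto_le[OF along_nontrivial[OF cofinal_pos] D.CN_tendsto[OF w(1)] tendsto_along_T[OF lim]])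
    show "eventually (\<lambda>t. \<nu> (f t) / t \<le> fn (psi G (1 / t) (w t))) (along T)"
      using norm_ratio_le[OF w(1)] by (intro D.eventually_along_T) (simp add: w(2))
  qed
qed

lemma C_norm_0_sublinear:
  assumes f: "f \<in> carrier C" "C_norm G \<nu> T f = 0"
  shows "((\<lambda>t. \<nu> (f t) / t) \<longlongrightarrow> 0) at_top"
proof (rule tendstoI)
  fix \<epsilon> :: real assume "\<epsilon> > 0"
  then obtain w where w: "w \<in> carrier D.CG" "\<pi> w = f" "D.CN w < \<epsilon>"
    using C_quotient(3)[OF f(1), of \<epsilon>] f(2) by auto
  have "eventually (\<lambda>t. fn (psi G (1 / t) (w t)) < \<epsilon>) (along T)"
    using order_tendstoD(2)[OF D.CN_tendsto[OF w(1)] w(3)] .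
  then have "eventually (\<lambda>t. t \<in> T \<longrightarrow> fn (psi G (1 / t) (w t)) < \<epsilon>) at_top"
    by (simp add: eventually_inf_principal)
  then show "eventually (\<lambda>t. dist (\<nu> (f t) / t) 0 < \<epsilon>) at_top"
    using eventually_gt_at_top[of 0]
  proof eventually_elim
    case (elim t)
    have "f t \<in> carrier G"
      using D.CG_mem[OF w(1), of t] elim by (auto simp: w(2)[symmetric] compose_def)
    then show ?case
      using norm_ratio_le[OF w(1), of t] elim by (simp add: w(2) G.norm_nonneg)
  qed
qed

text \<open>The function is lifted to the one-letter words \<open>bar (f t) 1\<close>, whose rescaled norms are at most \<open>\<nu> (f t) / t\<close>.\<close>

lemma sublinear_null:
  assumes f: "f \<in> T \<rightarrow>\<^sub>E carrier G" and lim: "((\<lambda>t. \<nu> (f t) / t) \<longlongrightarrow> 0) at_top"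
  shows "f \<in> carrier C" and "C_norm G \<nu> T f = 0"
proof -
  define w where "w = (\<lambda>t\<in>T. bar (f t) 1)"
  have fG: "f t \<in> carrier G" if "t \<in> T" for t
    using f that by auto
  have psi_w: "psi G (1 / t) (w t) = bar (f t) (1 / t)" if "t \<in> T" for t
    using psi_word[of "[(f t, 1)]" "1 / t"] fG[OF that] that by (simp add: word_single w_def)
  have fn_w: "fn (psi G (1 / t) (w t)) \<le> \<nu> (f t) / t" if "t \<in> T" for t
    using fn_bar_le[OF fG[OF that], of "1 / t"] that by (simp add: psi_w)
  have small: "((\<lambda>t. fn (psi G (1 / t) (w t))) \<longlongrightarrow> 0) (along T)"
  proof (rule tendsto_sandwich[OF _ _ tendsto_const tendsto_along_T[OF lim]])
    show "eventually (\<lambda>t. 0 \<le> fn (psi G (1 / t) (w t))) (along T)"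
      using fG by (intro D.eventually_along_T FR.norm_nonneg) (simp add: psi_w)
    show "eventually (\<lambda>t. fn (psi G (1 / t) (w t)) \<le> \<nu> (f t) / t) (along T)"
      using fn_w by (rule D.eventually_along_T)
  qed
  have w_int: "w t \<in> carrier (F_int G)" if "t \<in> T" for t
    using fG[OF that] that by (auto simp: w_def carrier_F_int bar_def FR_def carrier_free_real)
  have "cauchy_along T FR.d (\<lambda>t. psi G (1 / t) (w t))"
  proof (rule FR.cauchy_along_close[OF cofinal_pos, where g = "\<lambda>_. \<one>\<^bsub>FR G\<^esub>"])
    show "cauchy_along T FR.d (\<lambda>_. \<one>\<^bsub>FR G\<^esub>)"
      by (auto simp: cauchy_along_def)
    show "((\<lambda>t. FR.d (psi G (1 / t) (w t)) \<one>\<^bsub>FR G\<^esub>) \<longlongrightarrow> 0) (along T)"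
      using small
    proof (rule Lim_transform_eventually)
      show "eventually (\<lambda>t. fn (psi G (1 / t) (w t)) = FR.d (psi G (1 / t) (w t)) \<one>\<^bsub>FR G\<^esub>) (along T)"
        using fG by (intro D.eventually_along_T) (simp add: psi_w FR.d_sym[of _ "\<one>\<^bsub>FR G\<^esub>"] FR.d_one)
    qed
  qed (use w_int in auto)
  then have w: "w \<in> carrier D.CG"
    using w_int by (auto simp: D.carrier_CG_iff w_def)
  have "\<pi> w = f"
  proof
    fix t
    show "\<pi> w t = f t"
      using f fG[of t] by (cases "t \<in> T")
        (auto simp: compose_def w_def pi_hom_def bar_def PiE_def extensional_def int_pow_def2)
  qed
  with w show fC: "f \<in> carrier C"
    by (auto simp: carrier_C)
  have "D.CN w = 0"
    using small by (rule D.CN_eqI)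
  then show "C_norm G \<nu> T f = 0"
    using C_quotient(2)[OF w] C.norm_nonneg[OF fC] \<open>\<pi> w = f\<close> by simp
qed

end

section \<open>The homomorphism to the cone\<close>

context directional_cone
begin

definition floor_word :: "real \<Rightarrow> ('g \<times> real) list \<Rightarrow> ('g \<times> real) list" where
  "floor_word t W = map (\<lambda>(g, r). (g, real_of_int \<lfloor>r * t\<rfloor>)) W"

text \<open>A Cauchy function that lifts the path of \<open>W\<close> to the free product and converges to \<open>word W\<close> after rescaling.\<close>

definition approx :: "('g \<times> real) list \<Rightarrow> real \<Rightarrow> ('g \<times> real) list" where
  "approx W = (\<lambda>t\<in>T. word (floor_word t W))"

definition path :: "('g \<times> real) list \<Rightarrow> real \<Rightarrow> 'g" where
  "path W = (\<lambda>t\<in>T. list_mult G (map (\<lambda>(g, r). g [^]\<^bsub>G\<^esub> \<lfloor>r * t\<rfloor>) W))"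

definition total_weight :: "('g \<times> real) list \<Rightarrow> real" where
  "total_weight W = (\<Sum>(g, r)\<leftarrow>W. \<nu> g)"

lemma eta_eq: "eta G \<nu> W = C.cls (path W)"
  by (simp add: eta_def path_def cone_class_eq)

lemma fst_floor_word [simp]: "fst ` set (floor_word t W) = fst ` set W"
  by (force simp: floor_word_def image_image)

lemma approx_int:
  assumes "fst ` set W \<subseteq> carrier G" "t \<in> T" shows "approx W t \<in> carrier (F_int G)"
proof -
  have "set (floor_word t W) \<subseteq> carrier G \<times> \<int>"
    using assms(1) by (auto simp: floor_word_def)
  then have "set (word (floor_word t W)) \<subseteq> carrier G \<times> \<int>"
    using set_foldr_push_syl[OF additive_subgroup_Ints, of "floor_word t W" "carrier G" "[]"]
    by (simp add: word_def)
  moreover have "word (floor_word t W) \<in> carrier (FR G)"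
    using assms(1) by (intro word_FR) simp
  moreover have "approx W t = word (floor_word t W)"
    using assms(2) by (simp add: approx_def)
  ultimately show ?thesis
    unfolding carrier_F_int by simp
qed

lemma d_approx:
  assumes W: "fst ` set W \<subseteq> carrier G" and t: "t \<in> T"
  shows "FR.d (psi G (1 / t) (approx W t)) (word W) \<le> total_weight W / t"
proof -
  have eq: "psi G (1 / t) (approx W t) = list_mult (FR G) (map (\<lambda>(g, r). bar g (of_int \<lfloor>r * t\<rfloor> / t)) W)"
    using W t by (simp add: approx_def psi_word floor_word_def comp_def case_prod_unfold image_image)
  have "FR.d (list_mult (FR G) (map (\<lambda>(g, r). bar g (of_int \<lfloor>r * t\<rfloor> / t)) W))
      (list_mult (FR G) (map (\<lambda>(g, r). bar g r) W)) \<le> total_weight W / t"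
    using W
  proof (induction W)
    case (Cons p W)
    obtain g r where p: "p = (g, r)" by (cases p)
    have g: "g \<in> carrier G"
      using Cons.prems by (simp add: p)
    have cl: "list_mult (FR G) (map (\<lambda>(g, r). bar g (of_int \<lfloor>r * t\<rfloor> / t)) W) \<in> carrier (FR G)"
      "list_mult (FR G) (map (\<lambda>(g, r). bar g r) W) \<in> carrier (FR G)"
      using Cons.prems by (force simp: image_subset_iff intro!: FR.list_mult_closed)+
    have "FR.d (bar g (of_int \<lfloor>r * t\<rfloor> / t)) (bar g r) = fn (bar g (r - of_int \<lfloor>r * t\<rfloor> / t))"
      using g by (simp add: FR.d_eq) (simp add: FR_def bar_inv bar_mult)
    also have "\<dots> \<le> \<bar>r - of_int \<lfloor>r * t\<rfloor> / t\<bar> * \<nu> g"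
      using g by (rule fn_bar_le)
    also have "\<bar>r - of_int \<lfloor>r * t\<rfloor> / t\<bar> = \<bar>r * t - of_int \<lfloor>r * t\<rfloor>\<bar> / t"
      using t by (simp add: field_simps)
    also have "\<dots> * \<nu> g \<le> 1 / t * \<nu> g"
      using t g by (intro mult_right_mono divide_right_mono G.norm_nonneg) (auto, linarith)
    finally have "FR.d (bar g (of_int \<lfloor>r * t\<rfloor> / t)) (bar g r) \<le> \<nu> g / t"
      by simp
    moreover have "FR.d (list_mult (FR G) (map (\<lambda>(g, r). bar g (of_int \<lfloor>r * t\<rfloor> / t)) W))
      (list_mult (FR G) (map (\<lambda>(g, r). bar g r) W)) \<le> total_weight W / t"
      using Cons by simp
    ultimately show ?case
      using FR.d_mult[OF bar_FR[OF g] cl(1) bar_FR[OF g] cl(2), of "of_int \<lfloor>r * t\<rfloor> / t" r]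
      by (simp add: p total_weight_def add_divide_distrib)
  qed (simp add: total_weight_def)
  then show ?thesis
    by (simp add: eq word_eq_list_mult[of W "carrier G"] FR_def)
qed

lemma approx_tendsto:
  assumes W: "fst ` set W \<subseteq> carrier G"
  shows "((\<lambda>t. FR.d (psi G (1 / t) (approx W t)) (word W)) \<longlongrightarrow> 0) (along T)"
proof (rule tendsto_sandwich[OF _ _ tendsto_const])
  show "eventually (\<lambda>t. 0 \<le> FR.d (psi G (1 / t) (approx W t)) (word W)) (along T)"
    by (simp add: FR.d_nonneg)
  show "eventually (\<lambda>t. FR.d (psi G (1 / t) (approx W t)) (word W) \<le> total_weight W / t) (along T)"
    using d_approx[OF W] by (rule D.eventually_along_T)
  have "((\<lambda>t. total_weight W / t) \<longlongrightarrow> 0) at_top"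
    by (rule tendsto_divide_0[OF tendsto_const filterlim_at_top_imp_at_infinity[OF filterlim_ident]])
  then show "((\<lambda>t. total_weight W / t) \<longlongrightarrow> 0) (along T)"
    by (rule tendsto_along_T)
qed

lemma approx_D:
  assumes W: "fst ` set W \<subseteq> carrier G" shows "approx W \<in> carrier D.CG"
proof -
  have "cauchy_along T FR.d (\<lambda>t. psi G (1 / t) (approx W t))"
  proof (rule FR.cauchy_along_close[OF cofinal_pos _ _ _ approx_tendsto[OF W]])
    show "cauchy_along T FR.d (\<lambda>_. word W)"
      by (auto simp: cauchy_along_def)
  qed (use W approx_int in auto)
  then show ?thesis
    using approx_int[OF W] by (auto simp: D.carrier_CG_iff approx_def)
qed

lemma \<pi>_approx:
  assumes W: "fst ` set W \<subseteq> carrier G" shows "\<pi> (approx W) = path W"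
proof
  fix t
  interpret P: additive_family G "carrier G" \<int> "\<lambda>g r. g [^]\<^bsub>G\<^esub> \<lfloor>r\<rfloor>"
    by (rule additive_family_pi) (rule G.group_axioms)
  have "set (floor_word t W) \<subseteq> carrier G \<times> \<int>"
    using W by (auto simp: floor_word_def)
  then have "pi_hom G (word (floor_word t W)) = lift G (\<lambda>g r. g [^]\<^bsub>G\<^esub> \<lfloor>r\<rfloor>) (floor_word t W)"
    unfolding pi_hom_eq_lift by (rule P.lift_word)
  then show "\<pi> (approx W) t = path W t"
    by (simp add: compose_def approx_def path_def lift_def floor_word_def comp_def case_prod_unfold)
qed

lemma path_C: "fst ` set W \<subseteq> carrier G \<Longrightarrow> path W \<in> carrier C"
  using approx_D[of W] by (auto simp: carrier_C \<pi>_approx[symmetric])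

text \<open>Thus the class of the path of \<open>W\<close> depends only on the element that \<open>W\<close> spells, which makes \<open>\<eta>\<close> a homomorphism.\<close>

lemma C_d_path_le:
  assumes "fst ` set V \<subseteq> carrier G" "fst ` set W \<subseteq> carrier G"
  shows "C.d (path V) (path W) \<le> FR.d (word V) (word W)"
proof -
  have "C.d (path V) (path W) \<le> D.CG.d (approx V) (approx W)"
    using C_d_le[OF approx_D approx_D] assms by (simp add: \<pi>_approx)
  also have "\<dots> \<le> 0 + FR.d (word V) (word W) + 0"
  proof (rule tendsto_le[OF along_nontrivial[OF cofinal_pos] _ D.d_CG_tendsto[OF approx_D approx_D]])
    show "((\<lambda>t. FR.d (psi G (1 / t) (approx V t)) (word V) + FR.d (word V) (word W)
        + FR.d (psi G (1 / t) (approx W t)) (word W)) \<longlongrightarrow> 0 + FR.d (word V) (word W) + 0) (along T)"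
      by (intro tendsto_add approx_tendsto assms tendsto_const)
    show "eventually (\<lambda>t. FR.d (psi G (1 / t) (approx V t)) (psi G (1 / t) (approx W t))
        \<le> FR.d (psi G (1 / t) (approx V t)) (word V) + FR.d (word V) (word W)
          + FR.d (psi G (1 / t) (approx W t)) (word W)) (along T)"
    proof (rule D.eventually_along_T)
      fix t :: real assume "t \<in> T"
      then have cl: "psi G (1 / t) (approx V t) \<in> carrier (FR G)" "psi G (1 / t) (approx W t) \<in> carrier (FR G)"
        "word V \<in> carrier (FR G)" "word W \<in> carrier (FR G)"
        using assms approx_int by auto
      show "FR.d (psi G (1 / t) (approx V t)) (psi G (1 / t) (approx W t))
        \<le> FR.d (psi G (1 / t) (approx V t)) (word V) + FR.d (word V) (word W)
          + FR.d (psi G (1 / t) (approx W t)) (word W)"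
        using FR.d_triangle[OF cl(1,3,2)] FR.d_triangle[OF cl(3,4,2)]
        by (simp add: FR.d_sym[of "word W"])
    qed
  qed (use assms in auto)
  finally show ?thesis
    by simp
qed

lemma path_append:
  assumes "fst ` set V \<subseteq> carrier G" "fst ` set W \<subseteq> carrier G"
  shows "path (V @ W) = path V \<otimes>\<^bsub>C\<^esub> path W"
proof
  fix t :: real
  have "(\<lambda>(g, r). g [^]\<^bsub>G\<^esub> \<lfloor>r * t\<rfloor>) ` set U \<subseteq> carrier G" if "fst ` set U \<subseteq> carrier G" for U
    using that by auto
  then show "path (V @ W) t = (path V \<otimes>\<^bsub>C\<^esub> path W) t"
    using assms by (simp add: path_def mult_C G.list_mult_append)
qed

lemma eta_closed: "x \<in> carrier (FR G) \<Longrightarrow> eta G \<nu> x \<in> carrier L"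
  using path_C fst_FR by (auto simp: eta_eq L_eq)

lemma eta_word:
  assumes "fst ` set W \<subseteq> carrier G" shows "eta G \<nu> (word W) = C.cls (path W)"
proof -
  have w: "word W \<in> carrier (FR G)" "word (word W) = word W"
    using assms word_FR_normal by auto
  have "C.d (path (word W)) (path W) \<le> 0"
    using C_d_path_le[of "word W" W] fst_FR[OF w(1)] assms w by simp
  then have "C.d (path (word W)) (path W) = 0"
    using C.d_nonneg[of "path (word W)" "path W"] by simp
  then show ?thesis
    unfolding eta_eq using assms fst_FR[OF w(1)] by (subst C.cls_eq_iff) (auto simp: path_C)
qed

lemma eta_hom: "eta G \<nu> \<in> hom (FR G) L"
proof (rule homI)
  fix x y assume x: "x \<in> carrier (FR G)" and y: "y \<in> carrier (FR G)"
  have "eta G \<nu> (x \<otimes>\<^bsub>FR G\<^esub> y) = eta G \<nu> (word (x @ y))"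
    using x y by (simp add: FR_def mult_eq_word)
  also have "\<dots> = C.cls (path x \<otimes>\<^bsub>C\<^esub> path y)"
    using fst_FR[OF x] fst_FR[OF y] by (simp add: eta_word image_Un path_append)
  also have "\<dots> = eta G \<nu> x \<otimes>\<^bsub>L\<^esub> eta G \<nu> y"
    using fst_FR[OF x] fst_FR[OF y] path_C by (simp add: eta_eq L_eq)
  finally show "eta G \<nu> (x \<otimes>\<^bsub>FR G\<^esub> y) = eta G \<nu> x \<otimes>\<^bsub>L\<^esub> eta G \<nu> y" .
qed (rule eta_closed)

sublocale eta: group_hom "FR G" "asym_cone G \<nu> {0<..}" "eta G \<nu>"
  by unfold_locales (rule eta_hom)

lemma \<mu>_eta: "x \<in> carrier (FR G) \<Longrightarrow> \<mu> (eta G \<nu> x) = C_norm G \<nu> T (path x)"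
  using path_C fst_FR by (simp add: eta_eq \<mu>_cls)

lemma L_d_eta_le:
  assumes "x \<in> carrier (FR G)" "y \<in> carrier (FR G)"
  shows "L.d (eta G \<nu> x) (eta G \<nu> y) \<le> FR.d x y"
  using C_d_path_le[of x y] assms fst_FR[OF assms(1)] fst_FR[OF assms(2)]
  by (simp add: eta_eq L_d_cls path_C word_FR_normal)

lemma \<mu>_eta_le: assumes "x \<in> carrier (FR G)" shows "\<mu> (eta G \<nu> x) \<le> fn x"
  using L_d_eta_le[of "\<one>\<^bsub>FR G\<^esub>" x] assms by (simp add: L.d_one FR.d_one)

lemma eta_eqI_sublinear:
  assumes x: "x \<in> carrier (FR G)" and y: "y \<in> carrier (FR G)"
    and lim: "((\<lambda>t. G.d (path x t) (path y t) / t) \<longlongrightarrow> 0) at_top"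
  shows "eta G \<nu> x = eta G \<nu> y"
proof -
  note px = path_C[OF fst_FR[OF x]] and py = path_C[OF fst_FR[OF y]]
  have mem: "path x t \<in> carrier G" "path y t \<in> carrier G" if "t \<in> T" for t
    using px py that by (auto simp: carrier_C compose_def dest: D.CG_mem)
  have inv_px: "inv\<^bsub>C\<^esub> (path x) = (\<lambda>t\<in>T. inv\<^bsub>G\<^esub> (path x t))"
  proof -
    have "subgroup (carrier C) (product_group T (\<lambda>_. G))"
      using group_hom.img_is_subgroup[of D.CG "product_group T (\<lambda>_. G)" \<pi>] \<pi>_hom
      by (simp add: group_hom_def group_hom_axioms_def D.group_CG G.group_axioms carrier_C)
    then have "inv\<^bsub>C\<^esub> (path x) = inv\<^bsub>product_group T (\<lambda>_. G)\<^esub> (path x)"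
      using group.m_inv_consistent[of "product_group T (\<lambda>_. G)" "carrier C" "path x"] px
      by (simp add: C_eq[symmetric, folded carrier_C] G.group_axioms)
    also have "path x \<in> (\<Pi>\<^sub>E t\<in>T. carrier G)"
      using mem by (auto simp: path_def)
    then have "inv\<^bsub>product_group T (\<lambda>_. G)\<^esub> (path x) = (\<lambda>t\<in>T. inv\<^bsub>G\<^esub> (path x t))"
      using G.group_axioms by simp
    finally show ?thesis .
  qed
  define f where "f = inv\<^bsub>C\<^esub> (path x) \<otimes>\<^bsub>C\<^esub> path y"
  have f: "f = (\<lambda>t\<in>T. inv\<^bsub>G\<^esub> (path x t) \<otimes>\<^bsub>G\<^esub> path y t)"
    unfolding f_def mult_C inv_px by auto
  have "((\<lambda>t. \<nu> (f t) / t) \<longlongrightarrow> 0) at_top"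
    using lim
  proof (rule Lim_transform_eventually)
    show "eventually (\<lambda>t. G.d (path x t) (path y t) / t = \<nu> (f t) / t) at_top"
      using eventually_gt_at_top[of 0]
      by eventually_elim (use mem in \<open>simp add: f G.d_eq\<close>)
  qed
  moreover have "f \<in> T \<rightarrow>\<^sub>E carrier G"
    using mem by (auto simp: f)
  ultimately have "C_norm G \<nu> T f = 0"
    by (rule sublinear_null(2)[rotated])
  then have "C.d (path x) (path y) = 0"
    using px py by (simp add: f_def C.d_eq)
  then show ?thesis
    using px py by (simp add: eta_eq C.cls_eq_iff)
qed

text \<open>The rescaled lift of the element \<open>psi G (1 / s) (w s)\<close> converges to that element, while \<open>w\<close> stays close to it from
  time \<open>s\<close> onwards.\<close>

lemma cls_approx:
  assumes w: "w \<in> carrier D.CG" and \<epsilon>: "\<epsilon> > 0"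
  obtains b where "b \<in> T"
    "\<And>s. b \<le> s \<Longrightarrow> L.d (C.cls (\<pi> w)) (eta G \<nu> (psi G (1 / s) (w s))) \<le> \<epsilon>"
proof -
  have \<epsilon>2: "\<epsilon> / 2 > 0" using \<epsilon> by simp
  have cauchy: "cauchy_along T FR.d (\<lambda>t. psi G (1 / t) (w t))"
    using w by (simp add: D.carrier_CG_iff)
  obtain b where b: "b \<in> T" and bd: "\<And>t t'. t \<in> T \<Longrightarrow> t' \<in> T \<Longrightarrow> b \<le> t \<Longrightarrow> b \<le> t' \<Longrightarrow>
      FR.d (psi G (1 / t) (w t)) (psi G (1 / t') (w t')) < \<epsilon> / 2"
    using cauchy_alongD[OF cofinal_pos cauchy \<epsilon>2] by blast
  have "L.d (C.cls (\<pi> w)) (eta G \<nu> (psi G (1 / s) (w s))) \<le> \<epsilon>" if "b \<le> s" for s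
  proof -
    have s: "s \<in> T" using b that by auto
    define y where "y = psi G (1 / s) (w s)"
    have y: "y \<in> carrier (FR G)"
      using D.CG_mem[OF w s] by (auto simp: y_def)
    have "L.d (C.cls (\<pi> w)) (eta G \<nu> y) = C.d (\<pi> w) (\<pi> (approx y))"
      using w y path_C[OF fst_FR[OF y]] by (simp add: eta_eq L_d_cls carrier_C \<pi>_approx fst_FR)
    also have "\<dots> \<le> D.CG.d w (approx y)"
      using w approx_D[OF fst_FR[OF y]] by (rule C_d_le)
    also have "\<dots> \<le> \<epsilon> / 2 + 0"
    proof (rule tendsto_le[OF along_nontrivial[OF cofinal_pos] _ D.d_CG_tendsto[OF w approx_D[OF fst_FR[OF y]]]])
      show "((\<lambda>t. \<epsilon> / 2 + FR.d (psi G (1 / t) (approx y t)) (word y)) \<longlongrightarrow> \<epsilon> / 2 + 0) (along T)"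
        by (intro tendsto_add tendsto_const approx_tendsto fst_FR y)
      show "eventually (\<lambda>t. FR.d (psi G (1 / t) (w t)) (psi G (1 / t) (approx y t))
          \<le> \<epsilon> / 2 + FR.d (psi G (1 / t) (approx y t)) (word y)) (along T)"
        unfolding eventually_along[OF cofinal_pos]
      proof (intro exI[of _ b] ballI impI)
        fix t assume t: "t \<in> T" "b \<le> t"
        have cl: "psi G (1 / t) (w t) \<in> carrier (FR G)" "psi G (1 / t) (approx y t) \<in> carrier (FR G)"
          using D.CG_mem[OF w t(1)] approx_int[OF fst_FR[OF y] t(1)] by auto
        show "FR.d (psi G (1 / t) (w t)) (psi G (1 / t) (approx y t))
          \<le> \<epsilon> / 2 + FR.d (psi G (1 / t) (approx y t)) (word y)"
          using FR.d_triangle[OF cl(1) y cl(2)] bd[OF t(1) s t(2) that]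
          by (simp add: y_def[symmetric] word_FR_normal[OF y] FR.d_sym[of y])
      qed
    qed
    finally show ?thesis
      using \<epsilon> by (simp add: y_def)
  qed
  with b show ?thesis
    using that by blast
qed

text \<open>The limit is represented by a diagonal function: at time \<open>t\<close> it follows the lift of \<open>z (N t)\<close>, with \<open>N\<close> tending
  to infinity so slowly that the rounding errors of the lifts still vanish in the limit.\<close>

lemma eta_cauchy_limit:
  fixes z :: "nat \<Rightarrow> ('g \<times> real) list"
  assumes z: "\<And>n. z n \<in> carrier (FR G)" and cauchy: "cauchy_along UNIV FR.d z"
  obtains l where "l \<in> carrier L" "(\<lambda>n. L.d (eta G \<nu> (z n)) l) \<longlonglongrightarrow> 0"
proof -
  obtain N :: "real \<Rightarrow> nat" where N: "filterlim N at_top at_top"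
    "eventually (\<lambda>t. total_weight (z (N t)) * (real (N t) + 1) \<le> t) at_top"
    using slow_reparametrisation[of "\<lambda>n. total_weight (z n)"] by blast
  define w where "w = (\<lambda>t\<in>T. approx (z (N t)) t)"
  have w_int: "w t \<in> carrier (F_int G)" if "t \<in> T" for t
    using approx_int[OF fst_FR[OF z] that] that by (simp add: w_def)
  have w_FR: "psi G (1 / t) (w t) \<in> carrier (FR G)" if "t \<in> T" for t
    using w_int[OF that] by auto
  have N_along: "filterlim N at_top (along T)"
    by (rule filterlim_mono[OF N(1) order.refl]) auto
  have close: "((\<lambda>t. FR.d (psi G (1 / t) (w t)) (z (N t))) \<longlongrightarrow> 0) (along T)"
  proof (rule tendsto_sandwich[OF _ _ tendsto_const])
    show "eventually (\<lambda>t. 0 \<le> FR.d (psi G (1 / t) (w t)) (z (N t))) (along T)"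
      by (simp add: FR.d_nonneg)
    have "(\<lambda>n. inverse (real (Suc n))) \<longlonglongrightarrow> 0"
      by (rule LIMSEQ_inverse_real_of_nat)
    from filterlim_compose[OF this N_along]
    show "((\<lambda>t. inverse (real (Suc (N t)))) \<longlongrightarrow> 0) (along T)" .
    have "eventually (\<lambda>t. t \<in> T \<and> total_weight (z (N t)) * (real (N t) + 1) \<le> t) (along T)"
      using N(2) by (auto simp: eventually_inf_principal elim: eventually_mono)
    then show "eventually (\<lambda>t. FR.d (psi G (1 / t) (w t)) (z (N t)) \<le> inverse (real (Suc (N t)))) (along T)"
    proof (rule eventually_mono)
      fix t assume t: "t \<in> T \<and> total_weight (z (N t)) * (real (N t) + 1) \<le> t"
      have "FR.d (psi G (1 / t) (w t)) (z (N t)) \<le> total_weight (z (N t)) / t"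
        using d_approx[OF fst_FR[OF z[of "N t"]], of t] t by (simp add: w_def word_FR_normal z)
      also have "\<dots> \<le> inverse (real (Suc (N t)))"
        using t by (simp add: field_simps)
      finally show "FR.d (psi G (1 / t) (w t)) (z (N t)) \<le> inverse (real (Suc (N t)))" .
    qed
  qed
  have "cauchy_along T FR.d (\<lambda>t. z (N t))"
    unfolding cauchy_along_iff[OF cofinal_pos]
  proof (intro allI impI)
    fix \<epsilon> :: real assume "\<epsilon> > 0"
    with cauchy obtain b where b: "\<And>n m. b \<le> n \<Longrightarrow> b \<le> m \<Longrightarrow> FR.d (z n) (z m) < \<epsilon>"
      unfolding cauchy_along_def by blast
    have "eventually (\<lambda>t. b \<le> N t) (along T)"
      using N_along by (auto simp: filterlim_at_top)
    with b show "\<exists>P. eventually P (along T) \<and>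
        (\<forall>t\<in>T. \<forall>t'\<in>T. P t \<longrightarrow> P t' \<longrightarrow> FR.d (z (N t)) (z (N t')) < \<epsilon>)"
      by blast
  qed
  from FR.cauchy_along_close[OF cofinal_pos w_FR z this close]
  have w: "w \<in> carrier D.CG"
    using w_int by (auto simp: D.carrier_CG_iff w_def)
  define l where "l = C.cls (\<pi> w)"
  have l: "l \<in> carrier L"
    using w by (simp add: l_def carrier_L)
  have "(\<lambda>n. L.d (eta G \<nu> (z n)) l) \<longlonglongrightarrow> 0"
  proof (rule LIMSEQ_I)
    fix \<epsilon> :: real assume \<epsilon>: "\<epsilon> > 0"
    then have "\<epsilon> / 2 > 0" by simp
    with cauchy obtain b where b: "\<And>n m. b \<le> n \<Longrightarrow> b \<le> m \<Longrightarrow> FR.d (z n) (z m) < \<epsilon> / 2"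
      unfolding cauchy_along_def by blast
    have "L.d (eta G \<nu> (z n)) l \<le> \<epsilon> / 2" if n: "b \<le> n" for n
    proof -
      note az = approx_D[OF fst_FR[OF z[of n]]]
      have "L.d (eta G \<nu> (z n)) l = C.d (\<pi> (approx (z n))) (\<pi> w)"
        using w path_C[OF fst_FR[OF z[of n]]]
        by (simp add: eta_eq l_def L_d_cls carrier_C \<pi>_approx fst_FR z)
      also have "\<dots> \<le> D.CG.d (approx (z n)) w"
        by (rule C_d_le[OF az w])
      also have "\<dots> \<le> 0 + \<epsilon> / 2 + 0"
      proof (rule tendsto_le[OF along_nontrivial[OF cofinal_pos] _ D.d_CG_tendsto[OF az w]])
        show "((\<lambda>t. FR.d (psi G (1 / t) (approx (z n) t)) (word (z n)) + \<epsilon> / 2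
            + FR.d (psi G (1 / t) (w t)) (z (N t))) \<longlongrightarrow> 0 + \<epsilon> / 2 + 0) (along T)"
          by (intro tendsto_add tendsto_const close approx_tendsto fst_FR z)
        have "eventually (\<lambda>t. t \<in> T \<and> b \<le> N t) (along T)"
          using N_along by (auto simp: filterlim_at_top eventually_inf_principal elim: eventually_mono)
        then show "eventually (\<lambda>t. FR.d (psi G (1 / t) (approx (z n) t)) (psi G (1 / t) (w t))
            \<le> FR.d (psi G (1 / t) (approx (z n) t)) (word (z n)) + \<epsilon> / 2
              + FR.d (psi G (1 / t) (w t)) (z (N t))) (along T)"
        proof (rule eventually_mono)
          fix t assume t: "t \<in> T \<and> b \<le> N t"
          have cl: "psi G (1 / t) (approx (z n) t) \<in> carrier (FR G)" "psi G (1 / t) (w t) \<in> carrier (FR G)"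
            using D.CG_mem[OF w] approx_int[OF fst_FR[OF z[of n]]] t by auto
          show "FR.d (psi G (1 / t) (approx (z n) t)) (psi G (1 / t) (w t))
            \<le> FR.d (psi G (1 / t) (approx (z n) t)) (word (z n)) + \<epsilon> / 2
              + FR.d (psi G (1 / t) (w t)) (z (N t))"
            using FR.d_triangle[OF cl(1) z[of n] cl(2)] FR.d_triangle[OF z[of n] z[of "N t"] cl(2)]
              b[of n "N t"] n t by (simp add: word_FR_normal z FR.d_sym[of "z (N t)"])
        qed
      qed
      finally show ?thesis by simp
    qed
    then show "\<exists>no. \<forall>n\<ge>no. norm (L.d (eta G \<nu> (z n)) l - 0) < \<epsilon>"
      using \<epsilon> L.d_nonneg by (intro exI[of _ b] allI impI) (fastforce simp: le_less_trans)
  qed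
  with l that show ?thesis by blast
qed

end

section \<open>Stable length\<close>

text \<open>Fekete's lemma.\<close>

lemma subadditive_tendsto_Inf:
  fixes a :: "nat \<Rightarrow> real"
  assumes nonneg: "\<And>n. 0 \<le> a n" and sub: "\<And>m n. a (m + n) \<le> a m + a n"
  shows "(\<lambda>n. a n / real n) \<longlonglongrightarrow> (INF n\<in>{1..}. a n / real n)"
proof (rule LIMSEQ_I)
  define l where "l = (INF n\<in>{1..}. a n / real n)"
  have bdd: "bdd_below ((\<lambda>n. a n / real n) ` {1..})"
    using nonneg by (intro bdd_belowI2[where m = 0]) simp
  have l_le: "l \<le> a n / real n" if "n \<ge> 1" for n
    unfolding l_def using bdd that by (intro cINF_lower) auto
  fix \<epsilon> :: real assume \<epsilon>: "\<epsilon> > 0"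
  have "\<exists>m\<in>{1..}. a m / real m < l + \<epsilon> / 2"
    using \<epsilon> cINF_less_iff[OF _ bdd, of "l + \<epsilon> / 2"] unfolding l_def by simp
  then obtain m where m: "m \<ge> 1" "a m / real m < l + \<epsilon> / 2"
    by auto
  have multiple: "a (q * m) \<le> real q * a m" if "q \<ge> 1" for q
    using that
  proof (induction q rule: dec_induct)
    case (step q)
    then show ?case
      using sub[of m "q * m"] by (simp add: algebra_simps)
  qed simp
  \<comment> \<open>the remainder \<open>n mod m\<close> is smaller than \<open>2 * m\<close> with room to spare\<close>
  define B where "B = Max (a ` {..<2 * m})"
  have B: "a r \<le> B" if "r < 2 * m" for r
    unfolding B_def using that by (intro Max_ge) auto
  have "B \<ge> 0"
    using B[of 0] nonneg[of 0] m by simp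
  obtain n0 :: nat where n0: "B / (\<epsilon> / 2) < real n0"
    using reals_Archimedean2 by blast
  show "\<exists>no. \<forall>n\<ge>no. norm (a n / real n - (INF n\<in>{1..}. a n / real n)) < \<epsilon>"
  proof (intro exI allI impI)
    fix n assume n: "n \<ge> max n0 (2 * m)"
    define q where "q = n div m"
    define r where "r = n mod m"
    have qr: "n = q * m + r" "r < 2 * m"
      using m by (auto simp: q_def r_def less_le_trans[of _ m])
    have "q \<ge> 1"
      using n m by (simp add: q_def div_greater_zero_iff Suc_le_eq)
    have "n \<ge> 1"
      using n m by auto
    have "a n \<le> real q * a m + B"
      using sub[of "q * m" r] multiple[OF \<open>q \<ge> 1\<close>] B[OF qr(2)] by (simp add: qr(1)[symmetric])
    also have "real q * a m = (real q * real m) * (a m / real m)"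
      using m by simp
    also have "\<dots> \<le> real n * (a m / real m)"
      using nonneg[of m] by (intro mult_right_mono) (auto simp: qr(1))
    finally have "a n / real n \<le> a m / real m + B / real n"
      using \<open>n \<ge> 1\<close> by (simp add: field_simps)
    also have "B / real n < \<epsilon> / 2"
    proof -
      have "B < \<epsilon> / 2 * real n0"
        using n0 \<epsilon> by (simp add: field_simps)
      also have "\<dots> \<le> \<epsilon> / 2 * real n"
        using n \<epsilon> by simp
      finally show ?thesis
        using \<open>n \<ge> 1\<close> by (simp add: field_simps)
    qed
    finally have "a n / real n < l + \<epsilon>"
      using m by simp
    with l_le[OF \<open>n \<ge> 1\<close>] show "norm (a n / real n - (INF n\<in>{1..}. a n / real n)) < \<epsilon>"
      by (simp add: l_def)
  qed
qed

context pseudonormed_group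
begin

abbreviation "\<tau> \<equiv> stable_length K \<nu>"

lemma stable_length_Inf:
  assumes g: "g \<in> carrier K"
  shows "(\<lambda>n. \<nu> (g [^] n) / real n) \<longlonglongrightarrow> \<tau> g" and "\<tau> g = (INF n\<in>{1..}. \<nu> (g [^] (n::nat)) / real n)"
proof -
  have lim: "(\<lambda>n. \<nu> (g [^] n) / real n) \<longlonglongrightarrow> (INF n\<in>{1..}. \<nu> (g [^] (n::nat)) / real n)"
  proof (rule subadditive_tendsto_Inf)
    show "\<nu> (g [^] (m + n)) \<le> \<nu> (g [^] m) + \<nu> (g [^] n)" for m n :: nat
      using norm_mult[of "g [^] m" "g [^] n"] g by (simp add: nat_pow_mult)
  qed (use g in \<open>auto intro: norm_nonneg\<close>)
  from limI[OF this] show "\<tau> g = (INF n\<in>{1..}. \<nu> (g [^] (n::nat)) / real n)"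
    by (simp add: stable_length_def)
  with lim show "(\<lambda>n. \<nu> (g [^] n) / real n) \<longlonglongrightarrow> \<tau> g"
    by simp
qed

lemma stable_length_le:
  assumes g: "g \<in> carrier K" shows "real n * \<tau> g \<le> \<nu> (g [^] n)"
proof (cases "n = 0")
  case False
  have "bdd_below ((\<lambda>n. \<nu> (g [^] (n::nat)) / real n) ` {1..})"
    using g by (intro bdd_belowI2[where m = 0]) (simp add: norm_nonneg)
  then have "\<tau> g \<le> \<nu> (g [^] n) / real n"
    unfolding stable_length_Inf(2)[OF g] using False by (intro cINF_lower) auto
  then show ?thesis
    using False by (simp add: field_simps)
qed simp

lemma stable_length_nonneg: "g \<in> carrier K \<Longrightarrow> 0 \<le> \<tau> g"
  by (rule LIMSEQ_le_const[OF stable_length_Inf(1)]) (auto simp: norm_nonneg)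

lemma stable_length_approx:
  assumes g: "g \<in> carrier K" and "\<tau> g < c"
  obtains n :: nat where "n \<ge> 1" "\<nu> (g [^] n) / real n < c"
proof -
  have bdd: "bdd_below ((\<lambda>n. \<nu> (g [^] (n::nat)) / real n) ` {1..})"
    using g by (intro bdd_belowI2[where m = 0]) (simp add: norm_nonneg)
  then show ?thesis
    using assms(2) that cINF_less_iff[OF _ bdd] unfolding stable_length_Inf(2)[OF g] by auto
qed

lemma stable_length_int_le:
  "g \<in> carrier K \<Longrightarrow> \<bar>real_of_int n\<bar> * \<tau> g \<le> \<nu> (g [^] n)"
  using stable_length_le[of g "nat \<bar>n\<bar>"] by (simp add: norm_int_pow[of g n])

text \<open>The limit is independent of the rounding because \<open>\<bar>\<lfloor>r * t\<rfloor>\<bar> / t\<close> tends to \<open>\<bar>r\<bar>\<close>; negative exponents have the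
  same norms as positive ones.\<close>

lemma stable_length_floor:
  assumes g: "g \<in> carrier K"
  shows "((\<lambda>t. \<nu> (g [^] \<lfloor>r * t\<rfloor>) / t) \<longlongrightarrow> \<bar>r\<bar> * \<tau> g) at_top"
proof (cases "r = 0")
  case True
  then show ?thesis by simp
next
  case False
  define k where "k t = nat \<bar>\<lfloor>r * t\<rfloor>\<bar>" for t
  have k_near: "\<bar>real (k t) - \<bar>r\<bar> * t\<bar> \<le> 1" if "t > 0" for t
  proof -
    have "\<bar>real_of_int \<lfloor>r * t\<rfloor> - r * t\<bar> \<le> 1"
      by linarith
    moreover have "\<bar>r\<bar> * t = \<bar>r * t\<bar>"
      using that by (simp add: abs_mult)
    moreover have "real (k t) = \<bar>real_of_int \<lfloor>r * t\<rfloor>\<bar>"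
      by (simp add: k_def)
    ultimately show ?thesis
      using abs_triangle_ineq3[of "real_of_int \<lfloor>r * t\<rfloor>" "r * t"] by linarith
  qed
  have rt: "filterlim (\<lambda>t. \<bar>r\<bar> * t) at_top at_top"
    using False by (intro filterlim_tendsto_pos_mult_at_top[OF tendsto_const _ filterlim_ident]) simp
  have k_top: "filterlim k at_top at_top"
  proof -
    have "filterlim (\<lambda>t. real (k t)) at_top at_top"
    proof (rule filterlim_at_top_mono)
      show "filterlim (\<lambda>t. - 1 + \<bar>r\<bar> * t) at_top at_top"
        by (rule filterlim_tendsto_add_at_top[OF tendsto_const rt])
      show "eventually (\<lambda>t. - 1 + \<bar>r\<bar> * t \<le> real (k t)) at_top"
        using eventually_gt_at_top[of 0]
      proof eventually_elim
        case (elim t)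
        then show ?case using k_near[of t] by linarith
      qed
    qed
    then show ?thesis
      by (simp add: filterlim_sequentially_iff_filterlim_real)
  qed
  have ratio: "((\<lambda>t. real (k t) / t) \<longlongrightarrow> \<bar>r\<bar>) at_top"
  proof (rule Lim_transform)
    have "((\<lambda>t::real. 1 / t) \<longlongrightarrow> 0) at_top"
      by (rule tendsto_divide_0[OF tendsto_const filterlim_at_top_imp_at_infinity[OF filterlim_ident]])
    moreover have "eventually (\<lambda>t. norm (real (k t) / t - \<bar>r\<bar>) \<le> 1 / t) at_top"
      using eventually_gt_at_top[of 0]
    proof eventually_elim
      case (elim t)
      have "real (k t) / t - \<bar>r\<bar> = (real (k t) - \<bar>r\<bar> * t) / t"
        using elim by (simp add: field_simps)
      then show ?case
        using k_near[OF elim] elim by (simp add: divide_right_mono)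
    qed
    ultimately show "((\<lambda>t. real (k t) / t - \<bar>r\<bar>) \<longlongrightarrow> 0) at_top"
      by (rule Lim_null_comparison[rotated])
  qed simp
  have "((\<lambda>t. (real (k t) / t) * (\<nu> (g [^] k t) / real (k t))) \<longlongrightarrow> \<bar>r\<bar> * \<tau> g) at_top"
    using filterlim_compose[OF stable_length_Inf(1)[OF g] k_top] by (intro tendsto_mult ratio)
  then show ?thesis
  proof (rule Lim_transform_eventually)
    have "eventually (\<lambda>t. k t \<ge> 1) at_top"
      using k_top unfolding filterlim_at_top by blast
    then show "eventually (\<lambda>t. (real (k t) / t) * (\<nu> (g [^] k t) / real (k t)) = \<nu> (g [^] \<lfloor>r * t\<rfloor>) / t) at_top"
    proof eventually_elim
      case (elim t)
      have "\<nu> (g [^] \<lfloor>r * t\<rfloor>) = \<nu> (g [^] k t)"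
        using norm_int_pow[OF g, of "\<lfloor>r * t\<rfloor>"] by (simp add: k_def)
      with elim show ?case
        by simp
    qed
  qed
qed

end

section \<open>Conjugation-invariant word norms\<close>

locale conj_generated = group G for G (structure) +
  fixes S :: "'a set"
  assumes S: "S \<subseteq> carrier G"
    and generates: "g \<in> carrier G \<Longrightarrow> \<exists>xs. set xs \<subseteq> S \<union> m_inv G ` S \<and> g = list_mult G xs"
begin

definition gens where "gens = {h \<otimes> s \<otimes> inv h | h s. h \<in> carrier G \<and> s \<in> S \<union> m_inv G ` S}"

abbreviation "\<nu> \<equiv> conj_word_norm G S"

lemma gens_closed: "gens \<subseteq> carrier G"
  using S by (auto simp: gens_def)

lemma gens_conj: assumes "x \<in> gens" "k \<in> carrier G" shows "k \<otimes> x \<otimes> inv k \<in> gens"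
proof -
  obtain h s where x: "x = h \<otimes> s \<otimes> inv h" "h \<in> carrier G" "s \<in> S \<union> m_inv G ` S"
    using assms(1) by (auto simp: gens_def)
  then have "k \<otimes> x \<otimes> inv k = (k \<otimes> h) \<otimes> s \<otimes> inv (k \<otimes> h)"
    using S assms(2) by (auto simp: group_normalize)
  then show ?thesis
    using x assms(2) unfolding gens_def by blast
qed

lemma gens_inv: assumes "x \<in> gens" shows "inv x \<in> gens"
proof -
  obtain h s where x: "x = h \<otimes> s \<otimes> inv h" "h \<in> carrier G" "s \<in> S \<union> m_inv G ` S"
    using assms(1) by (auto simp: gens_def)
  then have "inv x = h \<otimes> inv s \<otimes> inv h"
    using S by (auto simp: group_normalize)
  moreover have "inv s \<in> S \<union> m_inv G ` S"
    using x(3) S by (auto simp: subset_iff)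
  ultimately show ?thesis
    using x unfolding gens_def by blast
qed

lemma word_norm_exists:
  assumes "g \<in> carrier G"
  shows "\<exists>cs. length cs = (LEAST n. \<exists>cs. length cs = n \<and> set cs \<subseteq> gens \<and> g = list_mult G cs)
    \<and> set cs \<subseteq> gens \<and> g = list_mult G cs"
proof -
  obtain xs where xs: "set xs \<subseteq> S \<union> m_inv G ` S" "g = list_mult G xs"
    using generates[OF assms] by blast
  have "set xs \<subseteq> gens"
  proof
    fix x assume "x \<in> set xs"
    then have x: "x \<in> S \<union> m_inv G ` S"
      using xs(1) by blast
    then have "x \<in> carrier G"
      using S by auto
    then have "x = \<one> \<otimes> x \<otimes> inv \<one>"
      by simp
    with x show "x \<in> gens"
      unfolding gens_def by blast
  qed
  with xs have "\<exists>n cs. length cs = n \<and> set cs \<subseteq> gens \<and> g = list_mult G cs"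
    by blast
  then show ?thesis
    by (rule LeastI_ex)
qed

lemma word_norm_eq: "\<nu> g = real (LEAST n. \<exists>cs. length cs = n \<and> set cs \<subseteq> gens \<and> g = list_mult G cs)"
  unfolding conj_word_norm_def gens_def ..

lemma word_norm_factorisation:
  assumes "g \<in> carrier G"
  obtains cs where "\<nu> g = real (length cs)" "set cs \<subseteq> gens" "g = list_mult G cs"
  using word_norm_exists[OF assms] that unfolding word_norm_eq by metis

lemma word_norm_le:
  assumes "set cs \<subseteq> gens" shows "\<nu> (list_mult G cs) \<le> real (length cs)"
  unfolding word_norm_eq using assms by (auto intro: Least_le)

lemma pseudonormed_word_norm: "pseudonormed_group G \<nu>"
proof (unfold_locales, unfold conj_inv_pseudonorm_def, intro conjI ballI)
  show "\<nu> \<one> = 0"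
    using word_norm_le[of "[]"] by (simp add: word_norm_eq)
  have map_closed: "set cs \<subseteq> carrier G" if "set cs \<subseteq> gens" for cs
    using that gens_closed by blast
  have inv_le: "\<nu> (inv g) \<le> \<nu> g" if "g \<in> carrier G" for g
  proof -
    obtain cs where cs: "\<nu> g = real (length cs)" "set cs \<subseteq> gens" "g = list_mult G cs"
      using word_norm_factorisation \<open>g \<in> carrier G\<close> by blast
    have "inv (list_mult G xs) = list_mult G (rev (map (m_inv G) xs))" if "set xs \<subseteq> carrier G" for xs
      using that
    proof (induction xs)
      case (Cons x xs)
      have "set (rev (map (m_inv G) xs)) \<subseteq> carrier G"
        using Cons.prems by auto
      with Cons show ?case
        by (simp add: inv_mult_group list_mult_append)
    qed simp
    then have "inv g = list_mult G (rev (map (m_inv G) cs))"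
      using cs map_closed by blast
    moreover have "set (rev (map (m_inv G) cs)) \<subseteq> gens"
      using cs(2) gens_inv by auto
    ultimately show ?thesis
      using word_norm_le[of "rev (map (m_inv G) cs)"] cs(1) by simp
  qed
  show "\<nu> (inv g) = \<nu> g" if "g \<in> carrier G" for g
    using inv_le[of g] inv_le[of "inv g"] that by simp
  show "\<nu> (g \<otimes> h) \<le> \<nu> g + \<nu> h" if g: "g \<in> carrier G" and h: "h \<in> carrier G" for g h
  proof -
    obtain cs where cs: "\<nu> g = real (length cs)" "set cs \<subseteq> gens" "g = list_mult G cs"
      using word_norm_factorisation[OF g] by blast
    obtain ds where ds: "\<nu> h = real (length ds)" "set ds \<subseteq> gens" "h = list_mult G ds"
      using word_norm_factorisation[OF h] by blast
    have "g \<otimes> h = list_mult G (cs @ ds)"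
      using cs ds map_closed by (simp add: list_mult_append)
    then show ?thesis
      using word_norm_le[of "cs @ ds"] cs ds by simp
  qed
  have conj_le: "\<nu> (h \<otimes> g \<otimes> inv h) \<le> \<nu> g" if g: "g \<in> carrier G" and h: "h \<in> carrier G" for g h
  proof -
    obtain cs where cs: "\<nu> g = real (length cs)" "set cs \<subseteq> gens" "g = list_mult G cs"
      using word_norm_factorisation[OF g] by blast
    have "h \<otimes> list_mult G xs \<otimes> inv h = list_mult G (map (\<lambda>x. h \<otimes> x \<otimes> inv h) xs)"
      if "set xs \<subseteq> carrier G" for xs
      using that
    proof (induction xs)
      case (Cons x xs)
      have "h \<otimes> list_mult G (x # xs) \<otimes> inv h = (h \<otimes> x \<otimes> inv h) \<otimes> (h \<otimes> list_mult G xs \<otimes> inv h)"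
        using Cons.prems h by (simp add: group_normalize list_mult_closed)
      with Cons show ?case
        by simp
    qed (use h in simp)
    then have "h \<otimes> g \<otimes> inv h = list_mult G (map (\<lambda>x. h \<otimes> x \<otimes> inv h) cs)"
      using cs map_closed by blast
    moreover have "set (map (\<lambda>x. h \<otimes> x \<otimes> inv h) cs) \<subseteq> gens"
      using cs(2) gens_conj[OF _ h] by auto
    ultimately show ?thesis
      using word_norm_le[of "map (\<lambda>x. h \<otimes> x \<otimes> inv h) cs"] cs(1) by simp
  qed
  show "\<nu> (h \<otimes> g \<otimes> inv h) = \<nu> g" if "g \<in> carrier G" "h \<in> carrier G" for g h
    using conj_le[of g h] conj_le[of "h \<otimes> g \<otimes> inv h" "inv h"] that by (simp add: group_normalize)
qed (simp add: word_norm_eq)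

end

section \<open>Free groups\<close>

definition winv :: "('a \<times> bool) list \<Rightarrow> ('a \<times> bool) list" where
  "winv w = rev (map letter_inv w)"

lemma winv_simps [simp]:
  "winv [] = []" "winv (x # w) = winv w @ [letter_inv x]" "winv (u @ v) = winv v @ winv u"
  "winv (winv w) = w" "length (winv w) = length w" "winv w = [] \<longleftrightarrow> w = []"
  by (simp_all add: winv_def rev_map comp_def)

lemma fst_set_winv [simp]: "fst ` set (winv w) = fst ` set w"
  by (simp add: winv_def image_image)

lemma reduced_append_iff:
  "reduced (u @ v) \<longleftrightarrow> reduced u \<and> reduced v \<and> (u = [] \<or> v = [] \<or> hd v \<noteq> letter_inv (last u))"
  unfolding reduced_def by (simp add: successively_append_iff)

lemma reduced_Cons_iff: "reduced (x # v) \<longleftrightarrow> reduced v \<and> (v = [] \<or> hd v \<noteq> letter_inv x)"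
  using reduced_append_iff[of "[x]" v] by (auto simp: reduced_def)

lemma reduced_Nil [simp]: "reduced []"
  by (simp add: reduced_def)

lemma reduced_winv: "reduced u \<Longrightarrow> reduced (winv u)"
proof (induction u)
  case (Cons x u)
  moreover have "last (winv u) = letter_inv (hd u)" if "u \<noteq> []"
    using that by (cases u) auto
  moreover have "letter_inv x \<noteq> letter_inv y" if "x \<noteq> y" for y
    using that by (metis letter_inv_letter_inv)
  ultimately show ?case
    by (auto simp: reduced_append_iff reduced_Cons_iff)
qed simp

lemma push_letters_reduced: "reduced (u @ v) \<Longrightarrow> foldr push_letter u v = u @ v"
  by (induction u) (auto simp: push_letter_reduced reduced_Cons_iff)

lemma push_letters_winv: "reduced u \<Longrightarrow> foldr push_letter (winv u) u = []"
  by (induction u) (auto simp: push_letter_def reduced_Cons_iff)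

text \<open>In a product of reduced words the cancelling part \<open>c\<close> is a suffix of the first and, inverted, a prefix of the
  second factor; nothing else happens.\<close>

lemma push_letters_cancellation:
  assumes "reduced u" "reduced v"
  shows "\<exists>u' c v'. u = u' @ c \<and> v = winv c @ v' \<and> foldr push_letter u v = u' @ v'"
  using assms(1)
proof (induction u)
  case Nil
  then show ?case
    by (intro exI[of _ "[]"] exI[of _ v]) simp
next
  case (Cons x u)
  then obtain u' c v' where u: "u = u' @ c" "v = winv c @ v'" "foldr push_letter u v = u' @ v'"
    by (auto simp: reduced_Cons_iff)
  show ?case
  proof (cases "u' = [] \<and> v' \<noteq> [] \<and> hd v' = letter_inv x")
    case True
    then obtain v'' where "v' = letter_inv x # v''"
      by (cases v') auto
    moreover have "push_letter x (letter_inv x # v'') = v''"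
      by (simp add: push_letter_def)
    ultimately show ?thesis
      using True u by (intro exI[of _ "[]"] exI[of _ "x # c"] exI[of _ v'']) simp
  next
    case False
    have "push_letter x (u' @ v') = x # u' @ v'"
    proof -
      have "u' @ v' = [] \<or> hd (u' @ v') \<noteq> letter_inv x"
        using False Cons.prems u(1) by (cases u') (auto simp: reduced_Cons_iff)
      then show ?thesis
        by (cases "u' @ v'") (auto simp: push_letter_def)
    qed
    then show ?thesis
      using u by (intro exI[of _ "x # u'"] exI[of _ c] exI[of _ v']) simp
  qed
qed

abbreviation power_word :: "'b list \<Rightarrow> nat \<Rightarrow> 'b list" where
  "power_word w n \<equiv> concat (replicate n w)"

lemma power_word_commute: "w @ power_word w n = power_word w n @ w"
  by (induction n) auto

lemma power_word_Suc': "power_word w (Suc n) = power_word w n @ w"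
  using power_word_commute[of w n] by simp

lemma length_power_word [simp]: "length (power_word w n) = n * length w"
  by (induction n) auto

lemma hd_power_word: "n > 0 \<Longrightarrow> hd (power_word w n) = hd w"
  by (induction n) (auto simp: hd_append)

lemma last_power_word: "n > 0 \<Longrightarrow> last (power_word w n) = last w"
  by (cases n; cases "w = []") (auto simp: power_word_Suc' power_word_commute)

lemma set_power_word: "set (power_word w n) \<subseteq> set w"
  by (induction n) auto

lemma winv_power_word: "winv (power_word w n) = power_word (winv w) n"
  by (induction n) (simp_all add: power_word_commute)

lemma reduced_power_word:
  assumes "cyclically_reduced c" shows "reduced (power_word c n)"
proof (induction n)
  case (Suc n)
  then show ?case
    using assms hd_power_word[of n c]
    by (cases n) (auto simp: reduced_append_iff cyclically_reduced_def)
qed simp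

lemma cyclic_reduction:
  "reduced h \<Longrightarrow> \<exists>u c. h = u @ c @ winv u \<and> cyclically_reduced c"
proof (induction "length h" arbitrary: h rule: less_induct)
  case less
  show ?case
  proof (cases "cyclically_reduced h")
    case True
    then show ?thesis
      by (intro exI[of _ "[]"] exI[of _ h]) simp
  next
    case False
    then have h: "h \<noteq> []" "hd h = letter_inv (last h)"
      using less.prems by (auto simp: cyclically_reduced_def)
    then obtain x t where t: "h = x # t"
      by (cases h) auto
    have "t \<noteq> []"
      using h t by auto
    then obtain m y where m: "t = m @ [y]"
      by (cases t rule: rev_cases) auto
    have "x = letter_inv y"
      using h t m by simp
    have "reduced m"
      using less.prems t m by (simp add: reduced_append_iff reduced_Cons_iff)
    then obtain u c where "m = u @ c @ winv u" "cyclically_reduced c"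
      using less.hyps[of m] t m by auto
    then show ?thesis
      using \<open>x = letter_inv y\<close> t m
      by (intro exI[of _ "x # u"] exI[of _ c]) simp
  qed
qed

lemma (in group) conj_nat_pow:
  assumes "u \<in> carrier G" "c \<in> carrier G"
  shows "(u \<otimes> c \<otimes> inv u) [^] (n::nat) = u \<otimes> c [^] n \<otimes> inv u"
proof (induction n)
  case (Suc n)
  then show ?case
    using assms by (simp add: group_normalize)
qed (use assms in simp)

lemma (in group) conj_int_pow:
  assumes "u \<in> carrier G" "c \<in> carrier G"
  shows "(u \<otimes> c \<otimes> inv u) [^] (n::int) = u \<otimes> c [^] n \<otimes> inv u"
proof (cases n rule: int_cases2)
  case (nonneg k)
  then show ?thesis
    using assms by (simp add: int_pow_int conj_nat_pow)
next
  case (nonpos k)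
  then show ?thesis
    using assms by (simp add: int_pow_neg int_pow_int conj_nat_pow) (simp add: group_normalize)
qed

lemma (in group) pure_conj:
  assumes "pure_elem G g" "k \<in> carrier G"
  shows "pure_elem G (k \<otimes> g \<otimes> inv k)"
  unfolding pure_elem_def
proof (intro conjI ballI allI impI)
  have g: "g \<in> carrier G"
    using assms(1) by (simp add: pure_elem_def)
  then show "k \<otimes> g \<otimes> inv k \<in> carrier G"
    using assms(2) by simp
  fix h and n :: int assume h: "h \<in> carrier G" and eq: "k \<otimes> g \<otimes> inv k = h [^] n"
  define h' where "h' = inv k \<otimes> h \<otimes> inv (inv k)"
  have h': "h' \<in> carrier G" "h = k \<otimes> h' \<otimes> inv k"
    using h assms(2) by (simp_all add: h'_def group_normalize)
  have "g = inv k \<otimes> (k \<otimes> g \<otimes> inv k) \<otimes> inv (inv k)"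
    using g assms(2) by (simp add: group_normalize)
  also have "\<dots> = h' [^] n"
    unfolding eq h'_def using h assms(2) by (simp only: conj_int_pow[symmetric] inv_closed)
  finally have "(h' = g \<or> h' = inv g) \<and> (n = 1 \<or> n = - 1)"
    using assms(1) h'(1) unfolding pure_elem_def by blast
  then show "h = k \<otimes> g \<otimes> inv k \<or> h = inv (k \<otimes> g \<otimes> inv k)" "n = 1 \<or> n = - 1"
    unfolding h'(2) using g assms(2) by (auto simp: group_normalize)
qed

lemma (in group) pure_inv:
  assumes "pure_elem G g" shows "pure_elem G (inv g)"
  unfolding pure_elem_def
proof (intro conjI ballI allI impI)
  have g: "g \<in> carrier G"
    using assms(1) by (simp add: pure_elem_def)
  then show "inv g \<in> carrier G"
    by simp
  fix h and n :: int assume h: "h \<in> carrier G" and eq: "inv g = h [^] n"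
  then have "g = h [^] (- n)"
    using g by (metis int_pow_neg inv_inv)
  then have "(h = g \<or> h = inv g) \<and> (- n = 1 \<or> - n = - 1)"
    using assms(1) h unfolding pure_elem_def by blast
  then show "h = inv g \<or> h = inv (inv g)" "n = 1 \<or> n = - 1"
    using g by auto
qed

locale free_group_on =
  fixes A :: "'a set"
begin

abbreviation "F \<equiv> free_group A"

sublocale F: group "free_group A"
  by (rule group_free_group)

lemma carrier_F: "w \<in> carrier F \<longleftrightarrow> fst ` set w \<subseteq> A \<and> reduced w"
  and mult_F: "u \<otimes>\<^bsub>F\<^esub> v = foldr push_letter u v" and one_F: "\<one>\<^bsub>F\<^esub> = []"
  by (simp_all add: free_group_def)

lemma winv_closed: "w \<in> carrier F \<Longrightarrow> winv w \<in> carrier F"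
  by (simp add: carrier_F reduced_winv)

lemma inv_F: "w \<in> carrier F \<Longrightarrow> inv\<^bsub>F\<^esub> w = winv w"
  by (rule F.inv_equality) (auto simp: mult_F one_F push_letters_winv winv_closed carrier_F reduced_winv)

lemma mult_append: "reduced (u @ v) \<Longrightarrow> u \<otimes>\<^bsub>F\<^esub> v = u @ v"
  by (simp add: mult_F push_letters_reduced)

lemma append_mult:
  assumes "u @ v \<in> carrier F"
  shows "u \<in> carrier F" "v \<in> carrier F" "u \<otimes>\<^bsub>F\<^esub> v = u @ v"
  using assms by (auto simp: carrier_F reduced_append_iff mult_append)

lemma pow_F:
  assumes "reduced (power_word z n)" "z \<in> carrier F" shows "z [^]\<^bsub>F\<^esub> n = power_word z n"
  using assms(1)
proof (induction n)
  case (Suc n)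
  have red: "reduced (power_word z n @ z)"
    using Suc.prems by (simp only: power_word_Suc')
  then have "z [^]\<^bsub>F\<^esub> n = power_word z n"
    using Suc.IH by (simp add: reduced_append_iff)
  then show ?case
    using red by (simp add: mult_append power_word_commute)
qed (simp add: one_F)

text \<open>All powers of \<open>u c u\<^sup>-\<^sup>1\<close> with \<open>c\<close> cyclically reduced are visibly reduced. In particular lengths of powers grow.\<close>

lemma pow_decomposition:
  assumes h: "h \<in> carrier F" "h \<noteq> []"
  obtains u c where "h = u @ c @ winv u" "cyclically_reduced c" "c \<noteq> []"
    "\<And>n. n \<ge> 1 \<Longrightarrow> h [^]\<^bsub>F\<^esub> n = u @ power_word c n @ winv u"
proof -
  have red: "reduced h"
    using h by (simp add: carrier_F)
  obtain u c where uc: "h = u @ c @ winv u" "cyclically_reduced c"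
    using cyclic_reduction[OF red] by blast
  have "c \<noteq> []"
  proof
    assume "c = []"
    then have "u \<noteq> []" "reduced (u @ winv u)"
      using uc h red by auto
    moreover have "hd (winv u) = letter_inv (last u)" if "u \<noteq> []"
      using that by (cases u rule: rev_cases) auto
    ultimately show False
      by (auto simp: reduced_append_iff)
  qed
  have cl: "u \<in> carrier F" "c \<in> carrier F"
    using h by (auto simp: uc carrier_F reduced_append_iff)
  have "h [^]\<^bsub>F\<^esub> n = u @ power_word c n @ winv u" if "n \<ge> 1" for n
  proof -
    have red_n: "reduced (u @ power_word c n @ winv u)"
      using red \<open>c \<noteq> []\<close> that reduced_power_word[OF uc(2), of n] hd_power_word[of n c] last_power_word[of n c]
      by (auto simp: uc(1) reduced_append_iff)
    have "h = u \<otimes>\<^bsub>F\<^esub> c \<otimes>\<^bsub>F\<^esub> inv\<^bsub>F\<^esub> u"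
      using h(1) append_mult[of u "c @ winv u"] append_mult[of c "winv u"] cl
      by (simp add: uc(1) inv_F winv_closed F.m_assoc)
    then have "h [^]\<^bsub>F\<^esub> n = u \<otimes>\<^bsub>F\<^esub> (c [^]\<^bsub>F\<^esub> n) \<otimes>\<^bsub>F\<^esub> inv\<^bsub>F\<^esub> u"
      using cl by (simp add: F.conj_nat_pow)
    also have "c [^]\<^bsub>F\<^esub> n = power_word c n"
      using reduced_power_word[OF uc(2)] cl by (simp add: pow_F)
    also have "fst ` set (power_word c n) \<subseteq> A"
      by (rule order_trans[OF image_mono[OF set_power_word]]) (use cl in \<open>simp add: carrier_F\<close>)
    then have pc: "power_word c n \<in> carrier F"
      using reduced_power_word[OF uc(2), of n] unfolding carrier_F by blast
    then have "u \<otimes>\<^bsub>F\<^esub> power_word c n \<otimes>\<^bsub>F\<^esub> inv\<^bsub>F\<^esub> u = u @ power_word c n @ winv u"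
      using cl red_n mult_append[of "power_word c n" "winv u"] mult_append[of u "power_word c n @ winv u"]
      by (simp add: F.m_assoc inv_F winv_closed) (simp add: reduced_append_iff)
    finally show ?thesis .
  qed
  with uc \<open>c \<noteq> []\<close> that show ?thesis by blast
qed

lemma length_pow_ge:
  assumes h: "h \<in> carrier F" "h \<noteq> []" shows "length (h [^]\<^bsub>F\<^esub> n) \<ge> n"
proof (cases "n = 0")
  case False
  obtain u c where "h = u @ c @ winv u" "cyclically_reduced c" and c: "c \<noteq> []"
    and pow: "\<And>n. n \<ge> 1 \<Longrightarrow> h [^]\<^bsub>F\<^esub> n = u @ power_word c n @ winv u"
    using pow_decomposition[OF h] by blast
  have "n \<le> n * length c"
    using c by (cases c) auto
  moreover have "length (h [^]\<^bsub>F\<^esub> n) = length u + (n * length c + length u)"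
    using False pow[of n] by simp
  ultimately show ?thesis
    by linarith
qed simp

lemma torsion_free:
  assumes "h \<in> carrier F" "h [^]\<^bsub>F\<^esub> (n::nat) = []" "n \<ge> 1" shows "h = []"
  using length_pow_ge[OF assms(1), of n] assms(2,3) by fastforce

text \<open>Lengths of powers bound the exponents with which \<open>g\<close> is a power. A root for the largest exponent is not a proper
  power, since otherwise the exponent could be increased.\<close>

lemma root_exists:
  assumes g: "g \<in> carrier F" "g \<noteq> []"
  obtains h n where "pure_elem F h" "g = h [^]\<^bsub>F\<^esub> (n::nat)" "n \<ge> 1"
proof -
  define P where "P n \<longleftrightarrow> (\<exists>h\<in>carrier F. g = h [^]\<^bsub>F\<^esub> n)" for n :: nat
  have bound: "n \<le> length g" if Pn: "P n" for n
  proof -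
    obtain h where h: "h \<in> carrier F" "g = h [^]\<^bsub>F\<^esub> n"
      using Pn by (auto simp: P_def)
    have "h \<noteq> []"
      using g h F.nat_pow_one[of n] by (auto simp: one_F)
    then show ?thesis
      using length_pow_ge[OF h(1)] h(2) by simp
  qed
  have "P 1"
    using g by (auto simp: P_def)
  define n where "n = (GREATEST n. P n)"
  have n: "P n" and max: "\<And>m. P m \<Longrightarrow> m \<le> n"
    unfolding n_def using GreatestI_nat[of P 1 "length g"] Greatest_le_nat[of P _ "length g"] \<open>P 1\<close> bound
    by blast+
  have "n \<ge> 1"
    using max \<open>P 1\<close> by blast
  obtain h where h: "h \<in> carrier F" "g = h [^]\<^bsub>F\<^esub> n"
    using n by (auto simp: P_def)
  have "pure_elem F h"
    unfolding pure_elem_def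
  proof (intro conjI ballI allI impI h(1))
    fix k and m :: int assume k: "k \<in> carrier F" and eq: "h = k [^]\<^bsub>F\<^esub> m"
    define q where "q = nat \<bar>m\<bar>"
    obtain k' where k': "k' \<in> carrier F" "h = k' [^]\<^bsub>F\<^esub> q" "k' = k \<or> k' = inv\<^bsub>F\<^esub> k"
    proof (cases "m < 0")
      case True
      then have "m = - int q"
        by (simp add: q_def)
      then have "h = inv\<^bsub>F\<^esub> (k [^]\<^bsub>F\<^esub> q)"
        using eq k F.int_pow_neg_int by metis
      then show ?thesis
        using k that[of "inv\<^bsub>F\<^esub> k"] by (simp add: F.nat_pow_inv)
    next
      case False
      then have "m = int q"
        by (simp add: q_def)
      then have "h = k [^]\<^bsub>F\<^esub> q"
        using eq by (metis int_pow_int)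
      then show ?thesis
        using k that[of k] by simp
    qed
    have "g = k' [^]\<^bsub>F\<^esub> (q * n)"
      using h(2) k'(1,2) by (simp add: F.nat_pow_pow)
    then have "P (q * n)"
      using k'(1) unfolding P_def by blast
    then have "q * n \<le> 1 * n"
      using max by simp
    then have "q \<le> 1"
      using \<open>n \<ge> 1\<close> by simp
    moreover have "q \<noteq> 0"
    proof
      assume "q = 0"
      then show False
        using k'(2) h(2) g(2) by (simp add: one_F[symmetric])
    qed
    ultimately have q: "q = 1"
      by linarith
    then show "m = 1 \<or> m = - 1"
      by (simp add: q_def) linarith
    show "k = h \<or> k = inv\<^bsub>F\<^esub> h"
      using k' q k by auto
  qed
  with h(2) \<open>n \<ge> 1\<close> that show ?thesis by blast
qed

lemma pure_not_Nil: assumes "pure_elem F \<theta>" shows "\<theta> \<noteq> []"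
proof
  assume "\<theta> = []"
  then have "\<theta> = \<one>\<^bsub>F\<^esub> [^]\<^bsub>F\<^esub> (0::int)"
    by (simp add: one_F)
  then have "(0::int) = 1 \<or> (0::int) = - 1"
    using assms F.one_closed unfolding pure_elem_def by blast
  then show False by simp
qed

lemma pure_power_word:
  assumes pure: "pure_elem F (power_word z n)" shows "n = 1"
proof -
  have F: "power_word z n \<in> carrier F"
    using pure by (simp add: pure_elem_def)
  have "power_word z n \<noteq> []"
    using pure by (rule pure_not_Nil)
  then obtain k where k: "n = Suc k"
    by (cases n) auto
  have "z \<in> carrier F"
    using F append_mult(1)[of z "power_word z k"] by (simp add: k)
  moreover from this have "power_word z n = z [^]\<^bsub>F\<^esub> (int n)"
    using F by (simp add: int_pow_int pow_F carrier_F)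
  ultimately have "int n = 1 \<or> int n = - 1"
    using pure unfolding pure_elem_def by metis
  then show ?thesis by simp
qed

text \<open>Commuting lists are powers of a common list.\<close>

lemma pure_commuting_eq:
  assumes "pure_elem F u" "pure_elem F v" "u @ v = v @ u" shows "u = v"
proof -
  obtain m n z where "power_word z m = u" "power_word z n = v"
    using comm_append_are_replicate[OF assms(3)] by blast
  with pure_power_word[of m z] pure_power_word[of n z] assms(1,2) show ?thesis
    by simp
qed

lemma pure_not_product_of_commuting:
  assumes "pure_elem F (x @ y)" "x @ y = y @ x" shows "x = [] \<or> y = []"
proof -
  obtain m n z where mn: "power_word z m = x" "power_word z n = y"
    using comm_append_are_replicate[OF assms(2)] by blast
  then have "x @ y = power_word z (m + n)"
    by (simp add: replicate_add)
  with pure_power_word[of "m + n" z] assms(1) have "m + n = 1"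
    by simp
  with mn show ?thesis
    by (cases m) auto
qed

end

text \<open>Both products are the prefix of length \<open>length u + length v\<close> of the common power \<open>W\<close>: as \<open>W\<close> commutes with
  \<open>u\<close> and starts with \<open>v\<close>, the word \<open>u W = W u\<close> starts with \<open>u v\<close>, and likewise with \<open>u\<close> and \<open>v\<close> exchanged.\<close>

lemma common_power_commute:
  assumes eq: "power_word u k = power_word v l" and u: "u \<noteq> []" and v: "v \<noteq> []"
    and len: "length u + length v \<le> length (power_word u k)"
  shows "u @ v = v @ u"
proof -
  define W where "W = power_word u k"
  have k: "k > 0" "l > 0"
    using len u v unfolding eq by (auto simp: W_def eq intro!: gr0I) (use len u in auto)
  have pre: "x @ y = take (length x + length y) W"
    if "x @ W = W @ x" "\<exists>W'. W = y @ W'" "length x + length y \<le> length W" for x y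
  proof -
    have "take (length x + length y) (x @ W) = x @ y"
      using that(2) by auto
    moreover have "take (length x + length y) (W @ x) = take (length x + length y) W"
      using that(3) by simp
    ultimately show ?thesis
      using that(1) by simp
  qed
  have "u @ v = take (length u + length v) W"
  proof (rule pre)
    show "u @ W = W @ u"
      by (simp add: W_def power_word_commute)
    show "\<exists>W'. W = v @ W'"
      using k by (cases l) (auto simp: W_def eq)
  qed (use len in \<open>simp add: W_def\<close>)
  moreover have "v @ u = take (length v + length u) W"
  proof (rule pre)
    show "v @ W = W @ v"
      by (simp add: W_def eq power_word_commute)
    show "\<exists>W'. W = u @ W'"
      using k by (cases k) (auto simp: W_def)
  qed (use len in \<open>simp add: W_def\<close>)
  ultimately show ?thesis
    by (simp add: add.commute)
qed

section \<open>Non-commutative counting quasimorphisms\<close>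

text \<open>The map \<open>\<phi>\<close> assigns group elements to words of length \<open>m\<close>. It is compatible with inverses and bounded. The product
  of its values over all windows of a reduced word, from left to right, generalises the counting quasimorphisms
  of Brooks, which are the case of integer values.\<close>

locale window_count = free_group_on A + H: pseudonormed_group H \<eta>
  for A :: "'a set" and H :: "('h, 'n) monoid_scheme" and \<eta> +
  fixes m :: nat and \<phi> :: "('a \<times> bool) list \<Rightarrow> 'h" and B :: real
  assumes m: "m \<ge> 1" and B: "B \<ge> 0"
    and \<phi>_closed: "\<phi> w \<in> carrier H"
    and \<phi>_inv: "length w = m \<Longrightarrow> \<phi> (winv w) = inv\<^bsub>H\<^esub> (\<phi> w)"
    and \<phi>_le: "\<eta> (\<phi> w) \<le> B"
begin

definition window :: "('a \<times> bool) list \<Rightarrow> 'h" where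
  "window w = (if length w \<ge> m then \<phi> (take m w) else \<one>\<^bsub>H\<^esub>)"

fun \<Phi> :: "('a \<times> bool) list \<Rightarrow> 'h" where
  "\<Phi> [] = \<one>\<^bsub>H\<^esub>"
| "\<Phi> (x # v) = window (x # v) \<otimes>\<^bsub>H\<^esub> \<Phi> v"

lemma window_closed [simp, intro]: "window w \<in> carrier H"
  by (simp add: window_def \<phi>_closed)

lemma window_le: "\<eta> (window w) \<le> B"
  using B by (simp add: window_def \<phi>_le)

lemma \<Phi>_closed [simp, intro]: "\<Phi> w \<in> carrier H"
  by (induction w) auto

lemma \<Phi>_short: "length w < m \<Longrightarrow> \<Phi> w = \<one>\<^bsub>H\<^esub>"
  by (induction w) (auto simp: window_def)

text \<open>Only the fewer than \<open>m\<close> windows across the junction are not windows of one of the factors.\<close>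

lemma \<Phi>_append:
  "\<exists>b\<in>carrier H. \<eta> b \<le> real m * B \<and> \<Phi> (u @ v) = \<Phi> u \<otimes>\<^bsub>H\<^esub> b \<otimes>\<^bsub>H\<^esub> \<Phi> v"
proof -
  have "\<exists>b\<in>carrier H. \<eta> b \<le> real (min (length u) m) * B \<and> \<Phi> (u @ v) = \<Phi> u \<otimes>\<^bsub>H\<^esub> b \<otimes>\<^bsub>H\<^esub> \<Phi> v"
  proof (induction u)
    case Nil
    show ?case
      by (rule bexI[of _ "\<one>\<^bsub>H\<^esub>"]) auto
  next
    case (Cons x u)
    then obtain b where b: "b \<in> carrier H" "\<eta> b \<le> real (min (length u) m) * B"
      "\<Phi> (u @ v) = \<Phi> u \<otimes>\<^bsub>H\<^esub> b \<otimes>\<^bsub>H\<^esub> \<Phi> v"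
      by blast
    show ?case
    proof (cases "length (x # u) \<ge> m")
      case True
      then have "take m ((x # u) @ v) = take m (x # u)"
        by (simp only: take_append) simp
      with True have "window (x # u @ v) = window (x # u)"
        by (simp add: window_def)
      moreover have "real (min (length u) m) * B \<le> real (min (length (x # u)) m) * B"
        using B by (intro mult_right_mono) auto
      ultimately show ?thesis
        using b by (intro bexI[of _ b]) (auto simp: H.m_assoc)
    next
      case False
      then have "\<Phi> u = \<one>\<^bsub>H\<^esub>" "\<Phi> (x # u) = \<one>\<^bsub>H\<^esub>"
        by (simp_all add: \<Phi>_short del: \<Phi>.simps)
      moreover have "\<eta> (window (x # u @ v) \<otimes>\<^bsub>H\<^esub> b) \<le> B + real (min (length u) m) * B"
        using H.norm_mult[of "window (x # u @ v)" b] b window_le[of "x # u @ v"] by simp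
      moreover have "B + real (min (length u) m) * B = real (min (length (x # u)) m) * B"
        using False by (simp add: algebra_simps)
      ultimately show ?thesis
        using b by (intro bexI[of _ "window (x # u @ v) \<otimes>\<^bsub>H\<^esub> b"]) (auto simp: H.m_assoc)
    qed
  qed
  moreover have "real (min (length u) m) * B \<le> real m * B"
    using B by (intro mult_right_mono) auto
  ultimately show ?thesis
    by (meson order_trans)
qed

text \<open>The recursion from the right end, as needed for the compatibility with inverses.\<close>

lemma \<Phi>_snoc:
  "\<Phi> (v @ [x]) = \<Phi> v \<otimes>\<^bsub>H\<^esub>
    (if length (v @ [x]) \<ge> m then \<phi> (drop (length (v @ [x]) - m) (v @ [x])) else \<one>\<^bsub>H\<^esub>)"
proof (induction v)
  case Nil
  then show ?case
    using m by (auto simp: window_def \<phi>_closed)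
next
  case (Cons y v)
  consider "length (v @ [x]) \<ge> m" | "length (y # v @ [x]) = m" | "length (y # v @ [x]) < m"
    by fastforce
  then show ?case
  proof cases
    case 1
    then have "take m ((y # v) @ [x]) = take m (y # v)"
      by (simp only: take_append) simp
    with 1 have "window (y # v @ [x]) = window (y # v)"
      by (simp add: window_def)
    moreover have "drop (Suc (length (v @ [x])) - m) (y # v @ [x]) = drop (length (v @ [x]) - m) (v @ [x])"
      using 1 by (simp add: Suc_diff_le)
    ultimately show ?thesis
      using Cons 1 by (simp add: H.m_assoc \<phi>_closed)
  next
    case 2
    then have "\<Phi> (y # v) = \<one>\<^bsub>H\<^esub>" "\<Phi> (v @ [x]) = \<one>\<^bsub>H\<^esub>"
      by (simp_all add: \<Phi>_short del: \<Phi>.simps)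
    then show ?thesis
      using 2 by (simp add: window_def \<phi>_closed del: \<Phi>.simps(2)) (simp add: window_def \<phi>_closed)
  next
    case 3
    then have "\<Phi> (y # v) = \<one>\<^bsub>H\<^esub>" "\<Phi> (y # v @ [x]) = \<one>\<^bsub>H\<^esub>"
      by (simp_all add: \<Phi>_short del: \<Phi>.simps)
    then show ?thesis
      using 3 by (simp del: \<Phi>.simps)
  qed
qed

lemma \<Phi>_winv: "\<Phi> (winv v) = inv\<^bsub>H\<^esub> (\<Phi> v)"
proof (induction v)
  case (Cons x v)
  let ?l = "length (x # v)"
  have last: "(if ?l \<ge> m then \<phi> (drop (?l - m) (winv (x # v))) else \<one>\<^bsub>H\<^esub>) = inv\<^bsub>H\<^esub> (window (x # v))"
  proof (cases "?l \<ge> m")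
    case True
    have "drop (?l - m) (winv (x # v)) = winv (take m (x # v))"
      unfolding winv_def by (simp only: drop_rev length_map length_rev rev_map[symmetric] take_map[symmetric])
        (use True in simp)
    then show ?thesis
      using True \<phi>_inv[of "take m (x # v)"] by (simp add: window_def)
  qed (simp add: window_def)
  have "\<Phi> (winv (x # v)) = \<Phi> (winv v) \<otimes>\<^bsub>H\<^esub>
      (if ?l \<ge> m then \<phi> (drop (?l - m) (winv (x # v))) else \<one>\<^bsub>H\<^esub>)"
    using \<Phi>_snoc[of "winv v" "letter_inv x"] by simp
  then show ?case
    unfolding last Cons.IH by (simp add: H.inv_mult_group)
qed simp

text \<open>The cancelling part contributes inverse factors to \<open>\<Phi> u\<close> and \<open>\<Phi> v\<close>. So only the windows across the three
  junctions, in the two factors and in the product, matter.\<close>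

lemma \<Phi>_quasimorphism:
  assumes u: "u \<in> carrier F" and v: "v \<in> carrier F"
  shows "H.d (\<Phi> (u \<otimes>\<^bsub>F\<^esub> v)) (\<Phi> u \<otimes>\<^bsub>H\<^esub> \<Phi> v) \<le> 3 * real m * B"
proof -
  obtain u' c v' where uv: "u = u' @ c" "v = winv c @ v'" "u \<otimes>\<^bsub>F\<^esub> v = u' @ v'"
    using push_letters_cancellation[of u v] u v by (auto simp: carrier_F mult_F)
  obtain b1 where b1: "b1 \<in> carrier H" "\<eta> b1 \<le> real m * B" "\<Phi> (u' @ v') = \<Phi> u' \<otimes>\<^bsub>H\<^esub> b1 \<otimes>\<^bsub>H\<^esub> \<Phi> v'"
    using \<Phi>_append by blast
  obtain b2 where b2: "b2 \<in> carrier H" "\<eta> b2 \<le> real m * B" "\<Phi> (u' @ c) = \<Phi> u' \<otimes>\<^bsub>H\<^esub> b2 \<otimes>\<^bsub>H\<^esub> \<Phi> c"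
    using \<Phi>_append by blast
  obtain b3 where b3: "b3 \<in> carrier H" "\<eta> b3 \<le> real m * B"
    "\<Phi> (winv c @ v') = \<Phi> (winv c) \<otimes>\<^bsub>H\<^esub> b3 \<otimes>\<^bsub>H\<^esub> \<Phi> v'"
    using \<Phi>_append by blast
  have "\<Phi> u \<otimes>\<^bsub>H\<^esub> \<Phi> v = \<Phi> u' \<otimes>\<^bsub>H\<^esub> (b2 \<otimes>\<^bsub>H\<^esub> b3) \<otimes>\<^bsub>H\<^esub> \<Phi> v'"
    using b2 b3 by (simp add: uv \<Phi>_winv H.group_normalize)
  moreover have "\<Phi> (u \<otimes>\<^bsub>F\<^esub> v) = \<Phi> u' \<otimes>\<^bsub>H\<^esub> b1 \<otimes>\<^bsub>H\<^esub> \<Phi> v'"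
    by (simp add: uv(3) b1(3))
  ultimately have "H.d (\<Phi> (u \<otimes>\<^bsub>F\<^esub> v)) (\<Phi> u \<otimes>\<^bsub>H\<^esub> \<Phi> v) = H.d b1 (b2 \<otimes>\<^bsub>H\<^esub> b3)"
    using b1 b2 b3 by simp
  also have "\<dots> \<le> \<eta> b1 + (\<eta> b2 + \<eta> b3)"
    using b1 b2 b3 H.norm_mult[of "inv\<^bsub>H\<^esub> b1" "b2 \<otimes>\<^bsub>H\<^esub> b3"] H.norm_mult[of b2 b3]
    by (simp add: H.d_eq H.norm_inv)
  finally show ?thesis
    using b1 b2 b3 by simp
qed

lemma \<Phi>_list_mult:
  assumes "set xs \<subseteq> carrier F"
  shows "H.d (\<Phi> (list_mult F xs)) (list_mult H (map \<Phi> xs)) \<le> 3 * real m * B * real (length xs)"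
  using assms
proof (induction xs)
  case Nil
  then show ?case
    by (simp add: one_F)
next
  case (Cons x xs)
  have cl: "list_mult F xs \<in> carrier F" "list_mult H (map \<Phi> xs) \<in> carrier H"
    using Cons.prems by (auto intro!: H.list_mult_closed)
  have "H.d (\<Phi> (x \<otimes>\<^bsub>F\<^esub> list_mult F xs)) (\<Phi> x \<otimes>\<^bsub>H\<^esub> list_mult H (map \<Phi> xs))
      \<le> H.d (\<Phi> (x \<otimes>\<^bsub>F\<^esub> list_mult F xs)) (\<Phi> x \<otimes>\<^bsub>H\<^esub> \<Phi> (list_mult F xs))
        + H.d (\<Phi> x \<otimes>\<^bsub>H\<^esub> \<Phi> (list_mult F xs)) (\<Phi> x \<otimes>\<^bsub>H\<^esub> list_mult H (map \<Phi> xs))"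
    using cl by (intro H.d_triangle) auto
  also have "\<dots> \<le> 3 * real m * B + 3 * real m * B * real (length xs)"
    using Cons cl \<Phi>_quasimorphism[of x "list_mult F xs"] by (intro add_mono) auto
  finally show ?case
    by (simp add: algebra_simps)
qed

lemma \<Phi>_conj:
  assumes h: "h \<in> carrier F" and s: "s \<in> carrier F"
  shows "\<eta> (\<Phi> (h \<otimes>\<^bsub>F\<^esub> s \<otimes>\<^bsub>F\<^esub> inv\<^bsub>F\<^esub> h)) \<le> \<eta> (\<Phi> s) + 9 * real m * B"
proof -
  have eq: "\<Phi> (inv\<^bsub>F\<^esub> h) = inv\<^bsub>H\<^esub> (\<Phi> h)"
    using h by (simp add: inv_F \<Phi>_winv)
  have "H.d (\<Phi> (list_mult F [h, s, inv\<^bsub>F\<^esub> h])) (list_mult H (map \<Phi> [h, s, inv\<^bsub>F\<^esub> h])) \<le> 3 * real m * B * 3"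
    using \<Phi>_list_mult[of "[h, s, inv\<^bsub>F\<^esub> h]"] h s by simp
  moreover have "list_mult F [h, s, inv\<^bsub>F\<^esub> h] = h \<otimes>\<^bsub>F\<^esub> s \<otimes>\<^bsub>F\<^esub> inv\<^bsub>F\<^esub> h"
    using h s by (simp add: F.m_assoc)
  moreover have "list_mult H (map \<Phi> [h, s, inv\<^bsub>F\<^esub> h]) = \<Phi> h \<otimes>\<^bsub>H\<^esub> \<Phi> s \<otimes>\<^bsub>H\<^esub> inv\<^bsub>H\<^esub> (\<Phi> h)"
    by (simp add: H.m_assoc eq)
  ultimately have "H.d (\<Phi> (h \<otimes>\<^bsub>F\<^esub> s \<otimes>\<^bsub>F\<^esub> inv\<^bsub>F\<^esub> h)) (\<Phi> h \<otimes>\<^bsub>H\<^esub> \<Phi> s \<otimes>\<^bsub>H\<^esub> inv\<^bsub>H\<^esub> (\<Phi> h)) \<le> 9 * real m * B"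
    by simp
  moreover have "\<eta> (\<Phi> h \<otimes>\<^bsub>H\<^esub> \<Phi> s \<otimes>\<^bsub>H\<^esub> inv\<^bsub>H\<^esub> (\<Phi> h)) = \<eta> (\<Phi> s)"
    by (simp add: H.norm_conj)
  ultimately show ?thesis
    using H.norm_diff_le[of "\<Phi> (h \<otimes>\<^bsub>F\<^esub> s \<otimes>\<^bsub>F\<^esub> inv\<^bsub>F\<^esub> h)" "\<Phi> h \<otimes>\<^bsub>H\<^esub> \<Phi> s \<otimes>\<^bsub>H\<^esub> inv\<^bsub>H\<^esub> (\<Phi> h)"]
    by simp
qed

end

context free_group_on
begin

lemma letter_eq_gen: "a \<in> A \<Longrightarrow> free_gen a = [(a, True)]" "a \<in> A \<Longrightarrow> inv\<^bsub>F\<^esub> (free_gen a) = [(a, False)]"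
  by (simp_all add: free_gen_def inv_F carrier_F reduced_def letter_inv_def)

lemma free_gen_closed: "free_gen ` A \<subseteq> carrier F"
  by (auto simp: free_gen_def carrier_F reduced_def)

sublocale conj_generated "free_group A" "free_gen ` A"
proof
  show "free_gen ` A \<subseteq> carrier F" by (rule free_gen_closed)
  fix g assume g: "g \<in> carrier F"
  have "fst ` set w \<subseteq> A \<Longrightarrow> reduced w \<Longrightarrow> w = list_mult F (map (\<lambda>x. [x]) w)" for w
  proof (induction w)
    case (Cons x w)
    then have "w = list_mult F (map (\<lambda>x. [x]) w)"
      by (simp add: reduced_Cons_iff)
    then show ?case
      using Cons.prems mult_append[of "[x]" w] by simp
  qed (simp add: one_F)
  then have "g = list_mult F (map (\<lambda>x. [x]) g)"
    using g by (simp add: carrier_F)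
  moreover have "[x] \<in> free_gen ` A \<union> m_inv F ` free_gen ` A" if "x \<in> set g" for x
  proof -
    obtain a b where x: "x = (a, b)" by (cases x)
    have "a \<in> A"
      using g that by (force simp: carrier_F x)
    then show ?thesis
      by (cases b) (auto simp: x letter_eq_gen[symmetric] simp del: letter_eq_gen)
  qed
  then have "set (map (\<lambda>x. [x]) g) \<subseteq> free_gen ` A \<union> m_inv F ` free_gen ` A"
    by auto
  ultimately show "\<exists>xs. set xs \<subseteq> free_gen ` A \<union> m_inv F ` free_gen ` A \<and> g = list_mult F xs"
    by blast
qed

lemma length_gen: "s \<in> free_gen ` A \<union> m_inv F ` free_gen ` A \<Longrightarrow> length s = 1"
  by (auto simp: letter_eq_gen(2)) (simp add: free_gen_def)

sublocale G: pseudonormed_group "free_group A" "conj_word_norm (free_group A) (free_gen ` A)"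
  by (rule pseudonormed_word_norm)

lemma word_norm_ge_1: assumes "g \<in> carrier F" "g \<noteq> []" shows "\<nu> g \<ge> 1"
proof -
  obtain cs where cs: "\<nu> g = real (length cs)" "set cs \<subseteq> gens" "g = list_mult F cs"
    using word_norm_factorisation[OF assms(1)] by blast
  then have "cs \<noteq> []"
    using assms(2) by (auto simp: one_F)
  then show ?thesis
    using cs(1) by (cases cs) auto
qed

end

context window_count
begin

text \<open>A conjugate of a letter costs at most \<open>1 + 9\<close> times \<open>m B\<close>, once for the letter and the rest for the conjugation. Multiplying the
  conjugates costs another \<open>3 m B\<close> for each factor.\<close>

lemma \<Phi>_le_word_norm:
  assumes g: "g \<in> carrier F" shows "\<eta> (\<Phi> g) \<le> 13 * real m * B * \<nu> g"
proof -
  obtain cs where cs: "\<nu> g = real (length cs)" "set cs \<subseteq> gens" "g = list_mult F cs"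
    using word_norm_factorisation[OF g] by blast
  have csF: "set cs \<subseteq> carrier F"
    using cs(2) gens_closed by blast
  have gen_le: "\<eta> (\<Phi> c) \<le> 10 * real m * B" if c: "c \<in> set cs" for c
  proof -
    obtain h s where hs: "c = h \<otimes>\<^bsub>F\<^esub> s \<otimes>\<^bsub>F\<^esub> inv\<^bsub>F\<^esub> h" "h \<in> carrier F"
      "s \<in> free_gen ` A \<union> m_inv F ` free_gen ` A"
      using c cs(2) by (auto simp: gens_def)
    then obtain x where "s = [x]"
      using length_gen[of s] by (auto simp: length_Suc_conv)
    then have "\<eta> (\<Phi> s) \<le> B"
      using window_le[of "[x]"] by simp
    also have "B \<le> real m * B"
      using mult_right_mono[of 1 "real m" B] m B by simp
    finally have "\<eta> (\<Phi> s) \<le> real m * B" .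
    moreover have "s \<in> carrier F"
      using hs(3) free_gen_closed by auto
    ultimately show ?thesis
      using \<Phi>_conj[OF hs(2), of s] by (simp add: hs(1))
  qed
  have "\<eta> (list_mult H (map \<Phi> cs)) \<le> (\<Sum>c\<leftarrow>cs. \<eta> (\<Phi> c))"
    using H.norm_list_mult[of "map \<Phi> cs"] by (auto simp: comp_def)
  also have "\<dots> \<le> (\<Sum>c\<leftarrow>cs. 10 * real m * B)"
    using gen_le by (intro sum_list_mono)
  also have "\<dots> = 10 * real m * B * real (length cs)"
    by (simp add: sum_list_triv)
  finally have "\<eta> (list_mult H (map \<Phi> cs)) \<le> 10 * real m * B * real (length cs)" .
  moreover have "list_mult H (map \<Phi> cs) \<in> carrier H"
    by (intro H.list_mult_closed) auto
  ultimately show ?thesis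
    using H.norm_diff_le[of "\<Phi> g" "list_mult H (map \<Phi> cs)"] \<Phi>_list_mult[OF csF]
    by (simp add: cs(1,3)[symmetric])
qed

end

section \<open>Periodic words over the representatives\<close>

lemma power_word_rotate: "y @ power_word (x @ y) n = power_word (y @ x) n @ y"
  by (induction n) auto

lemma one_FR: "\<one>\<^bsub>FR G\<^esub> = []"
  and bar_mult_FR: "bar g r \<otimes>\<^bsub>FR G\<^esub> bar g s = bar g (r + s)"
  by (simp_all add: FR_def one_free_real bar_mult)

lemma bar_inv_FR: "g \<in> carrier G \<Longrightarrow> inv\<^bsub>FR G\<^esub> (bar g r) = bar g (- r)"
  by (simp add: FR_def bar_inv)

lemma take_power_word:
  assumes "k \<le> n" shows "take (k * length w) (power_word w n @ v) = power_word w k"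
proof -
  have "power_word w n = power_word w k @ power_word w (n - k)"
    using assms by (simp flip: concat_append replicate_add)
  then show ?thesis
    by simp
qed

context free_group_on
begin

sublocale cone: directional_cone "free_group A" "conj_word_norm (free_group A) (free_gen ` A)"
  by (rule directional_cone.intro) (rule pseudonormed_word_norm)

text \<open>Free groups have no elements of order two.\<close>

lemma self_inverse_word:
  assumes "x \<in> carrier F" "winv x = x" shows "x = []"
proof (rule torsion_free[of x 2])
  have "x \<otimes>\<^bsub>F\<^esub> x = \<one>\<^bsub>F\<^esub>"
    using F.r_inv[OF assms(1)] unfolding inv_F[OF assms(1)] assms(2) .
  moreover have "x [^]\<^bsub>F\<^esub> (2::nat) = x \<otimes>\<^bsub>F\<^esub> x"
    using assms(1) by (simp add: numeral_2_eq_2)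
  ultimately show "x [^]\<^bsub>F\<^esub> (2::nat) = []"
    by (simp only: one_F)
qed (use assms in auto)

lemma rotation:
  assumes "x @ y \<in> carrier F" "cyclically_reduced (x @ y)"
  shows "y @ x \<in> carrier F" "y @ x = inv\<^bsub>F\<^esub> x \<otimes>\<^bsub>F\<^esub> (x @ y) \<otimes>\<^bsub>F\<^esub> inv\<^bsub>F\<^esub> (inv\<^bsub>F\<^esub> x)"
    and "x \<in> carrier F" "y \<in> carrier F"
proof -
  show xy: "x \<in> carrier F" "y \<in> carrier F"
    using append_mult[OF assms(1)] by auto
  have red: "reduced (y @ x)"
    using assms xy by (cases "x = []"; cases "y = []") (auto simp: cyclically_reduced_def reduced_append_iff carrier_F)
  then show "y @ x \<in> carrier F"
    using xy by (simp add: carrier_F image_Un)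
  have "y @ x = y \<otimes>\<^bsub>F\<^esub> x"
    using red by (simp add: mult_append)
  also have "\<dots> = inv\<^bsub>F\<^esub> x \<otimes>\<^bsub>F\<^esub> (x \<otimes>\<^bsub>F\<^esub> y) \<otimes>\<^bsub>F\<^esub> inv\<^bsub>F\<^esub> (inv\<^bsub>F\<^esub> x)"
    using xy by simp
  also have "x \<otimes>\<^bsub>F\<^esub> y = x @ y"
    using append_mult[OF assms(1)] by simp
  finally show "y @ x = inv\<^bsub>F\<^esub> x \<otimes>\<^bsub>F\<^esub> (x @ y) \<otimes>\<^bsub>F\<^esub> inv\<^bsub>F\<^esub> (inv\<^bsub>F\<^esub> x)" .
qed

end

locale pure_representatives = free_group_on A for A :: "'a set" +
  fixes \<Theta> :: "('a \<times> bool) list set"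
  assumes pure: "\<theta> \<in> \<Theta> \<Longrightarrow> pure_elem (free_group A) \<theta>"
    and cyc: "\<theta> \<in> \<Theta> \<Longrightarrow> cyclically_reduced \<theta>"
    and represented: "pure_elem (free_group A) g \<Longrightarrow> \<exists>\<theta>\<in>\<Theta>. conj_or_inv (free_group A) g \<theta>"
    and unique: "\<theta> \<in> \<Theta> \<Longrightarrow> \<theta>' \<in> \<Theta> \<Longrightarrow> conj_or_inv (free_group A) \<theta> \<theta>' \<Longrightarrow> \<theta> = \<theta>'"
begin

lemma \<Theta>_F: "\<theta> \<in> \<Theta> \<Longrightarrow> \<theta> \<in> carrier F"
  using pure by (simp add: pure_elem_def)

lemma \<Theta>_not_Nil: "\<theta> \<in> \<Theta> \<Longrightarrow> \<theta> \<noteq> []"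
  using pure pure_not_Nil by blast

lemma \<Theta>_pow: "\<theta> \<in> \<Theta> \<Longrightarrow> \<theta> [^]\<^bsub>F\<^esub> n = power_word \<theta> n"
  using reduced_power_word[OF cyc] by (simp add: pow_F \<Theta>_F)

lemma pure_rotation: "x @ y \<in> \<Theta> \<Longrightarrow> pure_elem F (y @ x)"
  using rotation[OF \<Theta>_F cyc, of x y] F.pure_conj[OF pure, of "x @ y" "inv\<^bsub>F\<^esub> x"] by simp

text \<open>Two words with a long common power commute. For the rotation \<open>y x\<close> and \<open>\<theta>'\<close>, which are not proper powers,
  this means equality, so \<open>x y\<close> and \<open>\<theta>'\<close> are conjugate representatives.\<close>

lemma periodic_unique:
  assumes \<theta>: "x @ y \<in> \<Theta>" and \<theta>': "\<theta>' \<in> \<Theta>"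
    and eq: "power_word (y @ x) k = power_word \<theta>' l"
    and len: "length (x @ y) + length \<theta>' \<le> length (power_word (y @ x) k)"
  shows "\<theta>' = x @ y" "x = [] \<or> y = []"
proof -
  have "(y @ x) @ \<theta>' = \<theta>' @ (y @ x)"
    using \<Theta>_not_Nil[OF \<theta>] \<Theta>_not_Nil[OF \<theta>'] len by (intro common_power_commute[OF eq]) auto
  then have rot: "y @ x = \<theta>'"
    using pure_commuting_eq[OF pure_rotation[OF \<theta>] pure[OF \<theta>']] by blast
  note r = rotation[OF \<Theta>_F[OF \<theta>] cyc[OF \<theta>]]
  have "conj_or_inv F (x @ y) \<theta>'"
    unfolding conj_or_inv_def using r rot by (intro bexI[of _ "inv\<^bsub>F\<^esub> x"] disjI1) auto
  then show "\<theta>' = x @ y"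
    using unique[OF \<theta> \<theta>'] by simp
  with rot show "x = [] \<or> y = []"
    using pure_not_product_of_commuting[OF pure[OF \<theta>]] by simp
qed

text \<open>Otherwise \<open>x y\<close> would be conjugate to the inverse of \<open>\<theta>'\<close>, hence equal to \<open>\<theta>'\<close>. Then \<open>y x\<close> is the inverse of
  \<open>x y\<close>, which forces \<open>x\<close> and \<open>y\<close> to be their own inverses.\<close>

lemma periodic_not_inverse:
  assumes \<theta>: "x @ y \<in> \<Theta>" and \<theta>': "\<theta>' \<in> \<Theta>"
    and len: "length (x @ y) + length \<theta>' \<le> length (power_word (y @ x) k)"
  shows "power_word (y @ x) k \<noteq> power_word (winv \<theta>') l"
proof
  assume eq: "power_word (y @ x) k = power_word (winv \<theta>') l"
  have "(y @ x) @ winv \<theta>' = winv \<theta>' @ (y @ x)"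
    using \<Theta>_not_Nil[OF \<theta>] \<Theta>_not_Nil[OF \<theta>'] len by (intro common_power_commute[OF eq]) auto
  moreover have "pure_elem F (winv \<theta>')"
    using F.pure_inv[OF pure[OF \<theta>']] by (simp add: inv_F \<Theta>_F \<theta>')
  ultimately have rot: "y @ x = winv \<theta>'"
    using pure_commuting_eq[OF pure_rotation[OF \<theta>]] by blast
  note r = rotation[OF \<Theta>_F[OF \<theta>] cyc[OF \<theta>]]
  have xF: "inv\<^bsub>F\<^esub> x \<in> carrier F" "x @ y \<in> carrier F"
    using r \<Theta>_F[OF \<theta>] by auto
  have "\<theta>' = inv\<^bsub>F\<^esub> (y @ x)"
    using r(1) \<Theta>_F[OF \<theta>'] by (simp add: rot inv_F winv_closed)
  also have "\<dots> = inv\<^bsub>F\<^esub> (inv\<^bsub>F\<^esub> x \<otimes>\<^bsub>F\<^esub> (x @ y) \<otimes>\<^bsub>F\<^esub> inv\<^bsub>F\<^esub> (inv\<^bsub>F\<^esub> x))"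
    by (simp only: r(2)[symmetric])
  also have "\<dots> = inv\<^bsub>F\<^esub> x \<otimes>\<^bsub>F\<^esub> inv\<^bsub>F\<^esub> (x @ y) \<otimes>\<^bsub>F\<^esub> inv\<^bsub>F\<^esub> (inv\<^bsub>F\<^esub> x)"
    using xF by (simp add: F.group_normalize)
  finally have "conj_or_inv F (x @ y) \<theta>'"
    unfolding conj_or_inv_def using xF by blast
  then have "\<theta>' = x @ y"
    using unique[OF \<theta> \<theta>'] by simp
  then have "y @ x = winv y @ winv x"
    using rot by simp
  then have "winv y = y" "winv x = x"
    by simp_all
  then have "x = []" "y = []"
    using self_inverse_word r(3,4) by auto
  then show False
    using \<Theta>_not_Nil[OF \<theta>] by simp
qed

end

text \<open>The lengths of the representatives may be unbounded, so only finitely many of them can be recognised by windows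
  of a common length.\<close>

locale periodic_windows = pure_representatives A \<Theta> for A :: "'a set" and \<Theta> +
  fixes \<Psi> :: "('a \<times> bool) list set"
  assumes \<Psi>: "\<Psi> \<subseteq> \<Theta>" and finite_\<Psi>: "finite \<Psi>"
begin

text \<open>A common multiple of the lengths, so that windows can be powers. The factor 2 makes a window at least as long as two of
  the representatives together.\<close>

definition m :: nat where "m = 2 * (\<Prod>\<theta>\<in>\<Psi>. length \<theta>)"

definition block :: "('a \<times> bool) list \<Rightarrow> ('a \<times> bool) list" where
  "block \<theta> = power_word \<theta> (m div length \<theta>)"

lemma length_pos: "\<theta> \<in> \<Psi> \<Longrightarrow> length \<theta> > 0"
  using \<Psi> \<Theta>_not_Nil by auto

lemma m_pos: "m \<ge> 1"
proof -
  have "(\<Prod>\<theta>\<in>\<Psi>. length \<theta>) > 0"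
    using length_pos by (intro prod_pos) auto
  then show ?thesis
    by (simp add: m_def)
qed

lemma dvd_m: "\<theta> \<in> \<Psi> \<Longrightarrow> length \<theta> dvd m"
  unfolding m_def by (intro dvd_mult dvd_prodI finite_\<Psi>)

lemma le_m: assumes "\<theta> \<in> \<Psi>" shows "2 * length \<theta> \<le> m"
proof -
  have "length \<theta> dvd (\<Prod>\<theta>\<in>\<Psi>. length \<theta>)"
    by (intro dvd_prodI finite_\<Psi> assms)
  moreover have "(\<Prod>\<theta>\<in>\<Psi>. length \<theta>) > 0"
    using length_pos by (intro prod_pos) auto
  ultimately show ?thesis
    unfolding m_def by (auto dest: dvd_imp_le)
qed

text \<open>Among the windows of a periodic word, only those that start at a multiple of the period are recognised.\<close>

lemma rotation_block:
  assumes "x @ y \<in> \<Psi>" "\<theta>' \<in> \<Psi>"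
  shows "power_word (y @ x) (m div length (x @ y)) = block \<theta>' \<Longrightarrow> \<theta>' = x @ y \<and> (x = [] \<or> y = [])"
    and "power_word (y @ x) (m div length (x @ y)) \<noteq> winv (block \<theta>')"
proof -
  have "length (power_word (y @ x) (m div length (x @ y))) = m"
    using dvd_m[OF assms(1)] by (simp add: add.commute)
  then have len: "length (x @ y) + length \<theta>' \<le> length (power_word (y @ x) (m div length (x @ y)))"
    using le_m[OF assms(1)] le_m[OF assms(2)] by linarith
  have \<Theta>: "x @ y \<in> \<Theta>" "\<theta>' \<in> \<Theta>"
    using assms \<Psi> by auto
  show "\<theta>' = x @ y \<and> (x = [] \<or> y = [])" if "power_word (y @ x) (m div length (x @ y)) = block \<theta>'"
    using periodic_unique[OF \<Theta> _ len] that unfolding block_def by blast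
  show "power_word (y @ x) (m div length (x @ y)) \<noteq> winv (block \<theta>')"
    unfolding block_def winv_power_word by (rule periodic_not_inverse[OF \<Theta> len])
qed

lemma block_inj: "\<theta> \<in> \<Psi> \<Longrightarrow> \<theta>' \<in> \<Psi> \<Longrightarrow> block \<theta> = block \<theta>' \<Longrightarrow> \<theta> = \<theta>'"
  using rotation_block(1)[of "[]" \<theta> \<theta>'] by (simp add: block_def)

lemma block_not_winv: "\<theta> \<in> \<Psi> \<Longrightarrow> \<theta>' \<in> \<Psi> \<Longrightarrow> block \<theta> \<noteq> winv (block \<theta>')"
  using rotation_block(2)[of "[]" \<theta> \<theta>'] by (simp add: block_def)

definition \<phi> :: "('a \<times> bool) list \<Rightarrow> (('a \<times> bool) list \<times> real) list" where
  "\<phi> w = (if w \<in> block ` \<Psi> then bar (the_inv_into \<Psi> block w) 1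
     else if winv w \<in> block ` \<Psi> then bar (the_inv_into \<Psi> block (winv w)) (- 1) else [])"

lemma inj_block: "inj_on block \<Psi>"
  using block_inj by (auto simp: inj_on_def)

lemma \<phi>_block: "\<theta> \<in> \<Psi> \<Longrightarrow> \<phi> (block \<theta>) = bar \<theta> 1"
  by (simp add: \<phi>_def the_inv_into_f_f inj_block)

lemma \<phi>_winv_block:
  assumes "\<theta> \<in> \<Psi>" shows "\<phi> (winv (block \<theta>)) = bar \<theta> (- 1)"
proof -
  have "winv (block \<theta>) \<notin> block ` \<Psi>"
    using block_not_winv[OF _ assms] by force
  then show ?thesis
    using assms by (simp add: \<phi>_def the_inv_into_f_f inj_block)
qed

lemma \<phi>_other: "w \<notin> block ` \<Psi> \<Longrightarrow> winv w \<notin> block ` \<Psi> \<Longrightarrow> \<phi> w = []"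
  by (simp add: \<phi>_def)

text \<open>The two kinds of recognised words are exclusive by \<open>block_not_winv\<close>.\<close>

lemma \<phi>_cases:
  obtains \<theta> where "\<theta> \<in> \<Psi>" "w = block \<theta>" "\<phi> w = bar \<theta> 1" "\<phi> (winv w) = bar \<theta> (- 1)"
    | \<theta> where "\<theta> \<in> \<Psi>" "winv w = block \<theta>" "\<phi> w = bar \<theta> (- 1)" "\<phi> (winv w) = bar \<theta> 1"
    | "\<phi> w = []" "\<phi> (winv w) = []"
proof (cases "w \<in> block ` \<Psi>")
  case True
  then show ?thesis
    using that(1) \<phi>_block \<phi>_winv_block by blast
next
  case 1: False
  show ?thesis
  proof (cases "winv w \<in> block ` \<Psi>")
    case True
    then obtain \<theta> where \<theta>: "\<theta> \<in> \<Psi>" "winv w = block \<theta>"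
      by auto
    then have w: "w = winv (block \<theta>)"
      by (metis winv_simps(4))
    have "\<phi> w = bar \<theta> (- 1)" "\<phi> (winv w) = bar \<theta> 1"
      unfolding \<theta>(2) \<phi>_block[OF \<theta>(1)] unfolding w \<phi>_winv_block[OF \<theta>(1)] by (rule refl)+
    then show ?thesis
      by (rule that(2)[OF \<theta>])
  next
    case False
    with 1 show ?thesis
      using that(3) \<phi>_other[of w] \<phi>_other[of "winv w"] by simp
  qed
qed

definition B :: real where "B = (\<Sum>\<theta>\<in>\<Psi>. \<nu> \<theta>)"

lemma \<Psi>_F: "\<theta> \<in> \<Psi> \<Longrightarrow> \<theta> \<in> carrier F"
  using \<Psi> \<Theta>_F by blast

lemma le_B: "\<theta> \<in> \<Psi> \<Longrightarrow> \<nu> \<theta> \<le> B"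
  unfolding B_def using finite_\<Psi> \<Psi>_F by (intro member_le_sum) (auto intro: G.norm_nonneg)

sublocale window_count A "FR (free_group A)"
  "FR_norm (free_group A) (conj_word_norm (free_group A) (free_gen ` A))" m \<phi> B
proof
  show "m \<ge> 1" by (rule m_pos)
  show "B \<ge> 0"
    unfolding B_def using \<Psi>_F by (intro sum_nonneg G.norm_nonneg) auto
  have one: "[] = \<one>\<^bsub>FR F\<^esub>"
    by (simp only: one_FR)
  fix w
  show "\<phi> w \<in> carrier (FR F)"
    by (cases w rule: \<phi>_cases) (use \<Psi>_F in \<open>auto simp: one\<close>)
  show "\<phi> (winv w) = inv\<^bsub>FR F\<^esub> (\<phi> w)"
  proof (cases w rule: \<phi>_cases)
    case 3
    then show ?thesis
      using cone.FR.inv_one by (simp add: one)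
  qed (use \<Psi>_F in \<open>auto simp: bar_inv_FR\<close>)
  show "FR_norm F \<nu> (\<phi> w) \<le> B"
  proof (cases w rule: \<phi>_cases)
    case (1 \<theta>)
    then show ?thesis
      using cone.fn_bar_le[OF \<Psi>_F[of \<theta>], of 1] le_B[of \<theta>] by simp
  next
    case (2 \<theta>)
    then show ?thesis
      using cone.fn_bar_le[OF \<Psi>_F[of \<theta>], of "- 1"] le_B[of \<theta>] by simp
  next
    case 3
    then show ?thesis
      using \<open>B \<ge> 0\<close> by (simp add: one)
  qed
qed

lemma window_rotation:
  assumes \<theta>: "x @ y \<in> \<Psi>" and x: "x \<noteq> []" and y: "y \<noteq> []"
  shows "window (y @ power_word (x @ y) n) = \<one>\<^bsub>FR F\<^esub>"
proof (cases "m \<le> length (y @ power_word (x @ y) n)")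
  case True
  define k where "k = m div length (x @ y)"
  have m: "m = k * length (y @ x)"
    using dvd_m[OF \<theta>] by (simp add: k_def add.commute)
  have "length (y @ power_word (x @ y) n) < Suc n * length (y @ x)"
    using x by (simp add: add.commute)
  then have "k * length (y @ x) < Suc n * length (y @ x)"
    using True m by linarith
  then have "k \<le> n"
    by (simp only: mult_less_cancel2) simp
  then have "take m (y @ power_word (x @ y) n) = power_word (y @ x) k"
    unfolding power_word_rotate m by (rule take_power_word)
  moreover have "\<phi> (power_word (y @ x) k) = []"
  proof (rule \<phi>_other)
    show "power_word (y @ x) k \<notin> block ` \<Psi>"
      using rotation_block(1)[OF \<theta>] x y unfolding k_def by blast
    show "winv (power_word (y @ x) k) \<notin> block ` \<Psi>"
    proof
      assume "winv (power_word (y @ x) k) \<in> block ` \<Psi>"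
      then obtain \<theta>' where "\<theta>' \<in> \<Psi>" "winv (power_word (y @ x) k) = block \<theta>'"
        by blast
      then show False
        using rotation_block(2)[OF \<theta>] unfolding k_def by (metis winv_simps(4))
    qed
  qed
  moreover have "window (y @ power_word (x @ y) n) = \<phi> (take m (y @ power_word (x @ y) n))"
    using True by (simp only: window_def if_True)
  ultimately show ?thesis
    by (simp only: one_FR)
qed (simp only: window_def if_False)

text \<open>The windows that start inside a period are rotated and contribute nothing.\<close>

lemma \<Phi>_proper_suffix:
  "x @ y \<in> \<Psi> \<Longrightarrow> x \<noteq> [] \<Longrightarrow> \<Phi> (y @ power_word (x @ y) n) = \<Phi> (power_word (x @ y) n)"
proof (induction y arbitrary: x)
  case (Cons z y)
  have "\<Phi> (y @ power_word ((x @ [z]) @ y) n) = \<Phi> (power_word ((x @ [z]) @ y) n)"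
    using Cons.prems by (intro Cons.IH) auto
  then show ?case
    using window_rotation[OF Cons.prems, of n] by simp
qed simp

text \<open>Every period contributes one recognised window, except near the end, where fewer than \<open>m\<close> letters remain. The subtraction is
  truncated: short powers have no window at all.\<close>

lemma \<Phi>_power:
  assumes \<theta>: "\<theta> \<in> \<Psi>"
  shows "\<Phi> (power_word \<theta> n) = bar \<theta> (real (Suc n - m div length \<theta>))"
proof (induction n)
  case 0
  have "m div length \<theta> \<ge> 1"
    using le_m[OF \<theta>] length_pos[OF \<theta>] by (simp add: div_greater_zero_iff Suc_le_eq)
  then have "Suc 0 - m div length \<theta> = 0"
    by simp
  then show ?case
    by (simp add: bar_def one_FR)
next
  case (Suc n)
  define k where "k = m div length \<theta>"
  have m: "m = k * length \<theta>"
    using dvd_m[OF \<theta>] by (simp add: k_def)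
  obtain z y where zy: "\<theta> = z # y"
    using length_pos[OF \<theta>] by (cases \<theta>) auto
  have "\<Phi> (y @ power_word \<theta> n) = \<Phi> (power_word \<theta> n)"
    using \<Phi>_proper_suffix[of "[z]" y n] \<theta> by (simp add: zy)
  then have eq: "\<Phi> (power_word \<theta> (Suc n)) = window (power_word \<theta> (Suc n)) \<otimes>\<^bsub>FR F\<^esub> \<Phi> (power_word \<theta> n)"
    by (simp add: zy)
  show ?case
  proof (cases "k \<le> Suc n")
    case True
    then have "m \<le> length (power_word \<theta> (Suc n))"
      unfolding m length_power_word by (rule mult_le_mono1)
    moreover have "take m (power_word \<theta> (Suc n)) = block \<theta>"
      using take_power_word[OF True, of \<theta> "[]"] by (simp only: m[symmetric] append_Nil2 block_def k_def[symmetric])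
    ultimately have "window (power_word \<theta> (Suc n)) = bar \<theta> 1"
      using \<phi>_block[OF \<theta>] unfolding window_def by simp
    then have "\<Phi> (power_word \<theta> (Suc n)) = bar \<theta> (1 + real (Suc n - k))"
      unfolding eq Suc k_def[symmetric] by (simp add: bar_mult_FR)
    also have "1 + real (Suc n - k) = real (Suc (Suc n) - k)"
      using True by simp
    finally show ?thesis
      by (simp add: k_def)
  next
    case False
    then have "\<not> m \<le> length (power_word \<theta> (Suc n))"
      using length_pos[OF \<theta>] unfolding m length_power_word by (simp only: mult_le_cancel2) simp
    then have "window (power_word \<theta> (Suc n)) = \<one>\<^bsub>FR F\<^esub>"
      unfolding window_def by simp
    moreover have "Suc (Suc n) - k = 0" "Suc n - k = 0"
      using False by auto
    ultimately show ?thesis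
      unfolding eq Suc k_def[symmetric] by (simp add: bar_0 flip: one_FR[of F])
  qed
qed

lemma d_\<Phi>_power:
  assumes \<theta>: "\<theta> \<in> \<Psi>"
  shows "cone.FR.d (\<Phi> (\<theta> [^]\<^bsub>F\<^esub> (z::int))) (bar \<theta> (real_of_int z)) \<le> real m * B"
proof -
  have nat_case: "cone.FR.d (\<Phi> (power_word \<theta> n)) (bar \<theta> (real n)) \<le> real m * B" for n
  proof -
    define s where "s = Suc n - m div length \<theta>"
    have "m div length \<theta> \<ge> 1"
      using le_m[OF \<theta>] length_pos[OF \<theta>] by (simp add: div_greater_zero_iff Suc_le_eq)
    moreover have "m div length \<theta> \<le> m"
      by (rule div_le_dividend)
    ultimately have s: "s \<le> n" "n - s \<le> m"
      unfolding s_def by linarith+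
    have "cone.FR.d (bar \<theta> (real s)) (bar \<theta> (real n)) = FR_norm F \<nu> (bar \<theta> (real n - real s))"
      using \<Psi>_F[OF \<theta>] by (simp add: cone.FR.d_eq bar_inv_FR bar_mult_FR)
    also have "\<dots> \<le> \<bar>real n - real s\<bar> * \<nu> \<theta>"
      using \<Psi>_F[OF \<theta>] by (rule cone.fn_bar_le)
    also have "\<dots> \<le> real m * B"
      using s le_B[OF \<theta>] G.norm_nonneg[OF \<Psi>_F[OF \<theta>]] by (intro mult_mono) auto
    finally show ?thesis
      by (simp add: \<Phi>_power[OF \<theta>] s_def)
  qed
  have pow: "\<theta> [^]\<^bsub>F\<^esub> n = power_word \<theta> n" for n :: nat
    using \<theta> \<Psi> by (intro \<Theta>_pow) auto
  show ?thesis
  proof (cases z rule: int_cases2)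
    case (nonneg n)
    then show ?thesis
      using nat_case[of n] by (simp add: int_pow_int pow)
  next
    case (nonpos n)
    have "\<theta> [^]\<^bsub>F\<^esub> z = winv (power_word \<theta> n)"
      using nonpos F.int_pow_neg_int[OF \<Psi>_F[OF \<theta>], of n] \<Psi>_F[OF \<theta>] F.nat_pow_closed[OF \<Psi>_F[OF \<theta>], of n]
      by (simp add: pow inv_F)
    moreover have "bar \<theta> (real_of_int z) = inv\<^bsub>FR F\<^esub> (bar \<theta> (real n))"
      using nonpos \<Psi>_F[OF \<theta>] by (simp add: bar_inv_FR)
    ultimately show ?thesis
      using nat_case[of n] \<Psi>_F[OF \<theta>] by (simp add: \<Phi>_winv cone.FR.d_inv)
  qed
qed

end

context pure_representatives
begin

text \<open>The map \<open>\<Phi>\<close> bounds the pseudonorm of \<open>x\<close> by a constant times \<open>\<nu> (path x t) / t\<close> up to an error of order \<open>1 / t\<close>,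
  and a nonempty \<open>x\<close> has positive pseudonorm.\<close>

lemma sublinear_path_trivial:
  assumes x: "x \<in> carrier (free_real \<Theta>)" and lim: "((\<lambda>t. \<nu> (cone.path x t) / t) \<longlongrightarrow> 0) at_top"
  shows "x = []"
proof (rule ccontr)
  assume "x \<noteq> []"
  define \<Psi> where "\<Psi> = fst ` set x"
  have \<Psi>: "\<Psi> \<subseteq> \<Theta>" "finite \<Psi>"
    using x by (auto simp: \<Psi>_def carrier_free_real)
  interpret periodic_windows A \<Theta> \<Psi>
    by unfold_locales (rule \<Psi>)+
  have xF: "fst ` set x \<subseteq> carrier F"
    using \<Psi> \<Theta>_F by (auto simp: \<Psi>_def)
  have x_FR: "x \<in> carrier (FR F)" "x \<in> carrier (free_real (carrier F))"
    using free_real_mono[OF _ x, of "carrier F"] \<Theta>_F by (auto simp: FR_def)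
  define C where "C = 4 * real m * B * real (length x)"
  have bound: "FR_norm F \<nu> x \<le> 13 * real m * B * (\<nu> (cone.path x t) / t) + (C + cone.total_weight x) / t"
    if t: "t \<in> {0<..}" for t
  proof -
    let ?gs = "map (\<lambda>(g, r). g [^]\<^bsub>F\<^esub> \<lfloor>r * t\<rfloor>) x"
    let ?bs = "map (\<lambda>(g, r). bar g (real_of_int \<lfloor>r * t\<rfloor>)) x"
    have path: "cone.path x t = list_mult F ?gs"
      using t by (simp add: cone.path_def)
    have approx: "cone.approx x t = list_mult (FR F) ?bs"
      using t by (simp add: cone.approx_def word_eq_list_mult[of _ "carrier F"] FR_def cone.floor_word_def
          comp_def case_prod_unfold)
    have gs: "set ?gs \<subseteq> carrier F"
      using xF by auto
    have bs: "set ?bs \<subseteq> carrier (FR F)"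
      using xF by auto
    have \<Phi>gs: "set (map \<Phi> ?gs) \<subseteq> carrier (FR F)"
      by auto
    have p: "cone.path x t \<in> carrier F"
      unfolding path using gs by (rule F.list_mult_closed)
    have a: "cone.approx x t \<in> carrier (FR F)"
      using cone.approx_int[OF xF t] by auto
    have "cone.FR.d (list_mult (FR F) (map \<Phi> ?gs)) (list_mult (FR F) ?bs)
        \<le> (\<Sum>(a, b)\<leftarrow>zip (map \<Phi> ?gs) ?bs. cone.FR.d a b)"
      by (rule cone.FR.d_list_mult[OF _ \<Phi>gs bs]) simp
    also have "\<dots> = (\<Sum>(g, r)\<leftarrow>x. cone.FR.d (\<Phi> (g [^]\<^bsub>F\<^esub> \<lfloor>r * t\<rfloor>)) (bar g (real_of_int \<lfloor>r * t\<rfloor>)))"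
      by (simp add: zip_map_map zip_same_conv_map comp_def case_prod_unfold)
    also have "\<dots> \<le> (\<Sum>(g, r)\<leftarrow>x. real m * B)"
    proof (rule sum_list_mono)
      fix p assume "p \<in> set x"
      then have "fst p \<in> \<Psi>"
        by (simp add: \<Psi>_def)
      from d_\<Phi>_power[OF this]
      show "(case p of (g, r) \<Rightarrow> cone.FR.d (\<Phi> (g [^]\<^bsub>F\<^esub> \<lfloor>r * t\<rfloor>)) (bar g (real_of_int \<lfloor>r * t\<rfloor>)))
          \<le> (case p of (g, r) \<Rightarrow> real m * B)"
        by (simp add: case_prod_unfold)
    qed
    also have "\<dots> = real m * B * real (length x)"
      by (simp add: case_prod_unfold sum_list_triv)
    finally have "cone.FR.d (list_mult (FR F) (map \<Phi> ?gs)) (cone.approx x t) \<le> real m * B * real (length x)"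
      by (simp only: approx)
    moreover have "cone.FR.d (\<Phi> (cone.path x t)) (list_mult (FR F) (map \<Phi> ?gs)) \<le> 3 * real m * B * real (length x)"
      using \<Phi>_list_mult[OF gs] by (simp add: path)
    moreover have "list_mult (FR F) (map \<Phi> ?gs) \<in> carrier (FR F)"
      using \<Phi>gs by (rule cone.FR.list_mult_closed)
    ultimately have "cone.FR.d (\<Phi> (cone.path x t)) (cone.approx x t) \<le> C"
      using cone.FR.d_triangle[OF _ _ a, of "\<Phi> (cone.path x t)" "list_mult (FR F) (map \<Phi> ?gs)"]
      by (simp add: C_def)
    then have fn_a: "FR_norm F \<nu> (cone.approx x t) \<le> 13 * real m * B * \<nu> (cone.path x t) + C"
      using cone.FR.norm_diff_le[OF _ a, of "\<Phi> (cone.path x t)"] \<Phi>_le_word_norm[OF p] by fastforce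
    have psi_a: "psi F (1 / t) (cone.approx x t) \<in> carrier (FR F)"
      using a by blast
    have "FR_norm F \<nu> x \<le> FR_norm F \<nu> (psi F (1 / t) (cone.approx x t)) + cone.FR.d (psi F (1 / t) (cone.approx x t)) x"
      using cone.FR.norm_diff_le[OF psi_a x_FR(1)] by simp
    also have "cone.FR.d (psi F (1 / t) (cone.approx x t)) x \<le> cone.total_weight x / t"
      using cone.d_approx[OF xF t] x_FR by (simp add: cone.word_FR_normal)
    also have "FR_norm F \<nu> (psi F (1 / t) (cone.approx x t)) \<le> (1 / t) * FR_norm F \<nu> (cone.approx x t)"
      using a t by (intro cone.fn_psi_le) auto
    also have "\<dots> \<le> (1 / t) * (13 * real m * B * \<nu> (cone.path x t) + C)"
      using fn_a t by (intro mult_left_mono) auto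
    finally show ?thesis
      by (simp add: add_divide_distrib)
  qed
  have "((\<lambda>t. (C + cone.total_weight x) / t) \<longlongrightarrow> 0) at_top"
    by (rule tendsto_divide_0[OF tendsto_const filterlim_at_top_imp_at_infinity[OF filterlim_ident]])
  then have "((\<lambda>t. 13 * real m * B * (\<nu> (cone.path x t) / t) + (C + cone.total_weight x) / t)
      \<longlongrightarrow> 13 * real m * B * 0 + 0) at_top"
    by (intro tendsto_add tendsto_mult tendsto_const lim)
  moreover have "eventually (\<lambda>t. FR_norm F \<nu> x
      \<le> 13 * real m * B * (\<nu> (cone.path x t) / t) + (C + cone.total_weight x) / t) at_top"
    by (rule eventually_mono[OF eventually_gt_at_top[of 0]]) (rule bound, simp)
  ultimately have "FR_norm F \<nu> x \<le> 13 * real m * B * 0 + 0"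
    by (rule tendsto_lowerbound) simp
  moreover have "0 < cone.W.wnorm x"
  proof (rule cone.W.wnorm_pos[OF x_FR(2) \<open>x \<noteq> []\<close>])
    fix g assume "g \<in> fst ` set x"
    then have "g \<in> carrier F" "g \<noteq> []"
      using xF \<Psi>(1) \<Theta>_not_Nil by (auto simp: \<Psi>_def)
    from word_norm_ge_1[OF this] show "0 < \<nu> g"
      by simp
  qed
  ultimately show False
    by (simp add: FR_norm_def FR_def)
qed

end

section \<open>Comparison of the free products over the group and over the representatives\<close>

lemma FR_hom_eqI:
  assumes "group M" "f \<in> hom (FR G) M" "f' \<in> hom (FR G) M"
    and eq: "\<And>g r. g \<in> carrier G \<Longrightarrow> f (bar g r) = f' (bar g r)" and x: "x \<in> carrier (FR G)"
  shows "f x = f' x"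
proof -
  interpret FR: group "FR G" by (rule group_FR)
  interpret M: group M by fact
  interpret f: group_hom "FR G" M f by unfold_locales fact
  interpret f': group_hom "FR G" M f' by unfold_locales fact
  have "fst ` set W \<subseteq> carrier G \<Longrightarrow> f (word W) = f' (word W)" for W
  proof (induction W)
    case Nil
    then show ?case
      using f.hom_one f'.hom_one by (simp add: one_FR)
  next
    case (Cons p W)
    have "word W \<in> carrier (FR G)"
      using Cons.prems by (simp add: FR_def word_closed)
    moreover have "bar (fst p) (snd p) \<in> carrier (FR G)"
      using Cons.prems by (simp add: FR_def bar_closed)
    moreover have "word (p # W) = bar (fst p) (snd p) \<otimes>\<^bsub>FR G\<^esub> word W"
      by (simp add: word_Cons push_syl_eq_mult[of _ _ "carrier G"] FR_def)
    ultimately show ?case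
      using Cons eq[of "fst p" "snd p"] by simp
  qed
  moreover have "fst ` set x \<subseteq> carrier G" "word x = x"
    using x by (auto simp: FR_def carrier_free_real word_normal)
  ultimately show ?thesis
    by metis
qed

context directional_cone
begin

lemma path_bar:
  assumes "g \<in> carrier G" "t \<in> T" shows "path (bar g r) t = g [^]\<^bsub>G\<^esub> \<lfloor>r * t\<rfloor>"
  using assms by (simp add: path_def bar_def)

lemma eta_eqI_bounded:
  assumes x: "x \<in> carrier (FR G)" and y: "y \<in> carrier (FR G)"
    and bound: "\<And>t. t \<in> T \<Longrightarrow> G.d (path x t) (path y t) \<le> c"
  shows "eta G \<nu> x = eta G \<nu> y"
proof (rule eta_eqI_sublinear[OF x y])
  show "((\<lambda>t. G.d (path x t) (path y t) / t) \<longlongrightarrow> 0) at_top"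
  proof (rule Lim_null_comparison)
    show "eventually (\<lambda>t. norm (G.d (path x t) (path y t) / t) \<le> c / t) at_top"
      using eventually_gt_at_top[of 0]
    proof eventually_elim
      case (elim t)
      then show ?case
        using bound[of t] G.d_nonneg[of "path x t" "path y t"] by (simp add: divide_right_mono)
    qed
    show "((\<lambda>t. c / t) \<longlongrightarrow> 0) at_top"
      by (rule tendsto_divide_0[OF tendsto_const filterlim_at_top_imp_at_infinity[OF filterlim_ident]])
  qed
qed

text \<open>The two paths are \<open>k \<theta>\<^sup>i k\<^sup>-\<^sup>1\<close> and \<open>\<theta>\<^sup>j\<close> with \<open>i = z \<lfloor>r t\<rfloor>\<close> and \<open>j = \<lfloor>z r t\<rfloor>\<close>, and \<open>\<bar>i - j\<bar> \<le> \<bar>z\<bar> + 1\<close>.\<close>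

lemma eta_bar_conj:
  fixes z :: int
  assumes \<theta>: "\<theta> \<in> carrier G" and k: "k \<in> carrier G"
    and g: "g = k \<otimes>\<^bsub>G\<^esub> \<theta> [^]\<^bsub>G\<^esub> z \<otimes>\<^bsub>G\<^esub> inv\<^bsub>G\<^esub> k"
  shows "eta G \<nu> (bar g r) = eta G \<nu> (bar \<theta> (real_of_int z * r))"
proof (rule eta_eqI_bounded)
  have gG: "g \<in> carrier G"
    using \<theta> k by (simp add: g)
  then show "bar g r \<in> carrier (FR G)" "bar \<theta> (real_of_int z * r) \<in> carrier (FR G)"
    using \<theta> by auto
  fix t assume t: "t \<in> T"
  define i where "i = z * \<lfloor>r * t\<rfloor>"
  define j where "j = \<lfloor>real_of_int z * r * t\<rfloor>"
  have path_g: "path (bar g r) t = k \<otimes>\<^bsub>G\<^esub> \<theta> [^]\<^bsub>G\<^esub> i \<otimes>\<^bsub>G\<^esub> inv\<^bsub>G\<^esub> k"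
    using \<theta> k gG t by (simp add: path_bar) (simp add: g i_def G.conj_int_pow G.int_pow_pow)
  have path_\<theta>: "path (bar \<theta> (real_of_int z * r)) t = \<theta> [^]\<^bsub>G\<^esub> j"
    using \<theta> t by (simp add: path_bar j_def)
  have a: "\<theta> [^]\<^bsub>G\<^esub> i \<in> carrier G" "\<theta> [^]\<^bsub>G\<^esub> j \<in> carrier G"
    using \<theta> by auto
  have "G.d (k \<otimes>\<^bsub>G\<^esub> \<theta> [^]\<^bsub>G\<^esub> i \<otimes>\<^bsub>G\<^esub> inv\<^bsub>G\<^esub> k) (\<one>\<^bsub>G\<^esub> \<otimes>\<^bsub>G\<^esub> \<theta> [^]\<^bsub>G\<^esub> i \<otimes>\<^bsub>G\<^esub> \<one>\<^bsub>G\<^esub>)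
      \<le> G.d (k \<otimes>\<^bsub>G\<^esub> \<theta> [^]\<^bsub>G\<^esub> i) (\<one>\<^bsub>G\<^esub> \<otimes>\<^bsub>G\<^esub> \<theta> [^]\<^bsub>G\<^esub> i) + G.d (inv\<^bsub>G\<^esub> k) \<one>\<^bsub>G\<^esub>"
    using k a by (intro G.d_mult) auto
  also have "G.d (k \<otimes>\<^bsub>G\<^esub> \<theta> [^]\<^bsub>G\<^esub> i) (\<one>\<^bsub>G\<^esub> \<otimes>\<^bsub>G\<^esub> \<theta> [^]\<^bsub>G\<^esub> i) = \<nu> k"
    using k a by (simp only: G.d_mult_right G.one_closed) (simp add: G.d_one G.d_sym[of k])
  also have "G.d (inv\<^bsub>G\<^esub> k) \<one>\<^bsub>G\<^esub> = \<nu> k"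
    using k by (simp add: G.d_one G.d_sym[of _ "\<one>\<^bsub>G\<^esub>"] G.norm_inv)
  finally have conj: "G.d (k \<otimes>\<^bsub>G\<^esub> \<theta> [^]\<^bsub>G\<^esub> i \<otimes>\<^bsub>G\<^esub> inv\<^bsub>G\<^esub> k) (\<theta> [^]\<^bsub>G\<^esub> i) \<le> 2 * \<nu> k"
    using a by simp
  have "\<bar>real_of_int (j - i)\<bar> \<le> \<bar>real_of_int z\<bar> + 1"
  proof -
    have "\<bar>real_of_int \<lfloor>r * t\<rfloor> - r * t\<bar> \<le> 1"
      by linarith
    then have "\<bar>real_of_int z\<bar> * \<bar>real_of_int \<lfloor>r * t\<rfloor> - r * t\<bar> \<le> \<bar>real_of_int z\<bar> * 1"
      by (intro mult_left_mono) auto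
    then have "\<bar>real_of_int i - real_of_int z * r * t\<bar> \<le> \<bar>real_of_int z\<bar>"
      unfolding abs_mult[symmetric] by (simp add: i_def right_diff_distrib mult.assoc)
    moreover have "\<bar>real_of_int j - real_of_int z * r * t\<bar> \<le> 1"
      unfolding j_def by linarith
    ultimately show ?thesis
      by linarith
  qed
  then have "\<bar>real_of_int (j - i)\<bar> * \<nu> \<theta> \<le> (\<bar>real_of_int z\<bar> + 1) * \<nu> \<theta>"
    using \<theta> by (intro mult_right_mono G.norm_nonneg)
  moreover have "G.d (\<theta> [^]\<^bsub>G\<^esub> i) (\<theta> [^]\<^bsub>G\<^esub> j) = \<nu> (\<theta> [^]\<^bsub>G\<^esub> (j - i))"
    using \<theta> by (simp add: G.d_eq G.int_pow_mult[symmetric] G.int_pow_neg[symmetric])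
  ultimately have "G.d (\<theta> [^]\<^bsub>G\<^esub> i) (\<theta> [^]\<^bsub>G\<^esub> j) \<le> (\<bar>real_of_int z\<bar> + 1) * \<nu> \<theta>"
    using G.norm_int_pow_le[OF \<theta>, of "j - i"] by simp
  with conj show "G.d (path (bar g r) t) (path (bar \<theta> (real_of_int z * r)) t)
      \<le> 2 * \<nu> k + (\<bar>real_of_int z\<bar> + 1) * \<nu> \<theta>"
    unfolding path_g path_\<theta>
    using G.d_triangle[of "k \<otimes>\<^bsub>G\<^esub> \<theta> [^]\<^bsub>G\<^esub> i \<otimes>\<^bsub>G\<^esub> inv\<^bsub>G\<^esub> k" "\<theta> [^]\<^bsub>G\<^esub> i" "\<theta> [^]\<^bsub>G\<^esub> j"] a k by simp
qed

lemma L_Metric_space: "Metric_space (carrier L) L.d"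
  using C.Quot_Metric_space by (simp add: L_eq \<mu>_eq)

lemma L_d_0: "l \<in> carrier L \<Longrightarrow> l' \<in> carrier L \<Longrightarrow> L.d l l' = 0 \<Longrightarrow> l = l'"
  using Metric_space.zero[OF L_Metric_space] by blast

end

context pure_representatives
begin

abbreviation "\<tau> \<equiv> stable_length F \<nu>"
abbreviation "K \<equiv> FR_sub F \<Theta>"
abbreviation "\<kappa> \<equiv> FR_sub_norm F \<Theta> \<tau>"

lemma K_eq: "K = free_real \<Theta>"
  using \<Theta>_F by (intro FR_sub_eq_free_real) auto

sublocale WK: weighted \<Theta> "stable_length (free_group A) (conj_word_norm (free_group A) (free_gen ` A))"
  by unfold_locales (rule G.stable_length_nonneg[OF \<Theta>_F])

lemma \<kappa>_eq: "\<kappa> = WK.wnorm"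
  by (rule ext) (simp add: FR_sub_norm_def K_eq)

sublocale K: pseudonormed_group "FR_sub (free_group A) \<Theta>"
  "FR_sub_norm (free_group A) \<Theta> (stable_length (free_group A) (conj_word_norm (free_group A) (free_gen ` A)))"
  using WK.pseudonormed_wnorm by (simp add: K_eq \<kappa>_eq)

lemma K_FR: "x \<in> carrier K \<Longrightarrow> x \<in> carrier (FR F)"
  using free_real_mono[of \<Theta> "carrier F"] \<Theta>_F by (auto simp: K_eq FR_def)

lemma K_mult: "x \<otimes>\<^bsub>K\<^esub> y = x \<otimes>\<^bsub>FR F\<^esub> y"
  by (simp add: FR_sub_def)

lemma bar_K: "\<theta> \<in> \<Theta> \<Longrightarrow> bar \<theta> r \<in> carrier K"
  by (simp add: K_eq bar_closed)

text \<open>The representative is that of a root of \<open>g\<close>; it is conjugate to the root or to its inverse, hence the sign of the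
  exponent.\<close>

lemma conjugate_to_power:
  assumes g: "g \<in> carrier F" "g \<noteq> []"
  shows "\<exists>\<theta>\<in>\<Theta>. \<exists>z::int. \<exists>k\<in>carrier F. g = k \<otimes>\<^bsub>F\<^esub> \<theta> [^]\<^bsub>F\<^esub> z \<otimes>\<^bsub>F\<^esub> inv\<^bsub>F\<^esub> k"
proof -
  obtain h n where h: "pure_elem F h" "g = h [^]\<^bsub>F\<^esub> (n::nat)"
    using root_exists[OF g] by blast
  have hF: "h \<in> carrier F"
    using h(1) by (simp add: pure_elem_def)
  obtain \<theta> k where \<theta>: "\<theta> \<in> \<Theta>" and k: "k \<in> carrier F"
    and or: "\<theta> = k \<otimes>\<^bsub>F\<^esub> h \<otimes>\<^bsub>F\<^esub> inv\<^bsub>F\<^esub> k \<or> \<theta> = k \<otimes>\<^bsub>F\<^esub> inv\<^bsub>F\<^esub> h \<otimes>\<^bsub>F\<^esub> inv\<^bsub>F\<^esub> k"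
    using represented[OF h(1)] unfolding conj_or_inv_def by blast
  have "\<exists>\<epsilon>::int. h = inv\<^bsub>F\<^esub> k \<otimes>\<^bsub>F\<^esub> \<theta> [^]\<^bsub>F\<^esub> \<epsilon> \<otimes>\<^bsub>F\<^esub> inv\<^bsub>F\<^esub> (inv\<^bsub>F\<^esub> k)"
    using or
  proof
    assume "\<theta> = k \<otimes>\<^bsub>F\<^esub> h \<otimes>\<^bsub>F\<^esub> inv\<^bsub>F\<^esub> k"
    then have "h = inv\<^bsub>F\<^esub> k \<otimes>\<^bsub>F\<^esub> \<theta> [^]\<^bsub>F\<^esub> (1::int) \<otimes>\<^bsub>F\<^esub> inv\<^bsub>F\<^esub> (inv\<^bsub>F\<^esub> k)"
      using hF k by (simp add: F.group_normalize)
    then show ?thesis ..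
  next
    assume "\<theta> = k \<otimes>\<^bsub>F\<^esub> inv\<^bsub>F\<^esub> h \<otimes>\<^bsub>F\<^esub> inv\<^bsub>F\<^esub> k"
    then have "h = inv\<^bsub>F\<^esub> k \<otimes>\<^bsub>F\<^esub> \<theta> [^]\<^bsub>F\<^esub> (- 1::int) \<otimes>\<^bsub>F\<^esub> inv\<^bsub>F\<^esub> (inv\<^bsub>F\<^esub> k)"
      using hF k by (simp add: F.int_pow_neg F.group_normalize)
    then show ?thesis ..
  qed
  then obtain \<epsilon> :: int where "h = inv\<^bsub>F\<^esub> k \<otimes>\<^bsub>F\<^esub> \<theta> [^]\<^bsub>F\<^esub> \<epsilon> \<otimes>\<^bsub>F\<^esub> inv\<^bsub>F\<^esub> (inv\<^bsub>F\<^esub> k)"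
    by blast
  then have "g = inv\<^bsub>F\<^esub> k \<otimes>\<^bsub>F\<^esub> (\<theta> [^]\<^bsub>F\<^esub> \<epsilon>) [^]\<^bsub>F\<^esub> n \<otimes>\<^bsub>F\<^esub> inv\<^bsub>F\<^esub> (inv\<^bsub>F\<^esub> k)"
    unfolding h(2) using k \<Theta>_F[OF \<theta>] by (simp only: F.conj_nat_pow F.inv_closed F.int_pow_closed)
  moreover have "(\<theta> [^]\<^bsub>F\<^esub> \<epsilon>) [^]\<^bsub>F\<^esub> n = \<theta> [^]\<^bsub>F\<^esub> (\<epsilon> * int n)"
    using F.int_pow_pow[OF \<Theta>_F[OF \<theta>], of \<epsilon> "int n"] by (simp add: int_pow_int)
  ultimately have "g = inv\<^bsub>F\<^esub> k \<otimes>\<^bsub>F\<^esub> \<theta> [^]\<^bsub>F\<^esub> (\<epsilon> * int n) \<otimes>\<^bsub>F\<^esub> inv\<^bsub>F\<^esub> (inv\<^bsub>F\<^esub> k)"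
    by simp
  then show ?thesis
    using \<theta> k F.inv_closed by blast
qed

definition rep :: "('a \<times> bool) list \<Rightarrow> ('a \<times> bool) list \<times> int" where
  "rep g = (SOME (\<theta>, z). \<theta> \<in> \<Theta> \<and> (\<exists>k\<in>carrier F. g = k \<otimes>\<^bsub>F\<^esub> \<theta> [^]\<^bsub>F\<^esub> z \<otimes>\<^bsub>F\<^esub> inv\<^bsub>F\<^esub> k))"

lemma rep:
  assumes "g \<in> carrier F" "g \<noteq> []"
  shows "fst (rep g) \<in> \<Theta>"
    and "\<exists>k\<in>carrier F. g = k \<otimes>\<^bsub>F\<^esub> fst (rep g) [^]\<^bsub>F\<^esub> snd (rep g) \<otimes>\<^bsub>F\<^esub> inv\<^bsub>F\<^esub> k"
proof -
  have "\<exists>p. case p of (\<theta>, z) \<Rightarrow> \<theta> \<in> \<Theta> \<and> (\<exists>k\<in>carrier F. g = k \<otimes>\<^bsub>F\<^esub> \<theta> [^]\<^bsub>F\<^esub> (z::int) \<otimes>\<^bsub>F\<^esub> inv\<^bsub>F\<^esub> k)"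
    using conjugate_to_power[OF assms] by auto
  from someI_ex[OF this]
  show "fst (rep g) \<in> \<Theta>"
    and "\<exists>k\<in>carrier F. g = k \<otimes>\<^bsub>F\<^esub> fst (rep g) [^]\<^bsub>F\<^esub> snd (rep g) \<otimes>\<^bsub>F\<^esub> inv\<^bsub>F\<^esub> k"
    unfolding rep_def by (simp_all add: case_prod_unfold)
qed

text \<open>The identity has no root, and its syllables are already trivial in the cone.\<close>

definition \<sigma>_bar :: "('a \<times> bool) list \<Rightarrow> real \<Rightarrow> (('a \<times> bool) list \<times> real) list" where
  "\<sigma>_bar g r = (if g = [] then [] else bar (fst (rep g)) (real_of_int (snd (rep g)) * r))"

definition \<sigma> where "\<sigma> = lift K \<sigma>_bar"

lemma one_K: "\<one>\<^bsub>K\<^esub> = []"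
  by (simp add: K_eq one_free_real)

lemma \<sigma>_family: "additive_family K (carrier F) UNIV \<sigma>_bar"
proof
  fix g assume g: "g \<in> carrier F"
  show "\<sigma>_bar g r \<in> carrier K" for r
    using rep(1)[OF g] bar_K K.one_closed by (auto simp: \<sigma>_bar_def one_K)
  show "\<sigma>_bar g (r + s) = \<sigma>_bar g r \<otimes>\<^bsub>K\<^esub> \<sigma>_bar g s" for r s
    by (simp add: \<sigma>_bar_def K_eq bar_mult distrib_left) (simp add: mult_free_real)
qed simp

lemma \<sigma>_hom: "\<sigma> \<in> hom (FR F) K"
  unfolding \<sigma>_def FR_def by (rule lift_hom[OF \<sigma>_family])

lemma \<sigma>_closed: "y \<in> carrier (FR F) \<Longrightarrow> \<sigma> y \<in> carrier K"
  using \<sigma>_hom by (auto simp: hom_def)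

lemma \<sigma>_bar: "g \<in> carrier F \<Longrightarrow> \<sigma> (bar g r) = \<sigma>_bar g r"
  unfolding \<sigma>_def by (rule additive_family.lift_bar[OF \<sigma>_family]) auto

lemma \<kappa>_bar_le: "\<theta> \<in> \<Theta> \<Longrightarrow> \<kappa> (bar \<theta> r) \<le> \<bar>r\<bar> * \<tau> \<theta>"
  unfolding \<kappa>_eq by (rule WK.wnorm_bar_le)

text \<open>For \<open>g = k \<theta>\<^sup>z k\<^sup>-\<^sup>1\<close> the weight of \<open>\<theta>(z r)\<close> is \<open>\<bar>r\<bar> \<bar>z\<bar> \<tau> \<theta> \<le> \<bar>r\<bar> \<nu> (\<theta>\<^sup>z) = \<bar>r\<bar> \<nu> g\<close>.\<close>

lemma \<kappa>_\<sigma>_le: assumes "y \<in> carrier (FR F)" shows "\<kappa> (\<sigma> y) \<le> FR_norm F \<nu> y"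
proof (rule cone.hom_le_fn[OF K.pseudonormed_group_axioms \<sigma>_hom _ assms])
  fix g r assume g: "g \<in> carrier F"
  show "\<kappa> (\<sigma> (bar g r)) \<le> \<bar>r\<bar> * \<nu> g"
  proof (cases "g = []")
    case True
    then show ?thesis
      using g G.norm_nonneg[of "[]"] K.norm_one by (simp add: \<sigma>_bar \<sigma>_bar_def one_K)
  next
    case False
    obtain \<theta> z where \<theta>z: "rep g = (\<theta>, z)" by (cases "rep g")
    obtain k where k: "k \<in> carrier F" "g = k \<otimes>\<^bsub>F\<^esub> \<theta> [^]\<^bsub>F\<^esub> z \<otimes>\<^bsub>F\<^esub> inv\<^bsub>F\<^esub> k"
      using rep(2)[OF g False] by (auto simp: \<theta>z)
    have \<theta>: "\<theta> \<in> \<Theta>"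
      using rep(1)[OF g False] by (simp add: \<theta>z)
    have "\<kappa> (\<sigma> (bar g r)) \<le> \<bar>real_of_int z * r\<bar> * \<tau> \<theta>"
      using \<kappa>_bar_le[OF \<theta>] g False by (simp add: \<sigma>_bar \<sigma>_bar_def \<theta>z)
    also have "\<dots> = \<bar>r\<bar> * (\<bar>real_of_int z\<bar> * \<tau> \<theta>)"
      by (simp add: abs_mult)
    also have "\<dots> \<le> \<bar>r\<bar> * \<nu> (\<theta> [^]\<^bsub>F\<^esub> z)"
      by (intro mult_left_mono G.stable_length_int_le \<Theta>_F \<theta>) auto
    also have "\<nu> (\<theta> [^]\<^bsub>F\<^esub> z) = \<nu> g"
      using k \<Theta>_F[OF \<theta>] by (simp add: G.norm_conj)
    finally show ?thesis .
  qed
qed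

abbreviation "\<eta> \<equiv> eta F \<nu>"

lemma \<eta>_bar_Nil: "\<eta> (bar [] r) = \<one>\<^bsub>cone.L\<^esub>"
proof -
  have "\<eta> (bar [] r) = \<eta> (bar [] (real_of_int 0 * r))"
    by (rule cone.eta_bar_conj[where k = "\<one>\<^bsub>F\<^esub>"]) (use F.one_closed in \<open>auto simp flip: one_F\<close>)
  then show ?thesis
    using cone.eta.hom_one by (simp add: bar_0 one_FR)
qed

lemma K_hom_FR: "f \<in> hom (FR F) M \<Longrightarrow> f \<in> hom K M"
  by (auto simp: hom_def K_mult K_FR)

lemma \<eta>_\<sigma>: assumes "y \<in> carrier (FR F)" shows "\<eta> (\<sigma> y) = \<eta> y"
proof (rule FR_hom_eqI[of _ "\<lambda>y. \<eta> (\<sigma> y)", OF cone.L.group_axioms _ cone.eta_hom _ assms])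
  show "(\<lambda>y. \<eta> (\<sigma> y)) \<in> hom (FR F) cone.L"
    using hom_compose[OF \<sigma>_hom K_hom_FR[OF cone.eta_hom]] by (simp add: comp_def)
  fix g r assume g: "g \<in> carrier F"
  show "\<eta> (\<sigma> (bar g r)) = \<eta> (bar g r)"
  proof (cases "g = []")
    case True
    then show ?thesis
      using g cone.eta.hom_one by (simp add: \<sigma>_bar \<sigma>_bar_def \<eta>_bar_Nil one_FR)
  next
    case False
    obtain k where k: "k \<in> carrier F" "g = k \<otimes>\<^bsub>F\<^esub> fst (rep g) [^]\<^bsub>F\<^esub> snd (rep g) \<otimes>\<^bsub>F\<^esub> inv\<^bsub>F\<^esub> k"
      using rep(2)[OF g False] by blast
    have "\<eta> (bar g r) = \<eta> (bar (fst (rep g)) (real_of_int (snd (rep g)) * r))"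
      by (rule cone.eta_bar_conj[OF \<Theta>_F[OF rep(1)[OF g False]] k])
    then show ?thesis
      using g False by (simp add: \<sigma>_bar \<sigma>_bar_def)
  qed
qed

text \<open>The stable length as a weight is no loss: \<open>\<theta>(r)\<close> and \<open>(\<theta>\<^sup>n)(r / n)\<close> have the same image in the cone,
  and for large \<open>n\<close> the norm of the latter is close to \<open>\<bar>r\<bar> * \<tau> \<theta>\<close>.\<close>

lemma \<eta>_lift:
  assumes "expr \<Theta> \<tau> x c" "\<epsilon> > 0"
  shows "\<exists>y\<in>carrier (FR F). FR_norm F \<nu> y \<le> c + \<epsilon> \<and> \<eta> y = \<eta> x"
  using assms
proof (induction arbitrary: \<epsilon> rule: expr.induct)
  case expr_one
  then show ?case
    using cone.FR.one_closed cone.FR.norm_one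
    by (intro bexI[of _ "\<one>\<^bsub>FR F\<^esub>"]) (auto simp: one_FR one_free_real)
next
  case (expr_step x c h \<theta> r)
  have \<theta>: "\<theta> \<in> carrier F"
    using expr_step.hyps \<Theta>_F by blast
  have hx: "h \<in> carrier (FR F)" "x \<in> carrier (FR F)"
    using expr_step.hyps WK.expr_closed[OF expr_step.hyps(1)] K_FR by (auto simp: K_eq)
  obtain y where y: "y \<in> carrier (FR F)" "FR_norm F \<nu> y \<le> c + \<epsilon> / 2" "\<eta> y = \<eta> x"
    using expr_step.IH[of "\<epsilon> / 2"] expr_step.prems by auto
  define \<delta> where "\<delta> = \<epsilon> / 2 / (\<bar>r\<bar> + 1)"
  have \<delta>: "\<delta> > 0" "\<bar>r\<bar> * \<delta> \<le> \<epsilon> / 2"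
    using expr_step.prems by (auto simp: \<delta>_def field_simps)
  obtain n :: nat where n: "n \<ge> 1" "\<nu> (\<theta> [^]\<^bsub>F\<^esub> n) / real n < \<tau> \<theta> + \<delta>"
    using G.stable_length_approx[OF \<theta>, of "\<tau> \<theta> + \<delta>"] \<delta>(1) by auto
  define b where "b = bar (\<theta> [^]\<^bsub>F\<^esub> n) (r / real n)"
  have b: "b \<in> carrier (FR F)"
    using \<theta> by (simp add: b_def cone.bar_FR)
  have "FR_norm F \<nu> b \<le> \<bar>r / real n\<bar> * \<nu> (\<theta> [^]\<^bsub>F\<^esub> n)"
    unfolding b_def using \<theta> by (intro cone.fn_bar_le) auto
  also have "\<dots> = \<bar>r\<bar> * (\<nu> (\<theta> [^]\<^bsub>F\<^esub> n) / real n)"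
    by simp
  also have "\<dots> \<le> \<bar>r\<bar> * (\<tau> \<theta> + \<delta>)"
    using n by (intro mult_left_mono) auto
  finally have fn_b: "FR_norm F \<nu> b \<le> \<bar>r\<bar> * \<tau> \<theta> + \<epsilon> / 2"
    using \<delta>(2) by (simp add: distrib_left)
  have "\<eta> b = \<eta> (bar \<theta> (real_of_int (int n) * (r / real n)))"
    unfolding b_def by (rule cone.eta_bar_conj[OF \<theta> F.one_closed]) (use \<theta> in \<open>simp add: int_pow_int\<close>)
  then have \<eta>_b: "\<eta> b = \<eta> (bar \<theta> r)"
    using n by simp
  define y' where "y' = (h \<otimes>\<^bsub>FR F\<^esub> b \<otimes>\<^bsub>FR F\<^esub> inv\<^bsub>FR F\<^esub> h) \<otimes>\<^bsub>FR F\<^esub> y"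
  have "y' \<in> carrier (FR F)"
    using hx b y by (simp add: y'_def)
  moreover have "FR_norm F \<nu> y' \<le> FR_norm F \<nu> b + FR_norm F \<nu> y"
    unfolding y'_def using cone.FR.norm_mult[of "h \<otimes>\<^bsub>FR F\<^esub> b \<otimes>\<^bsub>FR F\<^esub> inv\<^bsub>FR F\<^esub> h" y] hx b y
    by (simp add: cone.FR.norm_conj)
  then have "FR_norm F \<nu> y' \<le> \<bar>r\<bar> * \<tau> \<theta> + c + \<epsilon>"
    using fn_b y by simp
  moreover have "\<eta> y' = \<eta> ((h \<otimes>\<^bsub>FR F\<^esub> bar \<theta> r \<otimes>\<^bsub>FR F\<^esub> inv\<^bsub>FR F\<^esub> h) \<otimes>\<^bsub>FR F\<^esub> x)"
    using hx b y \<theta> by (simp add: y'_def \<eta>_b cone.bar_FR)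
  moreover have "(h \<otimes>\<^bsub>FR F\<^esub> bar \<theta> r \<otimes>\<^bsub>FR F\<^esub> inv\<^bsub>FR F\<^esub> h) \<otimes>\<^bsub>FR F\<^esub> x
      = (h \<otimes>\<^bsub>WK.K\<^esub> bar \<theta> r \<otimes>\<^bsub>WK.K\<^esub> inv\<^bsub>WK.K\<^esub> h) \<otimes>\<^bsub>WK.K\<^esub> x"
  proof -
    have "inv\<^bsub>WK.K\<^esub> h = inv\<^bsub>FR F\<^esub> h"
    proof (rule cone.FR.inv_equality[symmetric])
      show "inv\<^bsub>WK.K\<^esub> h \<otimes>\<^bsub>FR F\<^esub> h = \<one>\<^bsub>FR F\<^esub>"
        using WK.K.l_inv[OF expr_step.hyps(2)] K_mult by (simp add: K_eq one_FR one_free_real)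
      show "inv\<^bsub>WK.K\<^esub> h \<in> carrier (FR F)"
        using WK.K.inv_closed[OF expr_step.hyps(2)] K_FR by (simp add: K_eq)
    qed (rule hx)
    then show ?thesis
      using K_mult by (simp add: K_eq)
  qed
  ultimately show ?case
    by (intro bexI[of _ y']) auto
qed

lemma \<kappa>_lift:
  assumes x: "x \<in> carrier K" and c: "\<kappa> x < c"
  obtains y where "y \<in> carrier (FR F)" "FR_norm F \<nu> y < c" "\<eta> y = \<eta> x"
proof -
  obtain c' where c': "expr \<Theta> \<tau> x c'" "c' < c"
    using WK.wnorm_approx[of x c] x c by (auto simp: K_eq \<kappa>_eq)
  obtain y where "y \<in> carrier (FR F)" "FR_norm F \<nu> y \<le> c' + (c - c') / 2" "\<eta> y = \<eta> x"
    using \<eta>_lift[OF c'(1), of "(c - c') / 2"] c'(2) by auto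
  moreover have "c' + (c - c') / 2 < c"
    using c'(2) by (simp add: field_simps)
  ultimately show ?thesis
    using that by force
qed

lemma \<mu>_\<eta>_le: assumes "x \<in> carrier K" shows "cone.\<mu> (\<eta> x) \<le> \<kappa> x"
proof (rule field_le_epsilon)
  fix \<epsilon> :: real assume "\<epsilon> > 0"
  then obtain y where "y \<in> carrier (FR F)" "FR_norm F \<nu> y < \<kappa> x + \<epsilon>" "\<eta> y = \<eta> x"
    using \<kappa>_lift[OF assms, of "\<kappa> x + \<epsilon>"] by auto
  then show "cone.\<mu> (\<eta> x) \<le> \<kappa> x + \<epsilon>"
    using cone.\<mu>_eta_le[of y] by simp
qed

text \<open>The cone norm is at least the growth rate \<open>\<bar>r\<bar> \<tau> \<theta>\<close> of the path of \<open>\<theta>(r)\<close>, which is also an upper bound for the norm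
  over the representatives.\<close>

lemma \<mu>_\<eta>_bar: assumes \<theta>: "\<theta> \<in> \<Theta>" shows "cone.\<mu> (\<eta> (bar \<theta> r)) = \<kappa> (bar \<theta> r)"
proof (rule antisym)
  show "cone.\<mu> (\<eta> (bar \<theta> r)) \<le> \<kappa> (bar \<theta> r)"
    by (rule \<mu>_\<eta>_le[OF bar_K[OF \<theta>]])
  have b: "bar \<theta> r \<in> carrier (FR F)"
    using \<Theta>_F[OF \<theta>] by (rule cone.bar_FR)
  have "((\<lambda>t. \<nu> (cone.path (bar \<theta> r) t) / t) \<longlongrightarrow> \<bar>r\<bar> * \<tau> \<theta>) at_top"
    using G.stable_length_floor[OF \<Theta>_F[OF \<theta>], of r]
  proof (rule Lim_transform_eventually)
    show "eventually (\<lambda>t. \<nu> (\<theta> [^]\<^bsub>F\<^esub> \<lfloor>r * t\<rfloor>) / t = \<nu> (cone.path (bar \<theta> r) t) / t) at_top"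
      using eventually_gt_at_top[of 0] by eventually_elim (simp add: cone.path_bar \<Theta>_F[OF \<theta>])
  qed
  then have "\<bar>r\<bar> * \<tau> \<theta> \<le> cone.\<mu> (\<eta> (bar \<theta> r))"
    unfolding cone.\<mu>_eta[OF b] by (intro cone.C_norm_ge cone.path_C cone.fst_FR b)
  then show "\<kappa> (bar \<theta> r) \<le> cone.\<mu> (\<eta> (bar \<theta> r))"
    using \<kappa>_bar_le[OF \<theta>, of r] by simp
qed

sublocale \<xi>: group_hom "FR_sub (free_group A) \<Theta>"
  "asym_cone (free_group A) (conj_word_norm (free_group A) (free_gen ` A)) {0<..}"
  "eta (free_group A) (conj_word_norm (free_group A) (free_gen ` A))"
  by unfold_locales (rule K_hom_FR[OF cone.eta_hom])

lemma \<eta>_inj: "inj_on \<eta> (carrier K)"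
proof (rule inj_onI)
  fix x y assume x: "x \<in> carrier K" and y: "y \<in> carrier K" and eq: "\<eta> x = \<eta> y"
  define z where "z = inv\<^bsub>K\<^esub> x \<otimes>\<^bsub>K\<^esub> y"
  have z: "z \<in> carrier K"
    using x y by (simp add: z_def)
  have "\<eta> z = \<one>\<^bsub>cone.L\<^esub>"
    using x y eq by (simp add: z_def)
  then have "C_norm F \<nu> {0<..} (cone.path z) = 0"
    using cone.\<mu>_eta[OF K_FR[OF z]] cone.L.norm_one by simp
  then have "((\<lambda>t. \<nu> (cone.path z t) / t) \<longlongrightarrow> 0) at_top"
    by (intro cone.C_norm_0_sublinear cone.path_C cone.fst_FR K_FR z)
  then have "z = []"
    using sublinear_path_trivial z by (simp add: K_eq)
  then have "inv\<^bsub>K\<^esub> x \<otimes>\<^bsub>K\<^esub> y = \<one>\<^bsub>K\<^esub>"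
    by (simp add: z_def one_K)
  then show "x = y"
    using x y by (metis K.inv_equality K.inv_inv K.inv_closed)
qed

lemma L_d_\<eta>_le:
  assumes "x \<in> carrier K" "y \<in> carrier K" shows "cone.L.d (\<eta> x) (\<eta> y) \<le> K.d x y"
  using \<mu>_\<eta>_le[of "inv\<^bsub>K\<^esub> x \<otimes>\<^bsub>K\<^esub> y"] assms by (simp add: cone.L.d_eq K.d_eq)

end

section \<open>The continuous extension to the completion\<close>

context pure_representatives
begin

sublocale Seq: cauchy_group "FR_sub (free_group A) \<Theta>" "FR_sub (free_group A) \<Theta>"
  "FR_sub_norm (free_group A) \<Theta> (stable_length (free_group A) (conj_word_norm (free_group A) (free_gen ` A)))"
  "UNIV :: nat set" "\<lambda>_ x. x"
  by unfold_locales (auto simp: cofinal_UNIV hom_def)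

lemma cauchy_seqs_eq: "cauchy_seqs K \<kappa> = Seq.CG"
proof -
  have eq: "{s. range s \<subseteq> carrier K \<and> cauchy_along UNIV K.d s}
      = {s \<in> UNIV \<rightarrow>\<^sub>E carrier K. cauchy_along UNIV K.d s}"
    by auto
  show ?thesis
    unfolding cauchy_seqs_def Seq.CG_def eq ..
qed

lemma seq_norm_eq: "seq_norm \<kappa> = Seq.CN"
  by (rule ext) (simp add: seq_norm_def Seq.CN_def)

abbreviation "M \<equiv> completion K \<kappa>"
abbreviation "\<kappa>' \<equiv> completion_norm \<kappa>"

lemma completion_eq: "M = Seq.CG.Quot" and completion_norm_eq: "\<kappa>' = coset_norm Seq.CN"
  and completion_embed_eq: "completion_embed K \<kappa> g = Seq.CG.cls (\<lambda>_. g)"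
  by (simp_all add: completion_def Seq.CG.Quot_def completion_norm_def completion_embed_def
      Seq.CG.cls_def cauchy_seqs_eq seq_norm_eq)

sublocale M: pseudonormed_group "completion (FR_sub (free_group A) \<Theta>)
    (FR_sub_norm (free_group A) \<Theta> (stable_length (free_group A) (conj_word_norm (free_group A) (free_gen ` A))))"
  "completion_norm
    (FR_sub_norm (free_group A) \<Theta> (stable_length (free_group A) (conj_word_norm (free_group A) (free_gen ` A))))"
  using Seq.CG.pseudonormed_Quot by (simp add: completion_eq completion_norm_eq)

lemma M_Metric_space: "Metric_space (carrier M) M.d"
  using Seq.CG.Quot_Metric_space by (simp add: completion_eq completion_norm_eq)

lemma carrier_M: "carrier M = Seq.CG.cls ` carrier Seq.CG"
  by (simp add: completion_eq Seq.CG.carrier_Quot)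

lemma M_d_cls: "s \<in> carrier Seq.CG \<Longrightarrow> s' \<in> carrier Seq.CG \<Longrightarrow> M.d (Seq.CG.cls s) (Seq.CG.cls s') = Seq.CG.d s s'"
  using Seq.CG.d_cls by (simp add: completion_eq completion_norm_eq)

lemma \<kappa>'_cls: "s \<in> carrier Seq.CG \<Longrightarrow> \<kappa>' (Seq.CG.cls s) = Seq.CN s"
  by (simp add: completion_norm_eq Seq.CG.coset_norm_cls)

lemma Seq_mem: "s \<in> carrier Seq.CG \<Longrightarrow> s n \<in> carrier K"
  using Seq.CG_mem by simp

lemma Seq_d_tendsto:
  "s \<in> carrier Seq.CG \<Longrightarrow> s' \<in> carrier Seq.CG \<Longrightarrow> (\<lambda>n. K.d (s n) (s' n)) \<longlonglongrightarrow> Seq.CG.d s s'"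
  using Seq.d_CG_tendsto by simp

lemma const_Seq: "g \<in> carrier K \<Longrightarrow> (\<lambda>_. g) \<in> carrier Seq.CG"
  by (auto simp: Seq.carrier_CG_iff cauchy_along_def)

definition lim_in_cone where
  "lim_in_cone s l \<longleftrightarrow> l \<in> carrier cone.L \<and> (\<lambda>n. cone.L.d (\<eta> (s n)) l) \<longlonglongrightarrow> 0"

lemma \<eta>_L: "x \<in> carrier K \<Longrightarrow> \<eta> x \<in> carrier cone.L"
  by (rule cone.eta_closed[OF K_FR])

lemma lim_in_cone_d_le:
  assumes s: "s \<in> carrier Seq.CG" "s' \<in> carrier Seq.CG" and l: "lim_in_cone s l" "lim_in_cone s' l'"
  shows "cone.L.d l l' \<le> Seq.CG.d s s'"
proof (rule LIMSEQ_le_const)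
  show "(\<lambda>n. cone.L.d (\<eta> (s n)) l + K.d (s n) (s' n) + cone.L.d (\<eta> (s' n)) l') \<longlonglongrightarrow> Seq.CG.d s s'"
    using tendsto_add[OF tendsto_add[OF _ Seq_d_tendsto[OF s]], of "\<lambda>n. cone.L.d (\<eta> (s n)) l" 0
        "\<lambda>n. cone.L.d (\<eta> (s' n)) l'" 0] l by (simp add: lim_in_cone_def)
  have "cone.L.d l l' \<le> cone.L.d (\<eta> (s n)) l + K.d (s n) (s' n) + cone.L.d (\<eta> (s' n)) l'" for n
  proof -
    have "l \<in> carrier cone.L" "l' \<in> carrier cone.L" "\<eta> (s n) \<in> carrier cone.L" "\<eta> (s' n) \<in> carrier cone.L"
      using l s by (auto simp: lim_in_cone_def intro: \<eta>_L Seq_mem)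
    then show ?thesis
      using cone.L.d_triangle[of l "\<eta> (s n)" l'] cone.L.d_triangle[of "\<eta> (s n)" "\<eta> (s' n)" l']
        L_d_\<eta>_le[OF Seq_mem[OF s(1)] Seq_mem[OF s(2)], of n n] cone.L.d_sym[of l "\<eta> (s n)"] by linarith
  qed
  then show "\<exists>N. \<forall>n\<ge>N. cone.L.d l l'
      \<le> cone.L.d (\<eta> (s n)) l + K.d (s n) (s' n) + cone.L.d (\<eta> (s' n)) l'"
    by blast
qed

lemma lim_in_cone_unique:
  assumes "s \<in> carrier Seq.CG" "lim_in_cone s l" "lim_in_cone s l'" shows "l = l'"
proof (rule cone.L_d_0)
  show "cone.L.d l l' = 0"
    using lim_in_cone_d_le[OF assms(1,1,2,3)] cone.L.d_nonneg[of l l'] by simp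
qed (use assms in \<open>auto simp: lim_in_cone_def\<close>)

text \<open>The norm over the representatives is smaller than the one over the whole group, so \<open>s\<close> itself need not be Cauchy
  there. A subsequence with summable steps is taken, every step is replaced by an element with the same image in
  the cone and small norm over the group, and the partial products \<open>z\<close> of these are Cauchy.\<close>

lemma lim_in_cone_exists:
  assumes s: "s \<in> carrier Seq.CG" shows "\<exists>l. lim_in_cone s l"
proof -
  have "\<exists>b. \<forall>n\<ge>b. \<forall>m\<ge>b. K.d (s n) (s m) < (1 / 2) ^ k" for k :: nat
    using s unfolding Seq.carrier_CG_iff cauchy_along_def
    by (auto dest!: spec[of _ "(1 / 2) ^ k"])
  then obtain N where N: "\<And>k n m. N k \<le> n \<Longrightarrow> N k \<le> m \<Longrightarrow> K.d (s n) (s m) < (1 / 2) ^ k"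
    by metis
  define i where "i k = (\<Sum>j\<le>k. N j)" for k
  have i_ge: "N j \<le> i k" if "j \<le> k" for j k
    unfolding i_def using that by (intro member_le_sum) auto
  define step where "step k = inv\<^bsub>K\<^esub> (s (i k)) \<otimes>\<^bsub>K\<^esub> s (i (Suc k))" for k
  have step_K: "step k \<in> carrier K" for k
    using s by (simp add: step_def Seq_mem)
  have "\<kappa> (step k) < (1 / 2) ^ k" for k
    using N[of k "i k" "i (Suc k)"] i_ge[of k k] i_ge[of k "Suc k"] s
    by (simp add: step_def K.d_eq Seq_mem)
  then have "\<forall>k. \<exists>y. y \<in> carrier (FR F) \<and> FR_norm F \<nu> y < (1 / 2) ^ k \<and> \<eta> y = \<eta> (step k)"
    using \<kappa>_lift[OF step_K] by metis
  then obtain y where y: "\<And>k. y k \<in> carrier (FR F)" "\<And>k. FR_norm F \<nu> (y k) < (1 / 2) ^ k"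
    "\<And>k. \<eta> (y k) = \<eta> (step k)"
    by metis
  define z where "z = rec_nat (s (i 0)) (\<lambda>k x. x \<otimes>\<^bsub>FR F\<^esub> y k)"
  have z_simps: "z 0 = s (i 0)" "z (Suc k) = z k \<otimes>\<^bsub>FR F\<^esub> y k" for k
    by (simp_all add: z_def)
  have z: "z k \<in> carrier (FR F)" for k
    by (induction k) (use y s in \<open>auto simp: z_simps intro: K_FR Seq_mem\<close>)
  have \<eta>_z: "\<eta> (z k) = \<eta> (s (i k))" for k
  proof (induction k)
    case (Suc k)
    have "s (i k) \<otimes>\<^bsub>K\<^esub> step k = s (i (Suc k))"
      using s by (simp add: step_def Seq_mem)
    moreover have "\<eta> (z (Suc k)) = \<eta> (s (i k)) \<otimes>\<^bsub>cone.L\<^esub> \<eta> (step k)"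
      using Suc y z by (simp add: z_simps)
    ultimately show ?case
      using step_K s \<xi>.hom_mult[of "s (i k)" "step k"] by (simp add: Seq_mem)
  qed (simp add: z_simps)
  have z_step: "cone.FR.d (z k) (z (k + j)) \<le> 2 * (1 / 2) ^ k - 2 * (1 / 2) ^ (k + j)" for k j
  proof (induction j)
    case (Suc j)
    have "cone.FR.d (z (k + j)) (z (Suc (k + j))) = FR_norm F \<nu> (y (k + j))"
      using z y by (simp add: z_simps cone.FR.d_eq)
    then have "cone.FR.d (z k) (z (k + Suc j)) \<le> 2 * (1 / 2) ^ k - 2 * (1 / 2) ^ (k + j) + (1 / 2) ^ (k + j)"
      using Suc cone.FR.d_triangle[OF z[of k] z[of "k + j"] z[of "Suc (k + j)"]] y(2)[of "k + j"] by simp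
    then show ?case
      by simp
  qed simp
  have z_cauchy: "cauchy_along UNIV cone.FR.d z"
    unfolding cauchy_along_def
  proof (intro allI impI)
    fix \<epsilon> :: real assume "\<epsilon> > 0"
    then obtain b where b: "(1 / 2) ^ b < \<epsilon> / 4"
      using real_arch_pow_inv[of "\<epsilon> / 4" "1 / 2"] by auto
    have near: "cone.FR.d (z b) (z n) < \<epsilon> / 2" if bn: "b \<le> n" for n
    proof -
      obtain j where j: "n = b + j"
        using le_Suc_ex[OF bn] by blast
      have "(1 / 2 :: real) ^ (b + j) > 0"
        by simp
      then show ?thesis
        unfolding j using z_step[of b j] b by linarith
    qed
    show "\<exists>b. \<forall>n\<in>UNIV. \<forall>m\<in>UNIV. b \<le> n \<longrightarrow> b \<le> m \<longrightarrow> cone.FR.d (z n) (z m) < \<epsilon>"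
    proof (intro exI[of _ b] ballI impI)
      fix n m assume "b \<le> n" "b \<le> m"
      then show "cone.FR.d (z n) (z m) < \<epsilon>"
        using near[of n] near[of m] cone.FR.d_triangle[OF z[of n] z[of b] z[of m]]
        by (simp add: cone.FR.d_sym[of "z n"])
    qed
  qed
  obtain l where l: "l \<in> carrier cone.L" "(\<lambda>k. cone.L.d (\<eta> (z k)) l) \<longlonglongrightarrow> 0"
    by (rule cone.eta_cauchy_limit[OF z z_cauchy])
  have "(\<lambda>n. cone.L.d (\<eta> (s n)) l) \<longlonglongrightarrow> 0"
  proof (rule LIMSEQ_I)
    fix \<epsilon> :: real assume "\<epsilon> > 0"
    then obtain k where k: "(1 / 2) ^ k < \<epsilon> / 2"
      using real_arch_pow_inv[of "\<epsilon> / 2" "1 / 2"] by auto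
    obtain k' where k': "\<And>j. k' \<le> j \<Longrightarrow> cone.L.d (\<eta> (z j)) l < \<epsilon> / 2"
      using LIMSEQ_D[OF l(2), of "\<epsilon> / 2"] \<open>\<epsilon> > 0\<close> by (auto simp: cone.L.d_nonneg)
    define j where "j = max k k'"
    have "cone.L.d (\<eta> (s n)) l < \<epsilon>" if "N k \<le> n" for n
    proof -
      have "cone.L.d (\<eta> (s n)) (\<eta> (s (i j))) \<le> K.d (s n) (s (i j))"
        by (rule L_d_\<eta>_le) (use s in \<open>auto intro: Seq_mem\<close>)
      also have "\<dots> < (1 / 2) ^ k"
        using that i_ge[of k j] by (intro N) (auto simp: j_def)
      finally have "cone.L.d (\<eta> (s n)) (\<eta> (s (i j))) < \<epsilon> / 2"
        using k by simp
      moreover have "cone.L.d (\<eta> (s (i j))) l < \<epsilon> / 2"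
        using k'[of j] by (simp add: j_def \<eta>_z)
      ultimately show ?thesis
        using cone.L.d_triangle[OF \<eta>_L[OF Seq_mem[OF s]] \<eta>_L[OF Seq_mem[OF s]] l(1), of n "i j"] by simp
    qed
    then show "\<exists>no. \<forall>n\<ge>no. norm (cone.L.d (\<eta> (s n)) l - 0) < \<epsilon>"
      by (auto simp: cone.L.d_nonneg)
  qed
  with l(1) show ?thesis
    by (auto simp: lim_in_cone_def)
qed

abbreviation "\<xi> \<equiv> restrict \<eta> (carrier K)"

abbreviation "extension \<equiv> continuous_extension K \<kappa> cone.L cone.\<mu> \<xi>"

lemma norm_topology_continuous_iff:
  "continuous_map (norm_topology M \<kappa>') (norm_topology cone.L cone.\<mu>) f \<longleftrightarrow>
    f ` carrier M \<subseteq> carrier cone.L \<and>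
    (\<forall>X\<in>carrier M. \<forall>\<epsilon>>0. \<exists>\<delta>>0. \<forall>Y. Y \<in> carrier M \<and> M.d X Y < \<delta> \<longrightarrow> cone.L.d (f X) (f Y) < \<epsilon>)"
  unfolding norm_topology_def
  by (rule Metric_space.metric_continuous_map[OF M_Metric_space cone.L_Metric_space])

lemma embed_tendsto:
  assumes s: "s \<in> carrier Seq.CG"
  shows "(\<lambda>n. M.d (Seq.CG.cls s) (completion_embed K \<kappa> (s n))) \<longlonglongrightarrow> 0"
proof (rule LIMSEQ_I)
  fix \<epsilon> :: real assume "\<epsilon> > 0"
  then have "\<epsilon> / 2 > 0" by simp
  then obtain b where b: "\<And>n m. b \<le> n \<Longrightarrow> b \<le> m \<Longrightarrow> K.d (s n) (s m) < \<epsilon> / 2"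
    using s unfolding Seq.carrier_CG_iff cauchy_along_def by blast
  have "M.d (Seq.CG.cls s) (completion_embed K \<kappa> (s n)) \<le> \<epsilon> / 2" if "b \<le> n" for n
  proof -
    have "Seq.CG.d s (\<lambda>_. s n) \<le> \<epsilon> / 2"
      by (rule LIMSEQ_le_const2[OF Seq_d_tendsto[OF s const_Seq[OF Seq_mem[OF s]]]])
        (use b that in \<open>auto intro!: exI[of _ b] less_imp_le\<close>)
    then show ?thesis
      using s by (simp add: completion_embed_eq M_d_cls const_Seq Seq_mem)
  qed
  then show "\<exists>no. \<forall>n\<ge>no. norm (M.d (Seq.CG.cls s) (completion_embed K \<kappa> (s n)) - 0) < \<epsilon>"
    using \<open>\<epsilon> > 0\<close> by (intro exI[of _ b]) (fastforce simp: M.d_nonneg)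
qed

text \<open>A class in the completion is the limit of the embedded terms of the sequence, so a continuous extension has no
  choice. This is the uniqueness on which the last claim of the theorem rests.\<close>

lemma extension_lim:
  assumes f: "extension f" and s: "s \<in> carrier Seq.CG"
  shows "lim_in_cone s (f (Seq.CG.cls s))"
proof -
  have cls: "Seq.CG.cls s \<in> carrier M"
    using s by (simp add: carrier_M)
  have cont: "f ` carrier M \<subseteq> carrier cone.L"
    "\<And>\<epsilon>. \<epsilon> > 0 \<Longrightarrow> \<exists>\<delta>>0. \<forall>Y. Y \<in> carrier M \<and> M.d (Seq.CG.cls s) Y < \<delta> \<longrightarrow>
      cone.L.d (f (Seq.CG.cls s)) (f Y) < \<epsilon>"
    using f cls unfolding continuous_extension_def norm_topology_continuous_iff by blast+
  have "(\<lambda>n. cone.L.d (\<eta> (s n)) (f (Seq.CG.cls s))) \<longlonglongrightarrow> 0"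
  proof (rule LIMSEQ_I)
    fix \<epsilon> :: real assume "\<epsilon> > 0"
    then obtain \<delta> where \<delta>: "\<delta> > 0" "\<And>Y. Y \<in> carrier M \<Longrightarrow> M.d (Seq.CG.cls s) Y < \<delta> \<Longrightarrow>
        cone.L.d (f (Seq.CG.cls s)) (f Y) < \<epsilon>"
      using cont(2) by blast
    obtain b where b: "\<And>n. b \<le> n \<Longrightarrow> M.d (Seq.CG.cls s) (completion_embed K \<kappa> (s n)) < \<delta>"
      using LIMSEQ_D[OF embed_tendsto[OF s] \<delta>(1)] by (auto simp: M.d_nonneg)
    have "cone.L.d (\<eta> (s n)) (f (Seq.CG.cls s)) < \<epsilon>" if "b \<le> n" for n
    proof -
      have "f (completion_embed K \<kappa> (s n)) = \<eta> (s n)"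
        using f Seq_mem[OF s] by (simp add: continuous_extension_def)
      moreover have "completion_embed K \<kappa> (s n) \<in> carrier M"
        using const_Seq[OF Seq_mem[OF s]] by (simp add: completion_embed_eq carrier_M)
      ultimately show ?thesis
        using \<delta>(2) b[OF that] cone.L.d_sym by metis
    qed
    then show "\<exists>no. \<forall>n\<ge>no. norm (cone.L.d (\<eta> (s n)) (f (Seq.CG.cls s)) - 0) < \<epsilon>"
      by (auto simp: cone.L.d_nonneg)
  qed
  moreover have "f (Seq.CG.cls s) \<in> carrier cone.L"
    using cont(1) cls by blast
  ultimately show ?thesis
    by (simp add: lim_in_cone_def)
qed

text \<open>The limit of images does not depend on the chosen sequence and is 1-Lipschitz in it.\<close>

lemma extension_exists: "\<exists>f. extension f"
proof -
  define f where "f X = (SOME l. \<exists>s\<in>carrier Seq.CG. Seq.CG.cls s = X \<and> lim_in_cone s l)" for X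
  have f: "\<exists>s'\<in>carrier Seq.CG. Seq.CG.cls s' = Seq.CG.cls s \<and> lim_in_cone s' (f (Seq.CG.cls s))"
    if "s \<in> carrier Seq.CG" for s
    unfolding f_def by (rule someI_ex) (use lim_in_cone_exists[OF that] that in blast)
  have f_eq: "f (Seq.CG.cls s) = l" if s: "s \<in> carrier Seq.CG" and l: "lim_in_cone s l" for s l
  proof -
    obtain s' where s': "s' \<in> carrier Seq.CG" "Seq.CG.cls s' = Seq.CG.cls s"
      "lim_in_cone s' (f (Seq.CG.cls s))"
      using f[OF s] by blast
    have "Seq.CG.d s' s = 0"
      using s' s by (simp add: Seq.CG.cls_eq_iff)
    then have "cone.L.d (f (Seq.CG.cls s)) l = 0"
      using lim_in_cone_d_le[OF s'(1) s s'(3) l] cone.L.d_nonneg[of "f (Seq.CG.cls s)" l] by simp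
    then show ?thesis
      using s'(3) l by (intro cone.L_d_0) (auto simp: lim_in_cone_def)
  qed
  have f_lim: "lim_in_cone s (f (Seq.CG.cls s))" if "s \<in> carrier Seq.CG" for s
    using lim_in_cone_exists[OF that] f_eq[OF that] by auto
  have f_image: "f ` carrier M \<subseteq> carrier cone.L"
    using f_lim by (auto simp: carrier_M lim_in_cone_def)
  have "cone.L.d (f X) (f Y) \<le> M.d X Y" if "X \<in> carrier M" "Y \<in> carrier M" for X Y
  proof -
    obtain s s' where "s \<in> carrier Seq.CG" "s' \<in> carrier Seq.CG" "X = Seq.CG.cls s" "Y = Seq.CG.cls s'"
      using \<open>X \<in> carrier M\<close> \<open>Y \<in> carrier M\<close> by (auto simp: carrier_M)
    then show ?thesis
      using lim_in_cone_d_le[OF _ _ f_lim f_lim] by (simp add: M_d_cls)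
  qed
  then have f_cont: "\<forall>X\<in>carrier M. \<forall>\<epsilon>>0. \<exists>\<delta>>0. \<forall>Y. Y \<in> carrier M \<and> M.d X Y < \<delta> \<longrightarrow> cone.L.d (f X) (f Y) < \<epsilon>"
    by (meson le_less_trans)
  have f_embed: "f (completion_embed K \<kappa> g) = \<xi> g" if g: "g \<in> carrier K" for g
  proof -
    have "lim_in_cone (\<lambda>_. g) (\<eta> g)"
      using \<eta>_L[OF g] by (simp add: lim_in_cone_def)
    then show ?thesis
      using f_eq[OF const_Seq[OF g]] g by (simp add: completion_embed_eq)
  qed
  have "extension f"
    unfolding continuous_extension_def norm_topology_continuous_iff
  proof (intro conjI ballI)
    show "f ` carrier M \<subseteq> carrier cone.L"
      by (rule f_image)
    show "\<forall>\<epsilon>>0. \<exists>\<delta>>0. \<forall>Y. Y \<in> carrier M \<and> M.d X Y < \<delta> \<longrightarrow> cone.L.d (f X) (f Y) < \<epsilon>"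
      if "X \<in> carrier M" for X
      using f_cont that by blast
    show "f (completion_embed K \<kappa> g) = \<xi> g" if "g \<in> carrier K" for g
      by (rule f_embed[OF that])
  qed
  then show ?thesis
    by (rule exI[of extension f])
qed

lemma extension_hom:
  assumes f: "extension f" shows "f \<in> hom M cone.L"
proof (rule homI)
  show fL: "f X \<in> carrier cone.L" if "X \<in> carrier M" for X
    using extension_lim[OF f] that by (auto simp: carrier_M lim_in_cone_def)
  fix X Y assume XY: "X \<in> carrier M" "Y \<in> carrier M"
  obtain s s' where s: "s \<in> carrier Seq.CG" "s' \<in> carrier Seq.CG" "X = Seq.CG.cls s" "Y = Seq.CG.cls s'"
    using XY by (auto simp: carrier_M)
  have "lim_in_cone (s \<otimes>\<^bsub>Seq.CG\<^esub> s') (f X \<otimes>\<^bsub>cone.L\<^esub> f Y)"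
    unfolding lim_in_cone_def
  proof
    show "f X \<otimes>\<^bsub>cone.L\<^esub> f Y \<in> carrier cone.L"
      using fL XY by simp
    show "(\<lambda>n. cone.L.d (\<eta> ((s \<otimes>\<^bsub>Seq.CG\<^esub> s') n)) (f X \<otimes>\<^bsub>cone.L\<^esub> f Y)) \<longlonglongrightarrow> 0"
    proof (rule tendsto_sandwich[OF _ _ tendsto_const])
      show "(\<lambda>n. cone.L.d (\<eta> (s n)) (f X) + cone.L.d (\<eta> (s' n)) (f Y)) \<longlonglongrightarrow> 0"
        using tendsto_add[of "\<lambda>n. cone.L.d (\<eta> (s n)) (f X)" 0 sequentially "\<lambda>n. cone.L.d (\<eta> (s' n)) (f Y)" 0]
          extension_lim[OF f s(1)] extension_lim[OF f s(2)] s by (simp add: lim_in_cone_def)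
      have "cone.L.d (\<eta> ((s \<otimes>\<^bsub>Seq.CG\<^esub> s') n)) (f X \<otimes>\<^bsub>cone.L\<^esub> f Y)
          \<le> cone.L.d (\<eta> (s n)) (f X) + cone.L.d (\<eta> (s' n)) (f Y)" for n
      proof -
        have "\<eta> ((s \<otimes>\<^bsub>Seq.CG\<^esub> s') n) = \<eta> (s n) \<otimes>\<^bsub>cone.L\<^esub> \<eta> (s' n)"
          using Seq_mem[OF s(1)] Seq_mem[OF s(2)] by (simp add: Seq.mult_CG)
        then show ?thesis
          using cone.L.d_mult[OF \<eta>_L \<eta>_L fL fL, OF Seq_mem[OF s(1)] Seq_mem[OF s(2)] XY] by simp
      qed
      then show "\<forall>\<^sub>F n in sequentially. cone.L.d (\<eta> ((s \<otimes>\<^bsub>Seq.CG\<^esub> s') n)) (f X \<otimes>\<^bsub>cone.L\<^esub> f Y)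
          \<le> cone.L.d (\<eta> (s n)) (f X) + cone.L.d (\<eta> (s' n)) (f Y)"
        by simp
    qed (simp add: cone.L.d_nonneg)
  qed
  moreover have "lim_in_cone (s \<otimes>\<^bsub>Seq.CG\<^esub> s') (f (Seq.CG.cls (s \<otimes>\<^bsub>Seq.CG\<^esub> s')))"
    using s by (intro extension_lim f) auto
  ultimately have "f (Seq.CG.cls (s \<otimes>\<^bsub>Seq.CG\<^esub> s')) = f X \<otimes>\<^bsub>cone.L\<^esub> f Y"
    using s by (intro lim_in_cone_unique[of "s \<otimes>\<^bsub>Seq.CG\<^esub> s'"]) auto
  then show "f (X \<otimes>\<^bsub>M\<^esub> Y) = f X \<otimes>\<^bsub>cone.L\<^esub> f Y"
    using s by (simp add: completion_eq)
qed

text \<open>Sampling a Cauchy function at the integers gives a Cauchy sequence over the representatives, with at most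
  the same norm, whose limit is the class of the function.\<close>

lemma extension_section:
  assumes f: "extension f" and w: "w \<in> carrier cone.D.CG"
  shows "\<exists>X\<in>carrier M. f X = cone.C.cls (cone.\<pi> w) \<and> \<kappa>' X \<le> cone.D.CN w"
proof -
  define y where "y n = psi F (1 / real (Suc n)) (w (real (Suc n)))" for n
  have y: "y n \<in> carrier (FR F)" for n
    unfolding y_def using cone.D.CG_mem[OF w, of "real (Suc n)"] by auto
  define s where "s n = \<sigma> (y n)" for n
  have s_K: "s n \<in> carrier K" for n
    unfolding s_def by (rule \<sigma>_closed[OF y])
  have Suc_top: "filterlim (\<lambda>n. real (Suc n)) at_top sequentially"
    by (rule filterlim_compose[OF filterlim_real_sequentially filterlim_Suc])
  have Suc_along: "filterlim (\<lambda>n. real (Suc n)) (along {0<..}) sequentially"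
    using Suc_top by (simp add: filterlim_inf filterlim_principal)
  have d_s: "K.d (s n) (s m) \<le> cone.FR.d (y n) (y m)" for n m
  proof -
    interpret \<sigma>: group_hom "FR F" K \<sigma> by unfold_locales (rule \<sigma>_hom)
    have "inv\<^bsub>K\<^esub> (s n) \<otimes>\<^bsub>K\<^esub> s m = \<sigma> (inv\<^bsub>FR F\<^esub> (y n) \<otimes>\<^bsub>FR F\<^esub> y m)"
      using y by (simp add: s_def)
    then show ?thesis
      using \<kappa>_\<sigma>_le[of "inv\<^bsub>FR F\<^esub> (y n) \<otimes>\<^bsub>FR F\<^esub> y m"] y s_K by (simp add: K.d_eq cone.FR.d_eq)
  qed
  have "cauchy_along UNIV K.d s"
    unfolding cauchy_along_def
  proof (intro allI impI)
    fix \<epsilon> :: real assume "\<epsilon> > 0"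
    have w_cauchy: "cauchy_along {0<..} cone.FR.d (\<lambda>t. psi F (1 / t) (w t))"
      using w by (simp add: cone.D.carrier_CG_iff)
    obtain b where "b \<in> {0<..}" and b: "\<And>t t'. t \<in> {0<..} \<Longrightarrow> t' \<in> {0<..} \<Longrightarrow> b \<le> t \<Longrightarrow> b \<le> t' \<Longrightarrow>
        cone.FR.d (psi F (1 / t) (w t)) (psi F (1 / t') (w t')) < \<epsilon>"
      using cauchy_alongD[OF cofinal_pos w_cauchy \<open>\<epsilon> > 0\<close>] by blast
    obtain N :: nat where N: "b \<le> real N"
      using real_arch_simple by blast
    have "K.d (s n) (s m) < \<epsilon>" if "N \<le> n" "N \<le> m" for n m
    proof -
      have "cone.FR.d (y n) (y m) < \<epsilon>"
        unfolding y_def by (rule b) (use that N in auto)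
      with d_s[of n m] show ?thesis
        by simp
    qed
    then show "\<exists>b. \<forall>n\<in>UNIV. \<forall>m\<in>UNIV. b \<le> n \<longrightarrow> b \<le> m \<longrightarrow> K.d (s n) (s m) < \<epsilon>"
      by blast
  qed
  then have s: "s \<in> carrier Seq.CG"
    using s_K by (auto simp: Seq.carrier_CG_iff)
  have "lim_in_cone s (cone.C.cls (cone.\<pi> w))"
    unfolding lim_in_cone_def
  proof
    show "cone.C.cls (cone.\<pi> w) \<in> carrier cone.L"
      using w by (simp add: cone.carrier_L)
    show "(\<lambda>n. cone.L.d (\<eta> (s n)) (cone.C.cls (cone.\<pi> w))) \<longlonglongrightarrow> 0"
    proof (rule LIMSEQ_I)
      fix \<epsilon> :: real assume "\<epsilon> > 0"
      then have "\<epsilon> / 2 > 0" by simp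
      from cone.cls_approx[OF w this] obtain b where b: "\<And>t. b \<le> t \<Longrightarrow>
          cone.L.d (cone.C.cls (cone.\<pi> w)) (\<eta> (psi F (1 / t) (w t))) \<le> \<epsilon> / 2"
        by blast
      obtain N :: nat where N: "b \<le> real N"
        using real_arch_simple by blast
      have "cone.L.d (\<eta> (s n)) (cone.C.cls (cone.\<pi> w)) \<le> \<epsilon> / 2" if "N \<le> n" for n
      proof -
        have "cone.L.d (cone.C.cls (cone.\<pi> w)) (\<eta> (y n)) \<le> \<epsilon> / 2"
          unfolding y_def by (rule b) (use that N in auto)
        then show ?thesis
          by (simp add: s_def \<eta>_\<sigma>[OF y] cone.L.d_sym[of _ "cone.C.cls (cone.\<pi> w)"])
      qed
      then show "\<exists>no. \<forall>n\<ge>no. norm (cone.L.d (\<eta> (s n)) (cone.C.cls (cone.\<pi> w)) - 0) < \<epsilon>"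
        using \<open>\<epsilon> > 0\<close> by (intro exI[of _ N]) (fastforce simp: cone.L.d_nonneg)
    qed
  qed
  then have "f (Seq.CG.cls s) = cone.C.cls (cone.\<pi> w)"
    using lim_in_cone_unique[OF s extension_lim[OF f s]] by simp
  moreover have "Seq.CN s \<le> cone.D.CN w"
  proof (rule LIMSEQ_le)
    show "(\<lambda>n. \<kappa> (s n)) \<longlonglongrightarrow> Seq.CN s"
      using Seq.CN_tendsto[OF s] by simp
    show "(\<lambda>n. FR_norm F \<nu> (y n)) \<longlonglongrightarrow> cone.D.CN w"
      unfolding y_def by (rule filterlim_compose[OF cone.D.CN_tendsto[OF w] Suc_along])
    show "\<exists>N. \<forall>n\<ge>N. \<kappa> (s n) \<le> FR_norm F \<nu> (y n)"
      using \<kappa>_\<sigma>_le[OF y] by (auto simp: s_def)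
  qed
  ultimately show ?thesis
    using s by (intro bexI[of _ "Seq.CG.cls s"]) (auto simp: \<kappa>'_cls carrier_M)
qed

lemma extension_norm_le:
  assumes f: "extension f" and X: "X \<in> carrier M" shows "cone.\<mu> (f X) \<le> \<kappa>' X"
proof -
  obtain s where s: "s \<in> carrier Seq.CG" "X = Seq.CG.cls s"
    using X by (auto simp: carrier_M)
  have lim: "lim_in_cone s (f X)"
    using extension_lim[OF f s(1)] s(2) by simp
  have "cone.\<mu> (f X) \<le> Seq.CN s + 0"
  proof (rule LIMSEQ_le_const)
    show "(\<lambda>n. \<kappa> (s n) + cone.L.d (\<eta> (s n)) (f X)) \<longlonglongrightarrow> Seq.CN s + 0"
      using Seq.CN_tendsto[OF s(1)] lim by (intro tendsto_add) (auto simp: lim_in_cone_def)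
    have "cone.\<mu> (f X) \<le> \<kappa> (s n) + cone.L.d (\<eta> (s n)) (f X)" for n
      using cone.L.norm_diff_le[OF \<eta>_L[OF Seq_mem[OF s(1)]], of "f X" n] lim \<mu>_\<eta>_le[OF Seq_mem[OF s(1)], of n]
      by (simp add: lim_in_cone_def)
    then show "\<exists>N. \<forall>n\<ge>N. cone.\<mu> (f X) \<le> \<kappa> (s n) + cone.L.d (\<eta> (s n)) (f X)"
      by blast
  qed
  then show ?thesis
    using s by (simp add: \<kappa>'_cls)
qed

lemma extension_metric_quotient:
  assumes f: "extension f" shows "metric_quotient M \<kappa>' cone.L cone.\<mu> f"
  unfolding metric_quotient_def
proof (intro conjI ballI M.group_axioms M.conj_inv cone.L.group_axioms cone.L.conj_inv extension_hom f)
  have fL: "f X \<in> carrier cone.L" if "X \<in> carrier M" for X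
    using extension_hom[OF f] that by (auto simp: hom_def)
  show surj: "f ` carrier M = carrier cone.L"
  proof
    show "carrier cone.L \<subseteq> f ` carrier M"
      using extension_section[OF f] unfolding cone.carrier_L by force
  qed (use fL in auto)
  fix l assume l: "l \<in> carrier cone.L"
  have bdd: "bdd_below (\<kappa>' ` {X \<in> carrier M. f X = l})"
    by (rule bdd_belowI2[where m = 0]) (auto intro: M.norm_nonneg)
  show "cone.\<mu> l = Inf (\<kappa>' ` {X \<in> carrier M. f X = l})"
  proof (rule antisym)
    have "{X \<in> carrier M. f X = l} \<noteq> {}"
      using l unfolding surj[symmetric] by blast
    then show "cone.\<mu> l \<le> Inf (\<kappa>' ` {X \<in> carrier M. f X = l})"
      using extension_norm_le[OF f] by (intro cInf_greatest) auto
    show "Inf (\<kappa>' ` {X \<in> carrier M. f X = l}) \<le> cone.\<mu> l"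
    proof (rule field_le_epsilon)
      fix \<epsilon> :: real assume \<epsilon>: "\<epsilon> > 0"
      obtain g where g: "g \<in> carrier cone.C" "l = cone.C.cls g"
        using l by (auto simp: cone.carrier_L cone.carrier_C)
      then have "C_norm F \<nu> {0<..} g < cone.\<mu> l + \<epsilon>"
        using \<epsilon> by (simp add: cone.\<mu>_cls)
      then obtain w where w: "w \<in> carrier cone.D.CG" "cone.\<pi> w = g" "cone.D.CN w < cone.\<mu> l + \<epsilon>"
        using cone.C_quotient(3)[OF g(1)] by blast
      obtain X where X: "X \<in> carrier M" "f X = l" "\<kappa>' X \<le> cone.D.CN w"
        using extension_section[OF f w(1)] w(2) g(2) by blast
      have "Inf (\<kappa>' ` {X \<in> carrier M. f X = l}) \<le> \<kappa>' X"
        using X by (intro cInf_lower bdd) auto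
      then show "Inf (\<kappa>' ` {X \<in> carrier M. f X = l}) \<le> cone.\<mu> l + \<epsilon>"
        using X(3) w(3) by simp
    qed
  qed
qed

lemma \<xi>_dense: "norm_topology cone.L cone.\<mu> closure_of (\<xi> ` carrier K) = carrier cone.L"
proof -
  have "\<exists>y\<in>\<xi> ` carrier K. y \<in> Metric_space.mball (carrier cone.L) cone.L.d l r"
    if l: "l \<in> carrier cone.L" and r: "r > 0" for l r
  proof -
    obtain w where w: "w \<in> carrier cone.D.CG" "l = cone.C.cls (cone.\<pi> w)"
      using l by (auto simp: cone.carrier_L)
    have "r / 2 > 0"
      using r by simp
    from cone.cls_approx[OF w(1) this] obtain b where "b \<in> {0<..}"
      "\<And>t. b \<le> t \<Longrightarrow> cone.L.d (cone.C.cls (cone.\<pi> w)) (\<eta> (psi F (1 / t) (w t))) \<le> r / 2"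
      by blast
    then have b: "b \<in> {0<..}" "cone.L.d l (\<eta> (psi F (1 / b) (w b))) \<le> r / 2"
      unfolding w(2) by blast+
    define y where "y = psi F (1 / b) (w b)"
    have y: "y \<in> carrier (FR F)"
      unfolding y_def using cone.D.CG_mem[OF w(1) b(1)] by auto
    have "\<eta> y = \<xi> (\<sigma> y)"
      using \<sigma>_closed[OF y] by (simp add: \<eta>_\<sigma>[OF y])
    then have "\<eta> y \<in> \<xi> ` carrier K"
      using \<sigma>_closed[OF y] by blast
    moreover have "\<eta> y \<in> Metric_space.mball (carrier cone.L) cone.L.d l r"
      using b(2) r l cone.eta_closed[OF y]
      by (simp add: Metric_space.in_mball[OF cone.L_Metric_space] y_def)
    ultimately show ?thesis by blast
  qed
  then show ?thesis
    unfolding norm_topology_def Metric_space.metric_closure_of[OF cone.L_Metric_space] by blast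
qed

lemma representation_of_cone:
  "group_hom K cone.L \<xi> \<and> inj_on \<xi> (carrier K) \<and>
    norm_topology cone.L cone.\<mu> closure_of (\<xi> ` carrier K) = carrier cone.L \<and>
    lipschitz_hom 1 K \<kappa> cone.L cone.\<mu> \<xi> \<and>
    (\<forall>\<theta>\<in>\<Theta>. \<forall>r. cone.\<mu> (\<xi> (bar \<theta> r)) = \<kappa> (bar \<theta> r)) \<and>
    (\<exists>f. extension f) \<and> (\<forall>f. extension f \<longrightarrow> metric_quotient M \<kappa>' cone.L cone.\<mu> f)"
proof (intro conjI ballI allI impI)
  have hom: "\<xi> \<in> hom K cone.L"
    using \<xi>.homh K.m_closed by (auto simp: hom_def)
  show "group_hom K cone.L \<xi>"
    by unfold_locales (rule hom)
  show "inj_on \<xi> (carrier K)"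
    using \<eta>_inj by (simp add: inj_on_def)
  show "lipschitz_hom 1 K \<kappa> cone.L cone.\<mu> \<xi>"
    using hom \<mu>_\<eta>_le by (simp add: lipschitz_hom_def)
  show "cone.\<mu> (\<xi> (bar \<theta> r)) = \<kappa> (bar \<theta> r)" if "\<theta> \<in> \<Theta>" for \<theta> r
    using \<mu>_\<eta>_bar[OF that] bar_K[OF that] by simp
qed (rule \<xi>_dense extension_exists extension_metric_quotient; assumption?)+

end

theorem theorem11p4:
  fixes A :: "'a set" and \<Theta> :: "('a \<times> bool) list set"
  assumes "\<And>\<theta>. \<theta> \<in> \<Theta> \<Longrightarrow> pure_elem (free_group A) \<theta> \<and> cyclically_reduced \<theta>"
    and "\<And>g. pure_elem (free_group A) g \<Longrightarrow> \<exists>!\<theta>. \<theta> \<in> \<Theta> \<and> conj_or_inv (free_group A) g \<theta>"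
  shows
    "let G = free_group A;
         \<nu> = conj_word_norm G (free_gen ` A);
         \<tau> = stable_length G \<nu>;
         K = FR_sub G \<Theta>;
         \<kappa> = FR_sub_norm G \<Theta> \<tau>;
         L = asym_cone G \<nu> {0<..};
         \<mu> = cone_norm G \<nu> {0<..};
         \<xi> = restrict (eta G \<nu>) (carrier K)
     in group_hom K L \<xi> \<and> inj_on \<xi> (carrier K) \<and>
        norm_topology L \<mu> closure_of (\<xi> ` carrier K) = carrier L \<and>
        lipschitz_hom 1 K \<kappa> L \<mu> \<xi> \<and>
        (\<forall>\<theta>\<in>\<Theta>. \<forall>r. \<mu> (\<xi> (bar \<theta> r)) = \<kappa> (bar \<theta> r)) \<and>
        (\<exists>\<xi>h. continuous_extension K \<kappa> L \<mu> \<xi> \<xi>h) \<and>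
        (\<forall>\<xi>h. continuous_extension K \<kappa> L \<mu> \<xi> \<xi>h \<longrightarrow>
           metric_quotient (completion K \<kappa>) (completion_norm \<kappa>) L \<mu> \<xi>h)"
proof -
  interpret F: group "free_group A" by (rule group_free_group)
  interpret pure_representatives A \<Theta>
  proof
    fix \<theta> \<theta>' assume \<theta>: "\<theta> \<in> \<Theta>" "\<theta>' \<in> \<Theta>" and eq: "conj_or_inv (free_group A) \<theta> \<theta>'"
    have pure: "pure_elem (free_group A) \<theta>"
      using assms(1) \<theta>(1) by blast
    then have "\<theta> = \<one>\<^bsub>free_group A\<^esub> \<otimes>\<^bsub>free_group A\<^esub> \<theta> \<otimes>\<^bsub>free_group A\<^esub> inv\<^bsub>free_group A\<^esub> \<one>\<^bsub>free_group A\<^esub>"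
      by (simp add: pure_elem_def)
    then have "conj_or_inv (free_group A) \<theta> \<theta>"
      unfolding conj_or_inv_def using F.one_closed by blast
    with assms(2)[OF pure] \<theta> eq show "\<theta> = \<theta>'"
      by blast
  qed (use assms in blast)+
  show ?thesis
    unfolding Let_def by (rule representation_of_cone)
qed

end
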